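(* There is an absolute constant $b_0>1$ such that the following holds for all $0<\kappa<1$, $\epsilon>0$, and $\delta\le\frac14 b_0^{-1/\epsilon}$. For every constant $C_1>0$ there is a constant $C_2>0$, depending only on $C_1$, such that: if $p$ is a prime, $A,X,B\subseteq\mathbb{F}_p$ satisfy $A\subseteq X+B$, $|B+B|\le\sigma|B|$, $|B|\ge p^{\epsilon}$, and $|X|\le C_1\frac{|A|}{|B|}|B|^{\kappa}$, and $\rho\in\mathbb{F}_p$ is non-zero, then $$|A\cap\rho A^{-1}|\ \le\ C_2\max\left(\frac{\sigma^2|A|^2|B|^{2\kappa}}{p},\ \frac{\sigma|A||B|^{\kappa}}{p^{\delta}}\right).$$
   Context: For subsets $X,Y$ of $\mathbb{F}_p$, $X+Y=\{x+y: x\in X,\,y\in Y\}$. The set $A\cap\rho A^{-1}$ consists of the non-zero $a\in A$ with $\rho a^{-1}\in A$, so $|A\cap\rho A^{-1}|=|\{(a,a')\in A\times A: aa'=\rho\}|$. Here $\sigma$ is a real parameter. *)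

theory Defs
  imports Complex_Main "HOL-Number_Theory.Residues" "HOL-Algebra.AbelCoset"
begin

text \<open>
  The prime has to be bound inside the statement, after the constants. So the field with
  \<open>p\<close> elements is rendered as a record with explicit carrier \<open>{0..p - 1}\<close> rather than as a type
  determined by \<open>p\<close>. Sumsets are the library's \<open>set_add\<close>.
\<close>

abbreviation prime_field :: "nat \<Rightarrow> int ring" where
  "prime_field p \<equiv> residue_ring (int p)"

text \<open>\<open>scaled_inverse_set R \<rho> A\<close> is $\rho A^{-1}$; zero has no inverse and is left out.\<close>

definition scaled_inverse_set :: "('a, 'b) ring_scheme \<Rightarrow> 'a \<Rightarrow> 'a set \<Rightarrow> 'a set" where
  "scaled_inverse_set R \<rho> A = {\<rho> \<otimes>\<^bsub>R\<^esub> inv\<^bsub>R\<^esub> a | a. a \<in> A \<and> a \<noteq> \<zero>\<^bsub>R\<^esub>}"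

lemma (in field) mult_eq_iff_eq_mult_inv:
  assumes "a \<in> carrier R" "b \<in> carrier R" "r \<in> carrier R" "r \<noteq> \<zero>"
  shows "a \<otimes> b = r \<longleftrightarrow> a \<noteq> \<zero> \<and> b = r \<otimes> inv a"
proof (cases "a = \<zero>")
  case True
  then show ?thesis using assms by auto
next
  case False
  then have u: "a \<in> Units R" using assms field_Units by auto
  then have ui: "inv a \<in> carrier R" by (rule Units_inv_closed)
  have "a \<otimes> (r \<otimes> inv a) = r \<otimes> (a \<otimes> inv a)"
    using assms(1,3) ui by (rule m_lcomm)
  also have "\<dots> = r"
    using u assms(3) by simp
  finally have "a \<otimes> b = r \<longleftrightarrow> a \<otimes> b = a \<otimes> (r \<otimes> inv a)"
    by simp
  also have "\<dots> \<longleftrightarrow> b = r \<otimes> inv a"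
    using u ui assms(2,3) by simp
  finally show ?thesis
    using False by simp
qed

lemma (in field) Int_scaled_inverse_set:
  assumes "A \<subseteq> carrier R" "r \<in> carrier R" "r \<noteq> \<zero>"
  shows "A \<inter> scaled_inverse_set R r A = {a \<in> A. a \<noteq> \<zero> \<and> r \<otimes> inv a \<in> A}"
proof -
  have sym: "b \<noteq> \<zero> \<and> a = r \<otimes> inv b \<longleftrightarrow> a \<noteq> \<zero> \<and> b = r \<otimes> inv a"
    if "a \<in> A" "b \<in> A" for a b
  proof -
    have ab: "a \<in> carrier R" "b \<in> carrier R"
      using that assms(1) by blast+
    show ?thesis
      unfolding mult_eq_iff_eq_mult_inv [OF ab assms(2,3), symmetric]
        mult_eq_iff_eq_mult_inv [OF ab(2,1) assms(2,3), symmetric]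
      by (simp only: m_comm [OF ab])
  qed
  show ?thesis
  proof (rule Set.set_eqI)
    fix a
    have "a \<in> A \<inter> scaled_inverse_set R r A \<longleftrightarrow>
            (\<exists>b. a \<in> A \<and> b \<in> A \<and> (b \<noteq> \<zero> \<and> a = r \<otimes> inv b))"
      by (auto simp: scaled_inverse_set_def)
    also have "\<dots> \<longleftrightarrow> (\<exists>b. a \<in> A \<and> b \<in> A \<and> (a \<noteq> \<zero> \<and> b = r \<otimes> inv a))"
      using sym by metis
    also have "\<dots> \<longleftrightarrow> a \<in> {a \<in> A. a \<noteq> \<zero> \<and> r \<otimes> inv a \<in> A}"
      by auto
    finally show "a \<in> A \<inter> scaled_inverse_set R r A \<longleftrightarrow> a \<in> {a \<in> A. a \<noteq> \<zero> \<and> r \<otimes> inv a \<in> A}" .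
  qed
qed

lemma (in field) card_Int_scaled_inverse_set:
  assumes "A \<subseteq> carrier R" "r \<in> carrier R" "r \<noteq> \<zero>"
  shows "card (A \<inter> scaled_inverse_set R r A) = card {(a, b) \<in> A \<times> A. a \<otimes> b = r}"
proof -
  have iff: "a \<otimes> b = r \<longleftrightarrow> a \<noteq> \<zero> \<and> b = r \<otimes> inv a" if "a \<in> A" "b \<in> A" for a b
    using that assms by (intro mult_eq_iff_eq_mult_inv) auto
  have "{(a, b) \<in> A \<times> A. a \<otimes> b = r} = {(a, b) \<in> A \<times> A. a \<noteq> \<zero> \<and> b = r \<otimes> inv a}"
    using iff by blast
  also have "\<dots> = (\<lambda>a. (a, r \<otimes> inv a)) ` (A \<inter> scaled_inverse_set R r A)"
    unfolding Int_scaled_inverse_set[OF assms] by blast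
  finally have "{(a, b) \<in> A \<times> A. a \<otimes> b = r} =
      (\<lambda>a. (a, r \<otimes> inv a)) ` (A \<inter> scaled_inverse_set R r A)" .
  moreover have "inj_on (\<lambda>a. (a, r \<otimes> inv a)) (A \<inter> scaled_inverse_set R r A)"
    by (auto simp: inj_on_def)
  ultimately show ?thesis
    by (simp add: card_image)
qed

end

theory Submission
  imports Defs "HOL-Analysis.Convex" "HOL-Library.Set_Algebras" "HOL-Combinatorics.Perm"
begin

text \<open>Put \<open>Y = X + B + B\<close>. Since \<open>a + b \<in> Y\<close> for all \<open>a \<in> A\<close> and \<open>b \<in> B\<close>, the number of solutions of \<open>a a' = \<rho>\<close> in \<open>A\<close>
  is at most \<open>1 / |B|\<^sup>2\<close> times the number of solutions of \<open>(y\<^sub>1 - b\<^sub>1) (y\<^sub>2 - b\<^sub>2) = \<rho>\<close>, that is, of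
  \<open>y\<^sub>2 = g y\<^sub>1\<close> for the Moebius maps \<open>g z = b\<^sub>2 + \<rho> / (z - b\<^sub>1)\<close>. The deviation from the expected count is
  governed by the norm of the average over these maps on mean-zero functions on the projective line,
  whose square is a random walk on \<open>SL\<^sub>2\<close>. Following Bourgain and Gamburd, either the \<open>L\<^sup>2\<close> norm of the walk
  drops by a fixed power of \<open>|B|\<close> within two doublings of its length, or by the Balog--Szemeredi--Gowers
  theorem the walk charges a coset of an approximate subgroup \<open>S\<close>. No girth is needed for this: already
  a single step charges a coset of the Borel subgroup with mass at most \<open>1 / |B|\<close>, so that \<open>S\<close> is not
  contained in the Borel subgroup, and its last letter ranges over unipotents, so that \<open>S\<^sup>2\<close> contains many of
  them. Such an \<open>S\<close> has almost \<open>p\<^sup>3\<close> elements: the elements fixing infinity act by dilations on the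
  unipotent ones, and a sum-product pivot argument makes the latter almost all of \<open>F\<^sub>p\<close>. Hence the walk
  is flat after \<open>O(1 / \<epsilon>)\<close> doublings, which is the source of the exponential \<open>b\<^sub>0 powr (- 1 / \<epsilon>)\<close>, and the dimension
  \<open>p\<close> of the mean-zero functions turns flatness into a spectral gap.\<close>

section \<open>Groups and popular products in bipartite graphs\<close>

text \<open>All losses are powers of one parameter L = p^(epsilon / K) with K = 200000. The
  hypothesis |B| >= p^epsilon then reads |B| >= L^K, and K is so large that every loss stays below
  |B| or below the square root of p. Since p^3 <= L^n for n about 3 K / epsilon, n pairs of
  doublings that each save a factor L make the walk flat. If L < 2, then p^epsilon is bounded and
  the trivial estimate suffices, so small p are covered by the constant. The Moebius maps have
  determinant -rho, so they need not lie in SL_2, nor is their set closed under inversion. Quotients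
  of two of them cure both defects: determinants cancel, and exchanging the two maps inverts the
  quotient. The averaging operator is therefore self-adjoint, and its powers control a single step.
  An energy of p^(-5/2) is enough, because passing from energy to operator norm costs p^2 and not
  the order of the group, about p^3. The price is a root: a saving for the power 4^n of the operator
  leaves one step with the exponent divided by 4^n.\<close>

text \<open>The library has a type class for additive groups only.\<close>

class mgroup = monoid_mult + inverse +
  assumes mgroup_left_inverse [simp]: "inverse a * a = 1"
begin

sublocale mgroup: Groups.group "(*)" 1 inverse
  by standard simp_all

lemma mgroup_cancel [simp]:
  "a * inverse a = 1"
  "inverse a * (a * b) = b"
  "a * (inverse a * b) = b"
  "inverse (inverse a) = a"
  "inverse 1 = 1"
  "a * b = a * c \<longleftrightarrow> b = c"
  "b * a = c * a \<longleftrightarrow> b = c"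
  by (simp_all add: mgroup.left_cancel mgroup.right_cancel flip: mult.assoc)

lemma mgroup_inverse_mult [simp]: "inverse (a * b) = inverse b * inverse a"
  by (rule mgroup.inverse_distrib_swap)

lemma mgroup_solve:
  "inverse a * b = c \<longleftrightarrow> b = a * c"
  "b * inverse a = c \<longleftrightarrow> b = c * a"
  by (auto simp: mult.assoc)

end

instance perm :: (type) mgroup
  by standard (simp add: perm_eq_iff apply_times apply_inverse)

lemma card_mult_le_fibres:
  assumes "finite A" "f ` A \<subseteq> B" "finite B" "\<And>y. y \<in> B \<Longrightarrow> card {x \<in> A. f x = y} \<le> k"
  shows "card A \<le> k * card B"
proof -
  have "card A = (\<Sum>y\<in>B. card {x \<in> A. f x = y})"
    using sum.group[OF assms(1,3,2), of "\<lambda>_. 1::nat"] by simp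
  also have "\<dots> \<le> (\<Sum>y\<in>B. k)" by (intro sum_mono assms)
  finally show ?thesis by (simp add: mult.commute)
qed

lemma mult_card_le_fibres:
  assumes "finite A" "f ` A \<subseteq> B" "finite B" "C \<subseteq> B" "\<And>y. y \<in> C \<Longrightarrow> k \<le> real (card {x \<in> A. f x = y})"
  shows "k * real (card C) \<le> real (card A)"
proof -
  have "k * real (card C) = (\<Sum>y\<in>C. k)" by simp
  also have "\<dots> \<le> (\<Sum>y\<in>C. real (card {x \<in> A. f x = y}))" by (intro sum_mono assms)
  also have "\<dots> \<le> (\<Sum>y\<in>B. real (card {x \<in> A. f x = y}))"
    by (rule sum_mono2) (use assms in auto)
  also have "\<dots> = real (card A)"
    using sum.group[OF assms(1,3,2), of "\<lambda>_. 1::real"] by simp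
  finally show ?thesis .
qed

text \<open>The set \<open>A'\<close> is the neighbourhood of one vertex \<open>b\<close>: on
  average over \<open>b\<close> it is large, while a pair with few common neighbours rarely lies in
  it. By Markov's inequality, discarding the vertices with more than a quarter of bad partners
  leaves \<open>Z\<close>; two vertices of \<open>Z\<close> then have half of \<open>A'\<close> as
  good common partners, so they are joined by many paths of length four.\<close>

lemma dense_graph_popular_neighbours:
  fixes E :: "('a \<times> 'b) set" and \<alpha> :: real
  assumes A: "finite A" and B: "finite B" "B \<noteq> {}" and E: "E \<subseteq> A \<times> B"
    and \<alpha>: "\<alpha> > 0" "real (card E) \<ge> \<alpha> * card A * card B"
  obtains A' Z where "A' \<subseteq> A" "Z \<subseteq> A'" "real (card A') \<ge> \<alpha> / 2 * card A" "real (card Z) \<ge> 3 / 4 * card A'"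
    "\<And>x y. x \<in> Z \<Longrightarrow> y \<in> Z \<Longrightarrow>
      real (card {a \<in> A'. \<alpha>\<^sup>2 / 32 * card B \<le> card {b \<in> B. (x, b) \<in> E \<and> (a, b) \<in> E} \<and>
                     \<alpha>\<^sup>2 / 32 * card B \<le> card {b \<in> B. (a, b) \<in> E \<and> (y, b) \<in> E}}) \<ge> card A' / 2"
proof -
  define cd where "cd x y = card {b \<in> B. (x, b) \<in> E \<and> (y, b) \<in> E}" for x y
  define N where "N b = {a \<in> A. (a, b) \<in> E}" for b
  define bad where "bad = {(x, y) \<in> A \<times> A. real (cd x y) < \<alpha>\<^sup>2 / 32 * card B}"
  have finN: "finite (N b)" for b using A by (simp add: N_def)
  have fbad: "finite bad" using A by (auto simp: bad_def intro: finite_subset[of _ "A \<times> A"])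
  have cB: "card B > 0" using B by (simp add: card_gt_0_iff)
  have finE: "finite E" using E A B by (meson finite_SigmaI finite_subset)
  have cardE: "real (card E) = (\<Sum>b\<in>B. real (card (N b)))"
  proof -
    have "card E = (\<Sum>b\<in>B. card {e \<in> E. snd e = b})"
      using sum.group[of E B snd "\<lambda>_. 1::nat"] finE B E by force
    also have "\<dots> = (\<Sum>b\<in>B. card (N b))"
    proof (rule sum.cong[OF refl])
      fix b assume "b \<in> B"
      have "bij_betw fst {e \<in> E. snd e = b} (N b)"
        using E by (intro bij_betwI[where g = "\<lambda>a. (a, b)"]) (auto simp: N_def)
      then show "card {e \<in> E. snd e = b} = card (N b)" by (rule bij_betw_same_card)
    qed
    finally show ?thesis by simp
  qed
  have sq: "(\<Sum>b\<in>B. (real (card (N b)))\<^sup>2) \<ge> \<alpha>\<^sup>2 * (card A)\<^sup>2 * card B"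
  proof -
    have "(\<alpha> * card A * card B)\<^sup>2 \<le> (\<Sum>b\<in>B. real (card (N b)))\<^sup>2"
      using \<alpha> cardE by (intro power_mono) auto
    also have "\<dots> \<le> card B * (\<Sum>b\<in>B. (real (card (N b)))\<^sup>2)"
      using sum_squared_le_sum_of_squares[of "\<lambda>b. real (card (N b))" B] by (simp add: mult.commute)
    finally show ?thesis using cB by (simp add: power2_eq_square algebra_simps)
  qed
  have badsum: "(\<Sum>b\<in>B. real (card (bad \<inter> N b \<times> N b))) \<le> (card A)\<^sup>2 * (\<alpha>\<^sup>2 / 32 * card B)"
  proof -
    have "(\<Sum>b\<in>B. real (card (bad \<inter> N b \<times> N b))) = (\<Sum>b\<in>B. \<Sum>e\<in>bad. if e \<in> N b \<times> N b then 1 else 0)"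
      using fbad by (intro sum.cong refl) (simp add: sum.If_cases Int_def)
    also have "\<dots> = (\<Sum>e\<in>bad. \<Sum>b\<in>B. if e \<in> N b \<times> N b then 1 else 0)" by (rule sum.swap)
    also have "\<dots> \<le> (\<Sum>e\<in>bad. \<alpha>\<^sup>2 / 32 * card B)"
    proof (rule sum_mono)
      fix e assume e: "e \<in> bad"
      then obtain x y where xy: "e = (x, y)" "x \<in> A" "y \<in> A" "real (cd x y) < \<alpha>\<^sup>2 / 32 * card B"
        by (auto simp: bad_def)
      have "(\<Sum>b\<in>B. if e \<in> N b \<times> N b then 1 else 0) = real (cd x y)"
        using B xy by (simp add: sum.If_cases cd_def N_def Int_def)
      then show "(\<Sum>b\<in>B. if e \<in> N b \<times> N b then 1 else 0) \<le> \<alpha>\<^sup>2 / 32 * card B" using xy by simp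
    qed
    also have "\<dots> = card bad * (\<alpha>\<^sup>2 / 32 * card B)" by simp
    also have "\<dots> \<le> (card A)\<^sup>2 * (\<alpha>\<^sup>2 / 32 * card B)"
    proof (intro mult_right_mono)
      have "card bad \<le> card (A \<times> A)" using A by (intro card_mono) (auto simp: bad_def)
      then show "real (card bad) \<le> (card A)\<^sup>2" by (simp add: card_cartesian_product power2_eq_square flip: of_nat_mult)
    qed simp
    finally show ?thesis .
  qed
  \<comment> \<open>The weight 16 turns the constant 1 / 32 of \<open>badsum\<close> into half of
    the second moment \<open>sq\<close>; it also leaves at most a proportion 1 / 16 of bad pairs in
    the neighbourhood.\<close>
  have "\<exists>b\<in>B. (real (card (N b)))\<^sup>2 - 16 * card (bad \<inter> N b \<times> N b) \<ge> \<alpha>\<^sup>2 / 2 * (card A)\<^sup>2"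
  proof (rule ccontr)
    assume "\<not> ?thesis"
    then have "(\<Sum>b\<in>B. (real (card (N b)))\<^sup>2 - 16 * card (bad \<inter> N b \<times> N b)) < (\<Sum>b\<in>B. \<alpha>\<^sup>2 / 2 * (card A)\<^sup>2)"
      using B by (intro sum_strict_mono) auto
    then have "(\<Sum>b\<in>B. (real (card (N b)))\<^sup>2) - 16 * (\<Sum>b\<in>B. real (card (bad \<inter> N b \<times> N b))) < card B * (\<alpha>\<^sup>2 / 2 * (card A)\<^sup>2)"
      by (simp add: sum_subtractf sum_distrib_left)
    then show False using sq badsum by (simp add: algebra_simps)
  qed
  then obtain b where b: "b \<in> B" "(real (card (N b)))\<^sup>2 - 16 * card (bad \<inter> N b \<times> N b) \<ge> \<alpha>\<^sup>2 / 2 * (card A)\<^sup>2" by blast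
  define A' where "A' = N b"
  have finA': "finite A'" and A'A: "A' \<subseteq> A" using A by (auto simp: A'_def N_def)
  define badat where "badat x = {y \<in> A'. real (cd x y) < \<alpha>\<^sup>2 / 32 * card B}" for x
  define Z where "Z = {x \<in> A'. real (card (badat x)) \<le> card A' / 4}"
  have bad16: "16 * real (card (bad \<inter> A' \<times> A')) \<le> (card A')\<^sup>2"
  proof -
    have "0 \<le> \<alpha>\<^sup>2 / 2 * (card A)\<^sup>2" by simp
    also note b(2)
    finally show ?thesis by (simp add: A'_def)
  qed
  have A'2: "real (card A') \<ge> \<alpha> / 2 * card A"
  proof -
    have "(\<alpha> / 2 * card A)\<^sup>2 \<le> \<alpha>\<^sup>2 / 2 * (card A)\<^sup>2" by (simp add: power_mult_distrib power_divide)
    also have "\<dots> \<le> (real (card A'))\<^sup>2" using b(2) by (simp add: A'_def)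
    finally show ?thesis by (rule power2_le_imp_le) simp
  qed
  have "bad \<inter> A' \<times> A' = Sigma A' badat"
    using A'A by (auto simp: bad_def badat_def)
  then have sig: "real (card (bad \<inter> A' \<times> A')) = (\<Sum>x\<in>A'. real (card (badat x)))"
    using finA' by (simp add: badat_def)
  have "(card A' / 4) * (card A' - card Z) \<le> real (card (bad \<inter> A' \<times> A'))"
  proof -
    have "(card A' / 4) * (card A' - card Z) = (\<Sum>x\<in>A' - Z. card A' / 4)"
      using finA' by (subst sum_constant) (auto simp: Z_def card_Diff_subset of_nat_diff card_mono)
    also have "\<dots> \<le> (\<Sum>x\<in>A' - Z. real (card (badat x)))"
      by (rule sum_mono) (auto simp: Z_def)
    also have "\<dots> \<le> (\<Sum>x\<in>A'. real (card (badat x)))"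
      using finA' by (intro sum_mono2) auto
    finally show ?thesis using sig by simp
  qed
  then have "4 * (real (card A') * (card A' - card Z)) \<le> card A' * card A'"
    using bad16 by (simp add: power2_eq_square)
  have ZA': "Z \<subseteq> A'" by (auto simp: Z_def)
  have Z34: "real (card Z) \<ge> 3 / 4 * card A'"
  proof (cases "card A' = 0")
    case False
    then have pos: "real (card A') > 0" by simp
    have "card Z \<le> card A'" using ZA' finA' by (rule card_mono[rotated])
    then have "real (card A' - card Z) = real (card A') - card Z" by simp
    then have "real (card A') * (4 * (real (card A') - card Z)) \<le> real (card A') * card A'"
      using \<open>4 * (real (card A') * (card A' - card Z)) \<le> card A' * card A'\<close> by (simp add: mult.left_commute)
    then show ?thesis using pos by simp
  qed simp
  show ?thesis
  proof (rule that[OF A'A ZA' A'2 Z34])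
    fix x y assume xy: "x \<in> Z" "y \<in> Z"
    let ?G = "{a \<in> A'. \<alpha>\<^sup>2 / 32 * card B \<le> card {b \<in> B. (x, b) \<in> E \<and> (a, b) \<in> E} \<and>
                     \<alpha>\<^sup>2 / 32 * card B \<le> card {b \<in> B. (a, b) \<in> E \<and> (y, b) \<in> E}}"
    have comm: "cd a y = cd y a" for a by (auto simp: cd_def intro: arg_cong[of _ _ card])
    have "A' = ?G \<union> badat x \<union> badat y"
      using comm by (auto simp: badat_def cd_def)
    then have "card A' \<le> card ?G + card (badat x) + card (badat y)"
      by (metis (no_types, lifting) card_Un_le add_le_mono1 le_trans)
    moreover have "real (card (badat x)) \<le> card A' / 4" "real (card (badat y)) \<le> card A' / 4"
      using xy by (auto simp: Z_def)
    ultimately show "real (card ?G) \<ge> card A' / 2" by linarith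
  qed
qed

section \<open>The Balog--Szemeredi--Gowers theorem\<close>

definition rep :: "'a::mgroup set \<Rightarrow> 'a \<Rightarrow> nat" where
  "rep A z = card {y \<in> A. inverse y * z \<in> A}"

lemma rep_eq_card_pairs: "rep A z = card {e \<in> A \<times> A. fst e * snd e = z}"
proof -
  have "bij_betw (\<lambda>y. (y, inverse y * z)) {y \<in> A. inverse y * z \<in> A} {e \<in> A \<times> A. fst e * snd e = z}"
    by (rule bij_betwI[where g = fst]) (auto simp: mgroup_solve)
  then show ?thesis by (simp add: rep_def bij_betw_same_card)
qed

lemma rep_le: "finite A \<Longrightarrow> rep A z \<le> card A"
  by (simp add: rep_def card_mono)

lemma sum_rep:
  assumes "finite A" "finite P"
  shows "(\<Sum>z\<in>P. rep A z) = card {e \<in> A \<times> A. fst e * snd e \<in> P}"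
proof -
  let ?S = "{e \<in> A \<times> A. fst e * snd e \<in> P}"
  have "card ?S = (\<Sum>z\<in>P. card {e \<in> ?S. fst e * snd e = z})"
    using sum.group[of ?S P "\<lambda>e. fst e * snd e" "\<lambda>_. 1::nat"] assms by (force simp: finite_subset[of ?S "A \<times> A"])
  also have "\<dots> = (\<Sum>z\<in>P. rep A z)"
    unfolding rep_eq_card_pairs by (intro sum.cong refl arg_cong[of _ _ card]) auto
  finally show ?thesis by simp
qed

definition quotients :: "'a::mgroup set \<Rightarrow> 'a set" where
  "quotients Z = (\<lambda>(x, y). x * inverse y) ` (Z \<times> Z)"

text \<open>Popular products carry half of the energy, so they define a dense graph \<open>E\<close>
  on \<open>A\<close>. Along a path of length four, x y^-1 = (x b) (a b)^-1 (a c) (y c)^-1 with four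
  factors built from the set \<open>P\<close> of popular products. Each quotient has many such paths
  and there are only |P|^4 quadruples, so there are few quotients.\<close>

theorem balog_szemeredi_gowers:
  fixes A :: "'a::mgroup set" and K :: real
  assumes A: "finite A" "A \<noteq> {}" and K: "K \<ge> 1"
    and energy: "(\<Sum>z\<in>A * A. (real (rep A z))\<^sup>2) \<ge> card A ^ 3 / K"
  obtains Z where "Z \<subseteq> A" "real (card Z) \<ge> card A / (8 * K)"
    "real (card (quotients Z)) \<le> 2 ^ 21 * K ^ 9 * card A"
proof -
  define N where "N = real (card A)"
  have N: "N > 0" using A by (simp add: N_def card_gt_0_iff)
  define P where "P = {z \<in> A * A. real (rep A z) \<ge> N / (2 * K)}"
  define E where "E = {e \<in> A \<times> A. fst e * snd e \<in> P}"
  have finAA: "finite (A * A)" using A by (simp add: finite_set_times)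
  have finP: "finite P" using finAA by (simp add: P_def)
  have total: "(\<Sum>z\<in>A * A. real (rep A z)) = N\<^sup>2"
  proof -
    have "{e \<in> A \<times> A. fst e * snd e \<in> A * A} = A \<times> A" by auto
    then have "(\<Sum>z\<in>A * A. rep A z) = card (A \<times> A)" using sum_rep[OF A(1) finAA] by metis
    then show ?thesis unfolding N_def by (metis card_cartesian_product of_nat_mult of_nat_sum power2_eq_square)
  qed
  have low: "(\<Sum>z\<in>A * A - P. (real (rep A z))\<^sup>2) \<le> N ^ 3 / (2 * K)"
  proof -
    have "(\<Sum>z\<in>A * A - P. (real (rep A z))\<^sup>2) \<le> (\<Sum>z\<in>A * A - P. N / (2 * K) * real (rep A z))"
      unfolding power2_eq_square by (intro sum_mono mult_right_mono) (auto simp: P_def)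
    also have "\<dots> \<le> (\<Sum>z\<in>A * A. N / (2 * K) * real (rep A z))"
      using finAA N K by (intro sum_mono2) auto
    also have "\<dots> = N / (2 * K) * N\<^sup>2" by (simp only: total sum_distrib_left[symmetric])
    finally show ?thesis by (simp add: power3_eq_cube power2_eq_square)
  qed
  have high: "(\<Sum>z\<in>P. (real (rep A z))\<^sup>2) \<ge> N ^ 3 / (2 * K)"
  proof -
    have "(\<Sum>z\<in>A * A. (real (rep A z))\<^sup>2) = (\<Sum>z\<in>A * A - P. (real (rep A z))\<^sup>2) + (\<Sum>z\<in>P. (real (rep A z))\<^sup>2)"
      using finAA by (intro sum.subset_diff) (auto simp: P_def)
    moreover have "N ^ 3 / K = N ^ 3 / (2 * K) + N ^ 3 / (2 * K)" by (simp add: field_simps)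
    ultimately show ?thesis using low energy by (simp add: N_def)
  qed
  have cardE: "real (card E) \<ge> 1 / (2 * K) * N * N"
  proof -
    have "N ^ 3 / (2 * K) \<le> (\<Sum>z\<in>P. N * real (rep A z))"
      using high by (rule order_trans) (auto intro!: sum_mono mult_right_mono rep_le[OF A(1)] simp: power2_eq_square N_def)
    also have "\<dots> = N * real (card E)"
      using sum_rep[OF A(1) finP] by (simp add: E_def flip: sum_distrib_left of_nat_sum)
    finally have "N * (1 / (2 * K) * N * N) \<le> N * real (card E)" by (simp add: power3_eq_cube)
    then show ?thesis using N by (simp only: mult_le_cancel_left_pos)
  qed
  have cardP: "real (card P) \<le> 2 * K * N"
  proof -
    have "real (card P) * (N / (2 * K)) = (\<Sum>z\<in>P. N / (2 * K))" by simp
    also have "\<dots> \<le> (\<Sum>z\<in>P. real (rep A z))" by (intro sum_mono) (simp add: P_def)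
    also have "\<dots> \<le> N\<^sup>2" unfolding total[symmetric] using finAA by (intro sum_mono2) (auto simp: P_def)
    finally show ?thesis using N K by (simp add: field_simps power2_eq_square)
  qed
  obtain A' Z where Z: "A' \<subseteq> A" "Z \<subseteq> A'" "real (card A') \<ge> 1 / (2 * K) / 2 * card A" "real (card Z) \<ge> 3 / 4 * card A'"
    "\<And>x y. x \<in> Z \<Longrightarrow> y \<in> Z \<Longrightarrow>
      real (card {a \<in> A'. (1 / (2 * K))\<^sup>2 / 32 * card A \<le> card {b \<in> A. (x, b) \<in> E \<and> (a, b) \<in> E} \<and>
                     (1 / (2 * K))\<^sup>2 / 32 * card A \<le> card {b \<in> A. (a, b) \<in> E \<and> (y, b) \<in> E}}) \<ge> card A' / 2"
    by (rule dense_graph_popular_neighbours[of A A E "1 / (2 * K)"])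
      (use A K cardE in \<open>auto simp: E_def N_def\<close>)
  define \<beta> where "\<beta> = (1 / (2 * K))\<^sup>2 / 32 * N"
  have \<beta>: "\<beta> \<ge> 0" using N by (simp add: \<beta>_def)
  have finA': "finite A'" using Z(1) A(1) by (rule finite_subset)
  define f where "f = (\<lambda>(p, q, r, s). p * inverse q * (r * inverse s) :: 'a)"
  define Q where "Q = P \<times> P \<times> P \<times> P"
  have finQ: "finite Q" using finP by (simp add: Q_def)
  have k: "card A' / 2 * \<beta>\<^sup>2 * real (card (quotients Z)) \<le> card Q"
  proof (rule mult_card_le_fibres[where f = f and B = "f ` Q \<union> quotients Z"])
    show "finite (f ` Q \<union> quotients Z)"
      using finQ finA' Z(2) by (auto simp: quotients_def intro: finite_subset)
  next
    fix d assume "d \<in> quotients Z"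
    then obtain x y where xy: "x \<in> Z" "y \<in> Z" "d = x * inverse y" by (auto simp: quotients_def)
    define G where "G = {a \<in> A'. \<beta> \<le> card {b \<in> A. (x, b) \<in> E \<and> (a, b) \<in> E} \<and> \<beta> \<le> card {b \<in> A. (a, b) \<in> E \<and> (y, b) \<in> E}}"
    define T where "T = Sigma G (\<lambda>a. {b \<in> A. (x, b) \<in> E \<and> (a, b) \<in> E} \<times> {b \<in> A. (a, b) \<in> E \<and> (y, b) \<in> E})"
    have finG: "finite G" using finA' by (simp add: G_def)
    have "card A' / 2 * \<beta>\<^sup>2 \<le> card G * \<beta>\<^sup>2"
      using Z(5)[OF xy(1,2)] by (intro mult_right_mono) (auto simp: G_def \<beta>_def N_def)
    also have "\<dots> = (\<Sum>a\<in>G. \<beta> * \<beta>)" by (simp add: power2_eq_square)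
    also have "\<dots> \<le> (\<Sum>a\<in>G. real (card {b \<in> A. (x, b) \<in> E \<and> (a, b) \<in> E}) * real (card {b \<in> A. (a, b) \<in> E \<and> (y, b) \<in> E}))"
      using \<beta> by (intro sum_mono mult_mono) (auto simp: G_def)
    also have "\<dots> = real (card T)"
      using finG A by (simp add: T_def card_cartesian_product)
    also have "card T \<le> card {q \<in> Q. f q = d}"
    proof (rule card_inj_on_le)
      show "inj_on (\<lambda>(a, b, c). (x * b, a * b, a * c, y * c)) T"
        by (auto simp: inj_on_def)
      show "(\<lambda>(a, b, c). (x * b, a * b, a * c, y * c)) ` T \<subseteq> {q \<in> Q. f q = d}"
        by (auto simp: T_def Q_def f_def E_def xy mult.assoc)
      show "finite {q \<in> Q. f q = d}" using finQ by simp
    qed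
    finally show "card A' / 2 * \<beta>\<^sup>2 \<le> real (card {q \<in> Q. f q = d})" by simp
  qed (use finQ in auto)
  have cQ: "real (card Q) \<le> (2 * K * N) ^ 4"
  proof -
    have "real (card Q) = real (card P) ^ 4"
      by (simp add: Q_def card_cartesian_product power4_eq_xxxx)
    also have "\<dots> \<le> (2 * K * N) ^ 4" using cardP by (intro power_mono) auto
    finally show ?thesis .
  qed
  have "N / (4 * K) / 2 * \<beta>\<^sup>2 * real (card (quotients Z)) \<le> card A' / 2 * \<beta>\<^sup>2 * real (card (quotients Z))"
    using Z(3) by (intro mult_right_mono divide_right_mono) (auto simp: N_def)
  with k cQ have "N / (4 * K) / 2 * \<beta>\<^sup>2 * real (card (quotients Z)) \<le> (2 * K * N) ^ 4" by linarith
  then have "real (card (quotients Z)) \<le> 2 ^ 21 * K ^ 9 * N"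
    using N K by (simp add: \<beta>_def power_mult_distrib power_divide field_simps eval_nat_numeral)
  moreover have "real (card Z) \<ge> card A / (8 * K)"
  proof -
    have "card A / (8 * K) \<le> 3 / 4 * (1 / (2 * K) / 2 * card A)"
      using K by (simp add: field_simps)
    then show ?thesis using Z(3,4) by linarith
  qed
  moreover have "Z \<subseteq> A" using Z(1,2) by blast
  ultimately show ?thesis using that by (simp add: N_def)
qed

lemma finite_set_power [simp]: "finite (S :: 'a::monoid_mult set) \<Longrightarrow> finite (S ^ n)"
  by (induction n) (simp_all add: finite_set_times)

text \<open>In a non-abelian group a small set Z Z^-1 does not make Z^-1 Z small, so
  \<open>S\<close> keeps only the left quotients with at least |Z| / (2 K) representations. There
  are enough of them because left and right quotients have the same energy, and their powers stay
  small because every factor can be expanded in many ways. The element \<open>y\<close> ties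
  \<open>S\<close> back to \<open>Z\<close>: the translate of \<open>S\<close> by \<open>y\<close>
  meets \<open>Z\<close> in many points.\<close>

theorem small_quotients_imp_approximate_group:
  fixes Z :: "'a::mgroup set" and K :: real
  assumes Z: "finite Z" "Z \<noteq> {}" and K: "real (card (quotients Z)) \<le> K * card Z"
  obtains S y where "finite S" "1 \<in> S" "\<And>s. s \<in> S \<Longrightarrow> inverse s \<in> S"
    "S \<subseteq> (\<lambda>(x, y). inverse x * y) ` (Z \<times> Z)"
    "real (card S) \<ge> card Z / (2 * K)" "real (card S) \<le> 2 * K * card Z"
    "\<And>n. real (card (S ^ n)) \<le> K ^ (n + 1) * (2 * K) ^ n * card Z"
    "y \<in> Z" "real (card {s \<in> S. y * s \<in> Z}) \<ge> card Z / (2 * K)"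
proof -
  define N where "N = real (card Z)"
  have N: "N > 0" using Z by (simp add: N_def card_gt_0_iff)
  define D where "D = (\<lambda>(x, y). inverse x * y) ` (Z \<times> Z)"
  define m where "m s = card {x \<in> Z. x * s \<in> Z}" for s
  define r where "r d = card {x \<in> Z. inverse d * x \<in> Z}" for d
  have finD: "finite D" and finq: "finite (quotients Z)" using Z by (simp_all add: D_def quotients_def)
  have K0: "K > 0"
  proof -
    have "quotients Z \<noteq> {}" using Z by (auto simp: quotients_def)
    then have "0 < K * card Z" using K finq by (metis card_gt_0_iff less_le_trans of_nat_0_less_iff)
    then show ?thesis using N by (simp add: N_def zero_less_mult_iff)
  qed
  have mle: "m s \<le> card Z" for s using Z by (auto simp: m_def intro: card_mono)
  define S where "S = {s. real (m s) \<ge> N / (2 * K)}"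
  have SD: "S \<subseteq> D"
  proof
    fix s assume "s \<in> S"
    moreover have "0 < N / (2 * K)" using N K0 by simp
    ultimately have "0 < real (m s)" unfolding S_def by (metis (mono_tags) less_le_trans mem_Collect_eq)
    then have "m s > 0" by simp
    then obtain x where "x \<in> Z" "x * s \<in> Z" by (auto simp: m_def card_gt_0_iff)
    then show "s \<in> D" by (auto simp: D_def intro!: image_eqI[of _ _ "(x, x * s)"])
  qed
  then have finS: "finite S" using finD by (rule finite_subset)
  have sumr: "(\<Sum>d\<in>quotients Z. real (r d)) = N\<^sup>2"
  proof -
    have "card (Z \<times> Z) = (\<Sum>d\<in>quotients Z. card {e \<in> Z \<times> Z. fst e * inverse (snd e) = d})"
      using sum.group[of "Z \<times> Z" "quotients Z" "\<lambda>e. fst e * inverse (snd e)" "\<lambda>_. 1::nat"] Z finq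
      by (force simp: quotients_def)
    also have "\<dots> = (\<Sum>d\<in>quotients Z. r d)"
    proof (intro sum.cong refl)
      fix d
      have "bij_betw (\<lambda>x. (x, inverse d * x)) {x \<in> Z. inverse d * x \<in> Z} {e \<in> Z \<times> Z. fst e * inverse (snd e) = d}"
        by (rule bij_betwI[where g = fst]) (auto simp: mgroup_solve)
      then show "card {e \<in> Z \<times> Z. fst e * inverse (snd e) = d} = r d" by (simp add: r_def bij_betw_same_card)
    qed
    finally show ?thesis unfolding N_def by (metis card_cartesian_product of_nat_mult of_nat_sum power2_eq_square)
  qed
  have summ: "(\<Sum>s\<in>D. real (m s)) = N\<^sup>2"
  proof -
    have "card (Z \<times> Z) = (\<Sum>d\<in>D. card {e \<in> Z \<times> Z. inverse (fst e) * snd e = d})"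
      using sum.group[of "Z \<times> Z" D "\<lambda>e. inverse (fst e) * snd e" "\<lambda>_. 1::nat"] Z finD
      by (force simp: D_def)
    also have "\<dots> = (\<Sum>d\<in>D. m d)"
    proof (intro sum.cong refl)
      fix d
      have "bij_betw (\<lambda>x. (x, x * d)) {x \<in> Z. x * d \<in> Z} {e \<in> Z \<times> Z. inverse (fst e) * snd e = d}"
        by (rule bij_betwI[where g = fst]) (auto simp: mgroup_solve)
      then show "card {e \<in> Z \<times> Z. inverse (fst e) * snd e = d} = m d" by (simp add: m_def bij_betw_same_card)
    qed
    finally show ?thesis unfolding N_def by (metis card_cartesian_product of_nat_mult of_nat_sum power2_eq_square)
  qed
  \<comment> \<open>\<open>x\<inverse> y = x'\<inverse> y'\<close> is the same equation as \<open>x' x\<inverse> = y' y\<inverse>\<close>\<close>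
  have energy: "(\<Sum>s\<in>D. (real (m s))\<^sup>2) = (\<Sum>d\<in>quotients Z. (real (r d))\<^sup>2)"
  proof -
    have "(\<Sum>s\<in>D. (m s)\<^sup>2) = card (Sigma D (\<lambda>s. {x \<in> Z. x * s \<in> Z} \<times> {x \<in> Z. x * s \<in> Z}))"
      using finD Z by (simp add: m_def card_cartesian_product power2_eq_square)
    also have "\<dots> = card (Sigma (quotients Z) (\<lambda>d. {x \<in> Z. inverse d * x \<in> Z} \<times> {x \<in> Z. inverse d * x \<in> Z}))"
    proof (rule bij_betw_same_card)
      show "bij_betw (\<lambda>(s, x, x'). (x' * inverse x, x', x' * s))
        (Sigma D (\<lambda>s. {x \<in> Z. x * s \<in> Z} \<times> {x \<in> Z. x * s \<in> Z}))
        (Sigma (quotients Z) (\<lambda>d. {x \<in> Z. inverse d * x \<in> Z} \<times> {x \<in> Z. inverse d * x \<in> Z}))"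
        by (rule bij_betwI[where g = "\<lambda>(d, x', y'). (inverse x' * y', inverse d * x', x')"])
          (auto simp: D_def quotients_def mult.assoc)
    qed
    also have "\<dots> = (\<Sum>d\<in>quotients Z. (r d)\<^sup>2)"
      using finq Z by (simp add: r_def card_cartesian_product power2_eq_square)
    finally show ?thesis by (simp flip: of_nat_power of_nat_sum)
  qed
  have "N ^ 4 \<le> (K * N) * (\<Sum>s\<in>D. (real (m s))\<^sup>2)"
  proof -
    have "N ^ 4 = (\<Sum>d\<in>quotients Z. real (r d))\<^sup>2" by (simp add: sumr flip: power_mult)
    also have "\<dots> \<le> card (quotients Z) * (\<Sum>d\<in>quotients Z. (real (r d))\<^sup>2)"
      using sum_squared_le_sum_of_squares[of "\<lambda>d. real (r d)" "quotients Z"] by (simp add: mult.commute)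
    also have "\<dots> \<le> (K * N) * (\<Sum>d\<in>quotients Z. (real (r d))\<^sup>2)"
      using K by (intro mult_right_mono) (auto simp: N_def intro: sum_nonneg)
    finally show ?thesis by (simp add: energy)
  qed
  then have en: "(\<Sum>s\<in>D. (real (m s))\<^sup>2) \<ge> N ^ 3 / K"
    using N K0 by (simp add: field_simps eval_nat_numeral)
  have low: "(\<Sum>s\<in>D - S. (real (m s))\<^sup>2) \<le> N ^ 3 / (2 * K)"
  proof -
    have "(\<Sum>s\<in>D - S. (real (m s))\<^sup>2) \<le> (\<Sum>s\<in>D - S. N / (2 * K) * real (m s))"
      unfolding power2_eq_square by (intro sum_mono mult_right_mono) (auto simp: S_def)
    also have "\<dots> \<le> (\<Sum>s\<in>D. N / (2 * K) * real (m s))"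
      using finD N K0 by (intro sum_mono2) auto
    also have "\<dots> = N / (2 * K) * N\<^sup>2" by (simp only: summ sum_distrib_left[symmetric])
    finally show ?thesis by (simp add: power3_eq_cube power2_eq_square)
  qed
  have sumS: "(\<Sum>s\<in>S. real (m s)) \<ge> N\<^sup>2 / (2 * K)"
  proof -
    have "(\<Sum>s\<in>D. (real (m s))\<^sup>2) = (\<Sum>s\<in>D - S. (real (m s))\<^sup>2) + (\<Sum>s\<in>S. (real (m s))\<^sup>2)"
      using finD SD by (rule sum.subset_diff[rotated])
    moreover have "N ^ 3 / K = N ^ 3 / (2 * K) + N ^ 3 / (2 * K)" by (simp add: field_simps)
    moreover have "(\<Sum>s\<in>S. (real (m s))\<^sup>2) \<le> (\<Sum>s\<in>S. N * real (m s))"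
      unfolding power2_eq_square using mle by (intro sum_mono mult_right_mono) (auto simp: N_def)
    ultimately have "N ^ 3 / (2 * K) \<le> N * (\<Sum>s\<in>S. real (m s))"
      using low en by (simp add: sum_distrib_left)
    then have "N * (N\<^sup>2 / (2 * K)) \<le> N * (\<Sum>s\<in>S. real (m s))"
      by (simp add: power3_eq_cube power2_eq_square)
    then show ?thesis using N by (simp only: mult_le_cancel_left_pos)
  qed
  have one: "1 \<in> S"
  proof -
    have "quotients Z \<noteq> {}" using Z by (auto simp: quotients_def)
    obtain z where z: "z \<in> Z" using Z by blast
    have "card ((\<lambda>x. x * inverse z) ` Z) \<le> card (quotients Z)"
      using finq z by (intro card_mono) (auto simp: quotients_def)
    then have "N \<le> K * N" using K by (simp add: card_image inj_on_def N_def)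
    then have "1 \<le> K" using N by simp
    then show ?thesis using N by (simp add: S_def m_def N_def field_simps)
  qed
  have sym: "inverse s \<in> S" if "s \<in> S" for s
  proof -
    have "bij_betw (\<lambda>x. x * s) {x \<in> Z. x * s \<in> Z} {x \<in> Z. x * inverse s \<in> Z}"
      by (rule bij_betwI[where g = "\<lambda>x. x * inverse s"]) (auto simp: mult.assoc)
    then have "m (inverse s) = m s" by (simp add: m_def bij_betw_same_card)
    then show ?thesis using that by (simp add: S_def)
  qed
  have cS: "real (card S) \<ge> N / (2 * K)"
  proof -
    have "N\<^sup>2 / (2 * K) \<le> (\<Sum>s\<in>S. N)"
      using sumS by (rule order_trans) (use mle in \<open>intro sum_mono, simp add: N_def\<close>)
    then show ?thesis using N K0 by (simp add: field_simps power2_eq_square)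
  qed
  have cS': "real (card S) \<le> 2 * K * N"
  proof -
    have "real (card S) * (N / (2 * K)) = (\<Sum>s\<in>S. N / (2 * K))" by simp
    also have "\<dots> \<le> (\<Sum>s\<in>S. real (m s))" by (intro sum_mono) (simp add: S_def)
    also have "\<dots> \<le> N\<^sup>2" unfolding summ[symmetric] using finD SD by (intro sum_mono2) auto
    finally show ?thesis using N K0 by (simp add: field_simps power2_eq_square)
  qed
  have "\<exists>y\<in>Z. real (card {s \<in> S. y * s \<in> Z}) \<ge> N / (2 * K)"
  proof (rule ccontr)
    assume "\<not> ?thesis"
    then have "(\<Sum>y\<in>Z. real (card {s \<in> S. y * s \<in> Z})) < (\<Sum>y\<in>Z. N / (2 * K))"
      using Z by (intro sum_strict_mono) auto
    also have "\<dots> = N\<^sup>2 / (2 * K)" by (simp add: N_def power2_eq_square)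
    also have "\<dots> \<le> (\<Sum>s\<in>S. real (m s))" by (rule sumS)
    also have "\<dots> = (\<Sum>s\<in>S. \<Sum>y\<in>Z. if y * s \<in> Z then 1 else 0)"
      using Z by (simp add: m_def sum.If_cases Int_def)
    also have "\<dots> = (\<Sum>y\<in>Z. \<Sum>s\<in>S. if y * s \<in> Z then 1 else 0)" by (rule sum.swap)
    also have "\<dots> = (\<Sum>y\<in>Z. real (card {s \<in> S. y * s \<in> Z}))"
      using finS by (simp add: sum.If_cases Int_def)
    finally show False by simp
  qed
  then obtain y where y: "y \<in> Z" "real (card {s \<in> S. y * s \<in> Z}) \<ge> N / (2 * K)" by blast
  \<comment> \<open>writing each factor of \<open>s\<^sub>1 \<dots> s\<^sub>n\<close> as \<open>x\<inverse> y\<close> in \<open>m s\<^sub>i\<close> ways regroups \<open>z s\<^sub>1 \<dots> s\<^sub>n w\<inverse>\<close> as a product of quotients\<close>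
  have pw: "real (card ((\<lambda>(x, y). x * inverse y) ` ((Z * S ^ n) \<times> Z))) * (N / (2 * K)) ^ n \<le> (K * N) ^ (n + 1)" for n
  proof (induction n)
    case 0
    have "Z * {1} = Z" by (force simp: set_times_image)
    then show ?case using K by (simp add: quotients_def N_def)
  next
    case (Suc n)
    let ?W = "\<lambda>n. (\<lambda>(x, y). x * inverse y) ` ((Z * S ^ n) \<times> Z)"
    have finW: "finite (?W n)" for n using Z finS by (simp add: finite_set_times)
    have "N / (2 * K) * real (card (?W (Suc n))) \<le> card (?W n \<times> quotients Z)"
    proof (rule mult_card_le_fibres[where f = "\<lambda>(x, y). x * y" and B = "?W (Suc n) \<union> (\<lambda>(x, y). x * y) ` (?W n \<times> quotients Z)"])
      fix w assume "w \<in> ?W (Suc n)"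
      then obtain z t s v where w: "w = z * t * s * inverse v" "z \<in> Z" "t \<in> S ^ n" "s \<in> S" "v \<in> Z"
        by (auto simp: power_Suc2 set_times_image mult.assoc simp del: power_Suc)
      have "real (m s) \<le> card {e \<in> ?W n \<times> quotients Z. (case e of (x, y) \<Rightarrow> x * y) = w}"
        unfolding m_def of_nat_le_iff
      proof (rule card_inj_on_le)
        show "inj_on (\<lambda>x. (z * t * inverse x, x * s * inverse v)) {x \<in> Z. x * s \<in> Z}"
          by (auto simp: inj_on_def)
        have "z * t * inverse x \<in> ?W n" if "x \<in> Z" for x
          using w that by (intro image_eqI[of _ _ "(z * t, x)"]) auto
        moreover have "x * s * inverse v \<in> quotients Z" if "x * s \<in> Z" for x
          unfolding quotients_def using w that by (intro image_eqI[of _ _ "(x * s, v)"]) auto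
        ultimately show "(\<lambda>x. (z * t * inverse x, x * s * inverse v)) ` {x \<in> Z. x * s \<in> Z} \<subseteq>
            {e \<in> ?W n \<times> quotients Z. (case e of (x, y) \<Rightarrow> x * y) = w}"
          using w(1) by (auto simp: mult.assoc)
      qed (use finW finq in auto)
      then show "N / (2 * K) \<le> card {e \<in> ?W n \<times> quotients Z. (case e of (x, y) \<Rightarrow> x * y) = w}"
        using w by (simp add: S_def)
    qed (use finW[of n] finW[of "Suc n"] finq in \<open>auto simp del: power_Suc\<close>)
    also have "\<dots> = card (?W n) * card (quotients Z)" by (simp add: card_cartesian_product)
    also have "\<dots> \<le> card (?W n) * (K * N)" using K by (simp add: N_def mult_left_mono)
    finally have "N / (2 * K) * real (card (?W (Suc n))) * (N / (2 * K)) ^ n \<le> card (?W n) * (K * N) * (N / (2 * K)) ^ n"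
      using N K0 by (intro mult_right_mono) auto
    also have "\<dots> = (K * N) * (card (?W n) * (N / (2 * K)) ^ n)" by simp
    also have "\<dots> \<le> (K * N) * (K * N) ^ (n + 1)" using Suc N K0 by (intro mult_left_mono) auto
    finally show ?case by (simp add: mult_ac)
  qed
  have small: "real (card (S ^ n)) \<le> K ^ (n + 1) * (2 * K) ^ n * N" for n
  proof -
    obtain z where z: "z \<in> Z" using Z by blast
    let ?W = "(\<lambda>(x, y). x * inverse y) ` ((Z * S ^ n) \<times> Z)"
    have "card (S ^ n) = card ((\<lambda>s. z * s * inverse z) ` (S ^ n))"
      by (simp add: card_image inj_on_def)
    also have "\<dots> \<le> card ?W"
    proof (intro card_mono)
      show "(\<lambda>s. z * s * inverse z) ` (S ^ n) \<subseteq> ?W"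
      proof (rule image_subsetI)
        fix s assume "s \<in> S ^ n"
        then show "z * s * inverse z \<in> ?W" using z by (intro image_eqI[of _ _ "(z * s, z)"]) auto
      qed
    qed (use Z finS in \<open>auto simp: finite_set_times\<close>)
    finally have "card (S ^ n) * (N / (2 * K)) ^ n \<le> card ?W * (N / (2 * K)) ^ n"
      using N K0 by (intro mult_right_mono) auto
    also note pw[of n]
    finally show ?thesis using N K0 by (simp add: power_divide power_mult_distrib field_simps)
  qed
  show ?thesis
    by (rule that[of S y]) (use finS one sym SD cS cS' small y in \<open>auto simp: D_def N_def\<close>)
qed

section \<open>Convolution powers of probability measures on a finite group\<close>

locale finite_mgroup =
  fixes G :: "'a::mgroup set"
  assumes finite_G [simp]: "finite G" and one_G [simp]: "1 \<in> G"
    and mult_G [simp]: "x \<in> G \<Longrightarrow> y \<in> G \<Longrightarrow> x * y \<in> G"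
    and inverse_G [simp]: "x \<in> G \<Longrightarrow> inverse x \<in> G"
begin

lemma sum_left_translate: "x \<in> G \<Longrightarrow> (\<Sum>y\<in>G. h (x * y)) = (\<Sum>y\<in>G. h y)"
  by (rule sum.reindex_bij_witness[where i = "\<lambda>y. inverse x * y" and j = "\<lambda>y. x * y"]) auto

lemma sum_right_translate: "x \<in> G \<Longrightarrow> (\<Sum>y\<in>G. h (y * x)) = (\<Sum>y\<in>G. h y)"
  by (rule sum.reindex_bij_witness[where i = "\<lambda>y. y * inverse x" and j = "\<lambda>y. y * x"]) (auto simp: mult.assoc)

lemma sum_inverse: "(\<Sum>y\<in>G. h (inverse y)) = (\<Sum>y\<in>G. h y)"
  by (rule sum.reindex_bij_witness[where i = inverse and j = inverse]) auto

definition conv :: "('a \<Rightarrow> real) \<Rightarrow> ('a \<Rightarrow> real) \<Rightarrow> 'a \<Rightarrow> real" where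
  "conv f g x = (\<Sum>y\<in>G. f y * g (inverse y * x))"

lemma conv_alt:
  assumes "x \<in> G"
  shows "conv f g x = (\<Sum>y\<in>G. f (x * inverse y) * g y)"
  unfolding conv_def
  by (rule sum.reindex_bij_witness[where i = "\<lambda>z. x * inverse z" and j = "\<lambda>y. inverse y * x"])
    (use assms in \<open>auto simp: mult.assoc\<close>)

lemma sum_conv: "(\<Sum>x\<in>G. conv f g x * h x) = (\<Sum>y\<in>G. \<Sum>z\<in>G. f y * g z * h (y * z))"
proof -
  have "(\<Sum>x\<in>G. conv f g x * h x) = (\<Sum>x\<in>G. \<Sum>y\<in>G. f y * g (inverse y * x) * h x)"
    by (simp add: conv_def sum_distrib_right)
  also have "\<dots> = (\<Sum>y\<in>G. \<Sum>x\<in>G. f y * g (inverse y * x) * h x)" by (rule sum.swap)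
  also have "\<dots> = (\<Sum>y\<in>G. \<Sum>z\<in>G. f y * g z * h (y * z))"
  proof (rule sum.cong[OF refl])
    fix y assume "y \<in> G"
    then show "(\<Sum>x\<in>G. f y * g (inverse y * x) * h x) = (\<Sum>z\<in>G. f y * g z * h (y * z))"
      using sum_left_translate[of y "\<lambda>x. f y * g (inverse y * x) * h x"] by simp
  qed
  finally show ?thesis .
qed

lemma sum_conv_1: "(\<Sum>x\<in>G. conv f g x) = (\<Sum>x\<in>G. f x) * (\<Sum>x\<in>G. g x)"
  using sum_conv[of f g "\<lambda>_. 1"] by (simp add: sum_product)

lemma conv_assoc:
  assumes "x \<in> G"
  shows "conv (conv f g) h x = conv f (conv g h) x"
proof -
  have "conv (conv f g) h x = (\<Sum>y\<in>G. \<Sum>z\<in>G. f y * g z * h (inverse (y * z) * x))"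
    unfolding conv_def[of "conv f g"] by (rule sum_conv)
  also have "\<dots> = conv f (conv g h) x"
    by (simp add: conv_def sum_distrib_left mult.assoc)
  finally show ?thesis .
qed

lemma conv_cong:
  "\<lbrakk>x \<in> G; \<And>y. y \<in> G \<Longrightarrow> f y = f' y; \<And>y. y \<in> G \<Longrightarrow> g y = g' y\<rbrakk> \<Longrightarrow> conv f g x = conv f' g' x"
  by (auto simp: conv_def intro!: sum.cong)

lemma conv_nonneg:
  "\<lbrakk>x \<in> G; \<And>y. y \<in> G \<Longrightarrow> 0 \<le> f y; \<And>y. y \<in> G \<Longrightarrow> 0 \<le> g y\<rbrakk> \<Longrightarrow> 0 \<le> conv f g x"
  by (auto simp: conv_def intro!: sum_nonneg)

lemma weighted_Cauchy_Schwarz: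
  fixes w u :: "'b \<Rightarrow> real"
  assumes "\<And>i. i \<in> I \<Longrightarrow> w i \<ge> 0"
  shows "(\<Sum>i\<in>I. w i * u i)\<^sup>2 \<le> (\<Sum>i\<in>I. w i) * (\<Sum>i\<in>I. w i * (u i)\<^sup>2)"
proof -
  have "(\<Sum>i\<in>I. w i * u i)\<^sup>2 = (\<Sum>i\<in>I. sqrt (w i) * (sqrt (w i) * u i))\<^sup>2"
    using assms by (simp add: mult.assoc[symmetric])
  also have "\<dots> \<le> (\<Sum>i\<in>I. (sqrt (w i))\<^sup>2) * (\<Sum>i\<in>I. (sqrt (w i) * u i)\<^sup>2)"
    by (rule Cauchy_Schwarz_ineq_sum)
  also have "\<dots> = (\<Sum>i\<in>I. w i) * (\<Sum>i\<in>I. w i * (u i)\<^sup>2)"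
    using assms by (simp add: power_mult_distrib)
  finally show ?thesis .
qed

lemma conv_L2_left:
  assumes "\<And>y. y \<in> G \<Longrightarrow> f y \<ge> 0"
  shows "(\<Sum>x\<in>G. (conv f g x)\<^sup>2) \<le> (\<Sum>x\<in>G. f x)\<^sup>2 * (\<Sum>x\<in>G. (g x)\<^sup>2)"
proof -
  have "(\<Sum>x\<in>G. (conv f g x)\<^sup>2) \<le> (\<Sum>x\<in>G. (\<Sum>y\<in>G. f y) * conv f (\<lambda>z. (g z)\<^sup>2) x)"
    unfolding conv_def by (intro sum_mono weighted_Cauchy_Schwarz) (use assms in auto)
  also have "\<dots> = (\<Sum>x\<in>G. f x)\<^sup>2 * (\<Sum>x\<in>G. (g x)\<^sup>2)"
    by (simp add: sum_conv_1 power2_eq_square flip: sum_distrib_left)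
  finally show ?thesis .
qed

lemma conv_L2_right:
  assumes "\<And>y. y \<in> G \<Longrightarrow> g y \<ge> 0"
  shows "(\<Sum>x\<in>G. (conv f g x)\<^sup>2) \<le> (\<Sum>x\<in>G. g x)\<^sup>2 * (\<Sum>x\<in>G. (f x)\<^sup>2)"
proof -
  have "(\<Sum>x\<in>G. (conv f g x)\<^sup>2) \<le> (\<Sum>x\<in>G. (\<Sum>y\<in>G. g y) * conv (\<lambda>z. (f z)\<^sup>2) g x)"
  proof (rule sum_mono)
    fix x assume x: "x \<in> G"
    show "(conv f g x)\<^sup>2 \<le> (\<Sum>y\<in>G. g y) * conv (\<lambda>z. (f z)\<^sup>2) g x"
      using weighted_Cauchy_Schwarz[of G g "\<lambda>y. f (x * inverse y)"] assms
      by (simp add: conv_alt[OF x] mult.commute)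
  qed
  also have "\<dots> = (\<Sum>x\<in>G. g x)\<^sup>2 * (\<Sum>x\<in>G. (f x)\<^sup>2)"
    by (simp add: sum_conv_1 power2_eq_square flip: sum_distrib_left)
  finally show ?thesis .
qed

definition prob :: "('a \<Rightarrow> real) \<Rightarrow> bool" where
  "prob \<mu> \<longleftrightarrow> (\<forall>x\<in>G. \<mu> x \<ge> 0) \<and> (\<Sum>x\<in>G. \<mu> x) = 1"

definition energy :: "('a \<Rightarrow> real) \<Rightarrow> real" where
  "energy \<mu> = (\<Sum>x\<in>G. (\<mu> x)\<^sup>2)"

lemma prob_conv: "prob f \<Longrightarrow> prob g \<Longrightarrow> prob (conv f g)"
  by (auto simp: prob_def sum_conv_1 intro!: conv_nonneg)

text \<open>The numerical exponents are crude; \<open>45\<close> is the number of factors that the growth theorem for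
  \<open>SL\<^sub>2\<close> consumes.\<close>

theorem energy_conv_dichotomy:
  fixes L :: real
  assumes \<nu>: "prob \<nu>" and L: "L \<ge> 2" and sup: "\<forall>x\<in>G. \<nu> x \<le> L * energy \<nu>"
    and flat: "energy (conv \<nu> \<nu>) \<ge> energy \<nu> / L"
  obtains S y where "S \<subseteq> G" "1 \<in> S" "\<And>s. s \<in> S \<Longrightarrow> inverse s \<in> S" "y \<in> G"
    "real (card (S ^ 45)) \<le> L ^ 22500 * card S" "(\<Sum>s\<in>S. \<nu> (y * s)) \<ge> 1 / L ^ 300"
    "energy \<nu> * card S \<le> L ^ 250"
proof -
  define a where "a = energy \<nu>"
  \<comment> \<open>The part of \<open>\<nu>\<close> below this threshold has square norm at most
    \<open>\<tau>\<close>, so it accounts for at most 8 \<open>\<tau>\<close> = a / (2 L), half of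
    what \<open>flat\<close> provides.\<close>
  define \<tau> where "\<tau> = a / (16 * L)"
  define A where "A = {x \<in> G. \<nu> x \<ge> \<tau>}"
  define N where "N = real (card A)"
  have nn: "\<nu> x \<ge> 0" if "x \<in> G" for x using \<nu> that by (simp add: prob_def)
  have s1: "(\<Sum>x\<in>G. \<nu> x) = 1" using \<nu> by (simp add: prob_def)
  have a0: "a > 0"
  proof -
    have "\<exists>x\<in>G. \<nu> x \<noteq> 0" using s1 by (metis sum.neutral zero_neq_one)
    then obtain x where "x \<in> G" "\<nu> x \<noteq> 0" by blast
    then show ?thesis unfolding a_def energy_def by (intro sum_pos2[of _ x]) auto
  qed
  have \<tau>0: "\<tau> > 0" using a0 L by (simp add: \<tau>_def)
  \<comment> \<open>As 2 <= L, numerical factors are absorbed into the exponent of L.\<close>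
  have Lpow: "2 ^ k * L ^ m \<le> L ^ (k + m)" for k m
    unfolding power_add using L by (intro mult_right_mono power_mono) auto
  define h where "h x = (if \<nu> x \<ge> \<tau> then \<nu> x else 0)" for x
  define l where "l x = (if \<nu> x \<ge> \<tau> then 0 else \<nu> x)" for x
  have hn: "0 \<le> h x" "0 \<le> l x" "h x \<le> \<nu> x" "l x \<le> \<nu> x" "\<nu> x = h x + l x" if "x \<in> G" for x
    using nn[OF that] by (auto simp: h_def l_def)
  have hs: "0 \<le> (\<Sum>x\<in>G. h x)" "(\<Sum>x\<in>G. h x) \<le> 1" "(\<Sum>x\<in>G. \<nu> x)\<^sup>2 \<le> 1"
    using hn(1) sum_mono[of G h \<nu>] hn(3) s1 by (auto intro: sum_nonneg)
  then have hs2: "(\<Sum>x\<in>G. h x)\<^sup>2 \<le> 1" by (simp add: power_le_one)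
  have l2: "(\<Sum>x\<in>G. (l x)\<^sup>2) \<le> \<tau>"
  proof -
    have "(\<Sum>x\<in>G. (l x)\<^sup>2) \<le> (\<Sum>x\<in>G. \<tau> * \<nu> x)"
      unfolding power2_eq_square using hn \<tau>0 nn by (intro sum_mono mult_mono) (auto simp: l_def)
    then show ?thesis by (simp add: s1 flip: sum_distrib_left)
  qed
  have hh: "(\<Sum>x\<in>G. (conv h h x)\<^sup>2) \<ge> a / (4 * L)"
  proof -
    have split: "conv \<nu> \<nu> x = conv h h x + (conv l \<nu> x + conv h l x)" if "x \<in> G" for x
      unfolding conv_def sum.distrib[symmetric]
      by (rule sum.cong) (use that hn(5) in \<open>auto simp: algebra_simps\<close>)
    have sq: "(u + (v + w))\<^sup>2 \<le> 2 * u\<^sup>2 + (4 * v\<^sup>2 + 4 * w\<^sup>2)" for u v w :: real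
    proof -
      have "0 \<le> (u - (v + w))\<^sup>2 + 2 * (v - w)\<^sup>2" by simp
      then show ?thesis by (simp add: power2_eq_square algebra_simps)
    qed
    have "a / L \<le> (\<Sum>x\<in>G. (conv \<nu> \<nu> x)\<^sup>2)" using flat by (simp add: energy_def a_def)
    also have "\<dots> \<le> (\<Sum>x\<in>G. 2 * (conv h h x)\<^sup>2 + (4 * (conv l \<nu> x)\<^sup>2 + 4 * (conv h l x)\<^sup>2))"
      by (intro sum_mono) (simp add: split sq)
    also have "\<dots> = 2 * (\<Sum>x\<in>G. (conv h h x)\<^sup>2) + (4 * (\<Sum>x\<in>G. (conv l \<nu> x)\<^sup>2) + 4 * (\<Sum>x\<in>G. (conv h l x)\<^sup>2))"
      by (simp add: sum.distrib sum_distrib_left)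
    also have "(\<Sum>x\<in>G. (conv l \<nu> x)\<^sup>2) \<le> \<tau>"
      using conv_L2_right[of \<nu> l] nn l2 s1 by simp
    also have "(\<Sum>x\<in>G. (conv h l x)\<^sup>2) \<le> \<tau>"
    proof -
      have "(\<Sum>x\<in>G. h x)\<^sup>2 * (\<Sum>x\<in>G. (l x)\<^sup>2) \<le> 1 * \<tau>"
        using hs2 l2 by (intro mult_mono) (auto intro: sum_nonneg)
      then show ?thesis using conv_L2_left[of h l] hn(1) by fastforce
    qed
    finally have "a / L \<le> 2 * (\<Sum>x\<in>G. (conv h h x)\<^sup>2) + 8 * \<tau>" by simp
    moreover define t where "t = a / L"
    moreover have "8 * \<tau> = t / 2" using L by (simp add: \<tau>_def t_def)
    moreover have "a / (4 * L) = t / 4" by (simp add: t_def)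
    ultimately show ?thesis by linarith
  qed
  have finA: "finite A" and AG: "A \<subseteq> G" by (auto simp: A_def)
  have AA: "A * A \<subseteq> G" using AG by (auto simp: set_times_image subset_iff)
  \<comment> \<open>On \<open>A\<close> the measure is pinched between \<open>\<tau>\<close> and L
    a; up to powers of L it is uniform there, and its convolution counts representations.\<close>
  have conv_rep: "conv h h x = 0 \<or> x \<in> A * A \<and> conv h h x \<le> (L * a)\<^sup>2 * rep A x" if x: "x \<in> G" for x
  proof (cases "x \<in> A * A")
    case False
    have "h y * h (inverse y * x) = 0" if "y \<in> G" for y
    proof (rule ccontr)
      assume "h y * h (inverse y * x) \<noteq> 0"
      then have "y \<in> A" "inverse y * x \<in> A" using that x by (auto simp: h_def A_def split: if_splits)
      then have "y * (inverse y * x) \<in> A * A" by blast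
      then show False using False by simp
    qed
    then have "conv h h x = 0" unfolding conv_def by (intro sum.neutral ballI)
    then show ?thesis ..
  next
    case True
    have "conv h h x \<le> (\<Sum>y\<in>G. if y \<in> A \<and> inverse y * x \<in> A then (L * a)\<^sup>2 else 0)"
      unfolding conv_def power2_eq_square
    proof (rule sum_mono)
      fix y assume y: "y \<in> G"
      have "h y * h (inverse y * x) \<le> (L * a) * (L * a)"
        using hn[OF y] hn[of "inverse y * x"] y x bspec[OF sup y] bspec[OF sup, of "inverse y * x"] a0 L
        by (intro mult_mono) (auto simp: a_def)
      then show "h y * h (inverse y * x) \<le> (if y \<in> A \<and> inverse y * x \<in> A then (L * a) * (L * a) else 0)"
        using x y by (auto simp: h_def A_def)
    qed
    also have "\<dots> = (L * a)\<^sup>2 * card {y \<in> G. y \<in> A \<and> inverse y * x \<in> A}"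
      by (simp add: sum.If_cases Int_def)
    also have "{y \<in> G. y \<in> A \<and> inverse y * x \<in> A} = {y \<in> A. inverse y * x \<in> A}" using AG by auto
    finally show ?thesis using True by (simp add: rep_def)
  qed
  have en: "(\<Sum>z\<in>A * A. (real (rep A z))\<^sup>2) * (a ^ 3 * L ^ 7) \<ge> 1"
  proof -
    have "a / (4 * L) \<le> (\<Sum>x\<in>G. (conv h h x)\<^sup>2)" by (rule hh)
    also have "\<dots> \<le> (\<Sum>x\<in>G. if x \<in> A * A then ((L * a)\<^sup>2 * rep A x)\<^sup>2 else 0)"
    proof (rule sum_mono)
      fix x assume x: "x \<in> G"
      have "0 \<le> conv h h x" using x hn(1) by (intro conv_nonneg) auto
      then show "(conv h h x)\<^sup>2 \<le> (if x \<in> A * A then ((L * a)\<^sup>2 * rep A x)\<^sup>2 else 0)"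
        using conv_rep[OF x] by (auto intro: power_mono)
    qed
    also have "\<dots> = (\<Sum>x\<in>A * A. ((L * a)\<^sup>2 * rep A x)\<^sup>2)"
      using AA by (simp add: sum.If_cases Int_absorb1)
    also have "\<dots> = (L * a) ^ 4 * (\<Sum>z\<in>A * A. (real (rep A z))\<^sup>2)"
      by (simp add: power_mult_distrib sum_distrib_left flip: power_mult)
    finally have "1 \<le> 4 * L ^ 5 * a ^ 3 * (\<Sum>z\<in>A * A. (real (rep A z))\<^sup>2)"
      using a0 L by (simp add: field_simps eval_nat_numeral)
    also have "\<dots> \<le> L ^ 7 * a ^ 3 * (\<Sum>z\<in>A * A. (real (rep A z))\<^sup>2)"
      using Lpow[of 2 5] a0 by (intro mult_right_mono) (auto intro: sum_nonneg)
    finally show ?thesis by (simp add: mult_ac)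
  qed
  have finAA: "finite (A * A)" using finA by (simp add: finite_set_times)
  have Ane: "A \<noteq> {}" using en by (auto simp: set_times_image)
  have N0: "N > 0" using Ane finA by (simp add: N_def card_gt_0_iff)
  have "N * \<tau> \<le> 1"
  proof -
    have "N * \<tau> = (\<Sum>x\<in>A. \<tau>)" by (simp add: N_def)
    also have "\<dots> \<le> (\<Sum>x\<in>A. \<nu> x)" by (rule sum_mono) (simp add: A_def)
    also have "\<dots> \<le> (\<Sum>x\<in>G. \<nu> x)" using AG nn by (intro sum_mono2) auto
    finally show ?thesis using s1 by simp
  qed
  then have "N * a \<le> 16 * L" using L by (simp add: \<tau>_def field_simps)
  with Lpow[of 4 1] have Na: "N * a \<le> L ^ 5" by simp
  have Na': "N * a \<ge> 1 / L ^ 3"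
  proof -
    have "(\<Sum>z\<in>A * A. (real (rep A z))\<^sup>2) \<le> (\<Sum>z\<in>A * A. N * real (rep A z))"
      unfolding power2_eq_square using rep_le[OF finA] by (intro sum_mono mult_right_mono) (auto simp: N_def)
    also have "\<dots> = N * real (\<Sum>z\<in>A * A. rep A z)" by (simp add: sum_distrib_left)
    also have "\<dots> \<le> N * real (card (A \<times> A))"
    proof (intro mult_left_mono)
      have "card {e \<in> A \<times> A. fst e * snd e \<in> A * A} \<le> card (A \<times> A)" using finA by (intro card_mono) auto
      then show "real (\<Sum>z\<in>A * A. rep A z) \<le> real (card (A \<times> A))"
        unfolding sum_rep[OF finA finAA] of_nat_le_iff .
    qed (use N0 in auto)
    finally have "(\<Sum>z\<in>A * A. (real (rep A z))\<^sup>2) \<le> N ^ 3" by (simp add: card_cartesian_product N_def power3_eq_cube)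
    then have "1 \<le> N ^ 3 * (a ^ 3 * L ^ 7)"
      using en mult_right_mono[of _ _ "a ^ 3 * L ^ 7"] a0 L by (smt (verit) mult_nonneg_nonneg zero_le_power)
    also have "\<dots> \<le> N ^ 3 * (a ^ 3 * L ^ 9)"
      using a0 N0 L by (intro mult_left_mono power_increasing) auto
    also have "\<dots> = (N * a * L ^ 3) ^ 3" by (simp add: power_mult_distrib flip: power_mult)
    finally have "1 ^ 3 \<le> (N * a * L ^ 3) ^ 3" by simp
    then have "1 \<le> N * a * L ^ 3" using N0 a0 L by (subst (asm) power_mono_iff) auto
    then show ?thesis using L by (simp add: field_simps)
  qed
  have bsg_hyp: "(\<Sum>z\<in>A * A. (real (rep A z))\<^sup>2) \<ge> card A ^ 3 / L ^ 22"
  proof -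
    have "N ^ 3 * a ^ 3 \<le> L ^ 15" using power_mono[OF Na, of 3] N0 a0 by (simp add: power_mult_distrib flip: power_mult)
    also have "\<dots> \<le> L ^ 15 * ((\<Sum>z\<in>A * A. (real (rep A z))\<^sup>2) * (a ^ 3 * L ^ 7))"
      using mult_left_mono[OF en, of "L ^ 15"] L by simp
    also have "\<dots> = (\<Sum>z\<in>A * A. (real (rep A z))\<^sup>2) * L ^ 22 * a ^ 3"
      by (simp add: mult_ac flip: power_add)
    finally have "N ^ 3 \<le> (\<Sum>z\<in>A * A. (real (rep A z))\<^sup>2) * L ^ 22" using a0 by simp
    then show ?thesis using L by (simp add: N_def divide_le_eq)
  qed
  obtain Z where Z: "Z \<subseteq> A" "real (card Z) \<ge> card A / (8 * L ^ 22)"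
    "real (card (quotients Z)) \<le> 2 ^ 21 * (L ^ 22) ^ 9 * card A"
    by (rule balog_szemeredi_gowers[OF finA Ane _ bsg_hyp]) (use L in auto)
  have cZ: "N \<le> L ^ 25 * card Z"
  proof -
    have "N \<le> 8 * L ^ 22 * card Z" using Z(2) L by (simp add: N_def field_simps)
    also have "\<dots> \<le> L ^ 25 * card Z" using Lpow[of 3 22] by (intro mult_right_mono) auto
    finally show ?thesis .
  qed
  have Zne: "Z \<noteq> {}" using cZ N0 by auto
  have finZ: "finite Z" using Z(1) finA by (rule finite_subset)
  have q: "real (card (quotients Z)) \<le> L ^ 244 * card Z"
  proof -
    have "real (card (quotients Z)) \<le> 2 ^ 21 * L ^ 198 * N" using Z(3) by (simp add: N_def flip: power_mult)
    also have "\<dots> \<le> L ^ 219 * N" using Lpow[of 21 198] N0 by (intro mult_right_mono) auto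
    also have "\<dots> \<le> L ^ 219 * (L ^ 25 * card Z)" using cZ L by (intro mult_left_mono) auto
    finally show ?thesis by (simp add: mult.assoc[symmetric] flip: power_add)
  qed
  obtain S y where S: "finite S" "1 \<in> S" "\<And>s. s \<in> S \<Longrightarrow> inverse s \<in> S"
    "S \<subseteq> (\<lambda>(x, y). inverse x * y) ` (Z \<times> Z)"
    "real (card S) \<ge> card Z / (2 * L ^ 244)" "real (card S) \<le> 2 * L ^ 244 * card Z"
    "\<And>n. real (card (S ^ n)) \<le> (L ^ 244) ^ (n + 1) * (2 * L ^ 244) ^ n * card Z"
    "y \<in> Z" "real (card {s \<in> S. y * s \<in> Z}) \<ge> card Z / (2 * L ^ 244)"
    by (rule small_quotients_imp_approximate_group[OF finZ Zne q]) (rule that; blast)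
  have two: "2 * L ^ 244 \<le> L ^ 245" using Lpow[of 1 244] by simp
  have ZG: "Z \<subseteq> G" using Z(1) AG by blast
  have SG: "S \<subseteq> G" using S(4) ZG by (auto simp: subset_iff image_iff)
  have cS: "card Z \<le> L ^ 245 * card S"
  proof -
    have "card Z \<le> 2 * L ^ 244 * card S" using S(5) L by (simp add: field_simps)
    also have "\<dots> \<le> L ^ 245 * card S" using two by (intro mult_right_mono) auto
    finally show ?thesis .
  qed
  show ?thesis
  proof (rule that[OF SG S(2,3)])
    show "y \<in> G" using S(8) ZG by blast
    have "real (card (S ^ 45)) \<le> (L ^ 244) ^ 46 * (2 * L ^ 244) ^ 45 * card Z" using S(7)[of 45] by simp
    also have "\<dots> \<le> (L ^ 244) ^ 46 * (L ^ 245) ^ 45 * (L ^ 245 * card S)"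
      using two cS L by (intro mult_mono power_mono) auto
    also have "\<dots> = L ^ 22494 * card S" by (simp add: mult.assoc[symmetric] flip: power_add power_mult)
    also have "\<dots> \<le> L ^ 22500 * card S" using L by (intro mult_right_mono power_increasing) auto
    finally show "real (card (S ^ 45)) \<le> L ^ 22500 * card S" .
    have "a * card S \<le> a * (L ^ 245 * N)"
    proof (intro mult_left_mono)
      have "real (card S) \<le> 2 * L ^ 244 * card Z" by (rule S(6))
      also have "\<dots> \<le> L ^ 245 * N" using two card_mono[OF finA Z(1)] L by (intro mult_mono) (auto simp: N_def)
      finally show "real (card S) \<le> L ^ 245 * N" .
    qed (use a0 in auto)
    also have "\<dots> = L ^ 245 * (N * a)" by simp
    also have "\<dots> \<le> L ^ 245 * L ^ 5" using Na L by (intro mult_left_mono) auto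
    finally show "energy \<nu> * card S \<le> L ^ 250" by (simp add: a_def flip: power_add)
    \<comment> \<open>Each of the many \<open>s\<close> with y s in \<open>Z\<close> carries mass at
      least \<open>\<tau>\<close>, because \<open>Z\<close> is contained in
      \<open>A\<close>.\<close>
    have "1 / L ^ 3 / L ^ 275 \<le> N * a / L ^ 275" using Na' L by (intro divide_right_mono) auto
    also have "\<dots> = (N / L ^ 25) / L ^ 245 * (a / L ^ 5)" by (simp flip: power_add)
    also have "\<dots> \<le> card Z / (2 * L ^ 244) * \<tau>"
    proof (intro mult_mono)
      show "N / L ^ 25 / L ^ 245 \<le> card Z / (2 * L ^ 244)"
        using cZ two L by (intro frac_le) (auto simp: divide_le_eq mult.commute)
      show "a / L ^ 5 \<le> \<tau>" unfolding \<tau>_def using Lpow[of 4 1] L a0 by (intro divide_left_mono) auto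
    qed (use a0 L in auto)
    also have "\<dots> \<le> card {s \<in> S. y * s \<in> Z} * \<tau>" using S(9) \<tau>0 by (intro mult_right_mono) auto
    also have "\<dots> = (\<Sum>s\<in>{s \<in> S. y * s \<in> Z}. \<tau>)" by simp
    also have "\<dots> \<le> (\<Sum>s\<in>{s \<in> S. y * s \<in> Z}. \<nu> (y * s))"
      using Z(1) by (intro sum_mono) (auto simp: A_def)
    also have "\<dots> \<le> (\<Sum>s\<in>S. \<nu> (y * s))"
      using S(1) nn SG ZG S(8) by (intro sum_mono2) (auto simp: subset_iff)
    finally have "1 / L ^ 278 \<le> (\<Sum>s\<in>S. \<nu> (y * s))" by (simp flip: power_add)
    moreover have "1 / L ^ 300 \<le> 1 / L ^ 278" using L by (intro divide_left_mono power_increasing) auto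
    ultimately show "(\<Sum>s\<in>S. \<nu> (y * s)) \<ge> 1 / L ^ 300" by linarith
  qed
qed

text \<open>Repeated squaring: the index counts doublings, so this is the convolution power with
  exponent \<open>2 ^ k\<close>.\<close>

primrec convpow :: "('a \<Rightarrow> real) \<Rightarrow> nat \<Rightarrow> 'a \<Rightarrow> real" where
  "convpow \<mu> 0 = \<mu>"
| "convpow \<mu> (Suc k) = conv (convpow \<mu> k) (convpow \<mu> k)"

lemma prob_convpow: "prob \<mu> \<Longrightarrow> prob (convpow \<mu> k)"
  by (induction k) (simp_all add: prob_conv)

lemma conv_self_le_energy:
  assumes x: "x \<in> G"
  shows "conv f f x \<le> energy f"
proof -
  have "conv f f x \<le> (\<Sum>y\<in>G. ((f y)\<^sup>2 + (f (inverse y * x))\<^sup>2) / 2)"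
    unfolding conv_def
  proof (rule sum_mono)
    fix y show "f y * f (inverse y * x) \<le> ((f y)\<^sup>2 + (f (inverse y * x))\<^sup>2) / 2"
      using sum_squares_bound[of "f y" "f (inverse y * x)"] by simp
  qed
  also have "\<dots> = (energy f + (\<Sum>y\<in>G. (f (inverse y * x))\<^sup>2)) / 2"
    by (simp add: energy_def sum.distrib flip: sum_divide_distrib)
  also have "(\<Sum>y\<in>G. (f (inverse y * x))\<^sup>2) = energy f"
    using sum_inverse[of "\<lambda>y. (f (y * x))\<^sup>2"] sum_right_translate[OF x, of "\<lambda>y. (f y)\<^sup>2"]
    by (simp add: energy_def)
  finally show ?thesis by simp
qed

lemma energy_convpow_Suc:
  assumes "prob \<mu>"
  shows "energy (convpow \<mu> (Suc k)) \<le> energy (convpow \<mu> k)"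
  using conv_L2_left[of "convpow \<mu> k" "convpow \<mu> k"] prob_convpow[OF assms, of k]
  by (simp add: energy_def prob_def)

lemma energy_convpow_antimono:
  "prob \<mu> \<Longrightarrow> j \<le> k \<Longrightarrow> energy (convpow \<mu> k) \<le> energy (convpow \<mu> j)"
  by (rule lift_Suc_antimono_le[of "\<lambda>k. energy (convpow \<mu> k)"]) (auto simp del: convpow.simps intro: energy_convpow_Suc)

lemma energy_le_1: "prob \<mu> \<Longrightarrow> energy \<mu> \<le> 1"
proof -
  assume \<mu>: "prob \<mu>"
  have "energy \<mu> \<le> (\<Sum>x\<in>G. 1 * \<mu> x)"
    unfolding energy_def power2_eq_square
  proof (intro sum_mono mult_right_mono)
    fix x assume x: "x \<in> G"
    show "\<mu> x \<le> 1" using \<mu> x member_le_sum[of x G \<mu>] by (auto simp: prob_def)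
  qed (use \<mu> in \<open>auto simp: prob_def\<close>)
  then show ?thesis using \<mu> by (simp add: prob_def)
qed

lemma convpow_factor:
  assumes "prob \<mu>"
  shows "\<exists>\<rho>. prob \<rho> \<and> (\<forall>x\<in>G. convpow \<mu> k x = conv \<rho> \<mu> x)"
proof (induction k)
  case 0
  have "conv (\<lambda>x. if x = 1 then 1 else 0) \<mu> x = \<mu> x" for x
    by (simp add: conv_def if_distrib[of "\<lambda>c. c * _"] cong: if_cong)
  moreover have "prob (\<lambda>x. if x = 1 then 1 else 0)" by (simp add: prob_def)
  ultimately show ?case by auto
next
  case (Suc k)
  then obtain \<rho> where \<rho>: "prob \<rho>" "\<And>x. x \<in> G \<Longrightarrow> convpow \<mu> k x = conv \<rho> \<mu> x" by blast
  have "convpow \<mu> (Suc k) x = conv (conv (convpow \<mu> k) \<rho>) \<mu> x" if "x \<in> G" for x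
    using conv_cong[OF that, of "convpow \<mu> k" "convpow \<mu> k" "convpow \<mu> k" "conv \<rho> \<mu>"] \<rho>(2) conv_assoc[OF that]
    by simp
  then show ?case using prob_conv[OF prob_convpow[OF assms] \<rho>(1)] by blast
qed

text \<open>The power is an average of left translates of \<open>\<mu>\<close>, so some translate of
  \<open>S\<close> has at least the same mass under \<open>\<mu>\<close> itself. Structural
  conditions on \<open>S\<close> can therefore be tested on a single step of the walk.\<close>

lemma convpow_mass_translate:
  assumes \<mu>: "prob \<mu>" and S: "S \<subseteq> G" and y: "y \<in> G" and mass: "(\<Sum>s\<in>S. convpow \<mu> k (y * s)) \<ge> \<theta>"
  obtains g where "g \<in> G" "(\<Sum>s\<in>S. \<mu> (g * s)) \<ge> \<theta>"
proof -
  obtain \<rho> where \<rho>: "prob \<rho>" "\<And>x. x \<in> G \<Longrightarrow> convpow \<mu> k x = conv \<rho> \<mu> x"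
    using convpow_factor[OF \<mu>] by blast
  have "\<exists>z\<in>G. (\<Sum>s\<in>S. \<mu> (inverse z * y * s)) \<ge> \<theta>"
  proof (rule ccontr)
    assume "\<not> ?thesis"
    then have lt: "(\<Sum>s\<in>S. \<mu> (inverse z * y * s)) < \<theta>" if "z \<in> G" for z using that by auto
    have "\<exists>z\<in>G. \<rho> z \<noteq> 0" using \<rho>(1) by (metis prob_def sum.neutral zero_neq_one)
    then obtain z where z: "z \<in> G" "\<rho> z > 0" using \<rho>(1) by (auto simp: prob_def order_less_le)
    have "(\<Sum>s\<in>S. convpow \<mu> k (y * s)) = (\<Sum>s\<in>S. \<Sum>z\<in>G. \<rho> z * \<mu> (inverse z * y * s))"
      using S y \<rho>(2) by (intro sum.cong refl) (auto simp: conv_def mult.assoc subset_iff)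
    also have "\<dots> = (\<Sum>z\<in>G. \<Sum>s\<in>S. \<rho> z * \<mu> (inverse z * y * s))" by (rule sum.swap)
    also have "\<dots> = (\<Sum>z\<in>G. \<rho> z * (\<Sum>s\<in>S. \<mu> (inverse z * y * s)))" by (simp add: sum_distrib_left)
    also have "\<dots> < (\<Sum>z\<in>G. \<rho> z * \<theta>)"
    proof (rule sum_strict_mono_ex1)
      show "\<forall>z\<in>G. \<rho> z * (\<Sum>s\<in>S. \<mu> (inverse z * y * s)) \<le> \<rho> z * \<theta>"
        using lt \<rho>(1) by (auto simp: prob_def intro!: mult_left_mono intro: less_imp_le)
      show "\<exists>z\<in>G. \<rho> z * (\<Sum>s\<in>S. \<mu> (inverse z * y * s)) < \<rho> z * \<theta>"
        using z lt by (intro bexI[of _ z]) auto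
    qed simp
    also have "\<dots> = \<theta>" using \<rho>(1) by (simp add: prob_def flip: sum_distrib_right)
    finally show False using mass by simp
  qed
  then show ?thesis using that y by (meson inverse_G mult_G)
qed

text \<open>Doublings are taken in pairs because the dichotomy has two hypotheses. If a pair fails
  to save a factor L, the energies before, between and after are comparable: the first doubling
  yields the pointwise bound, as a convolution square is bounded by the energy, and the second
  yields flatness. Then \<open>S\<close> has at least \<open>M\<close> elements and the energy is
  small at once; if no pair fails, the savings multiply to \<open>L ^ J\<close>.\<close>

theorem energy_convpow_decay:
  fixes L M :: real
  assumes \<mu>: "prob \<mu>" and L: "L \<ge> 2" and M: "M > 0"
    and growth: "\<And>S g. \<lbrakk>S \<subseteq> G; 1 \<in> S; \<And>s. s \<in> S \<Longrightarrow> inverse s \<in> S; g \<in> G;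
      real (card (S ^ 45)) \<le> L ^ 22500 * card S; (\<Sum>s\<in>S. \<mu> (g * s)) \<ge> 1 / L ^ 300\<rbrakk> \<Longrightarrow> M \<le> real (card S)"
  shows "energy (convpow \<mu> (2 * J)) \<le> max (1 / L ^ J) (L ^ 250 / M)"
proof (cases "\<forall>j<J. energy (convpow \<mu> (2 * Suc j)) \<le> energy (convpow \<mu> (2 * j)) / L")
  case True
  then have "energy (convpow \<mu> (2 * j)) \<le> 1 / L ^ j" if "j \<le> J" for j
    using that
  proof (induction j)
    case 0
    then show ?case using energy_le_1[OF \<mu>] by simp
  next
    case (Suc j)
    then have "energy (convpow \<mu> (2 * Suc j)) \<le> energy (convpow \<mu> (2 * j)) / L" by (meson Suc_le_lessD)
    also have "\<dots> \<le> 1 / L ^ j / L" using Suc L by (intro divide_right_mono) auto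
    finally show ?case by (simp add: mult.commute)
  qed
  then show ?thesis by (simp add: le_max_iff_disj)
next
  case False
  then obtain j where j: "j < J" "energy (convpow \<mu> (2 * Suc j)) \<ge> energy (convpow \<mu> (2 * j)) / L"
    by (meson not_le less_imp_le)
  define \<nu> where "\<nu> = convpow \<mu> (Suc (2 * j))"
  have pr: "prob \<nu>" unfolding \<nu>_def by (rule prob_convpow[OF \<mu>])
  have e1: "energy \<nu> \<le> energy (convpow \<mu> (2 * j))" unfolding \<nu>_def by (rule energy_convpow_Suc[OF \<mu>])
  have cv: "energy (conv \<nu> \<nu>) = energy (convpow \<mu> (2 * Suc j))" by (simp add: \<nu>_def)
  have e2: "energy (conv \<nu> \<nu>) \<le> energy \<nu>"
    using energy_convpow_Suc[OF \<mu>, of "Suc (2 * j)"] by (simp add: \<nu>_def)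
  have "energy \<nu> / L \<le> energy (convpow \<mu> (2 * j)) / L" using e1 L by (intro divide_right_mono) auto
  then have flat: "energy (conv \<nu> \<nu>) \<ge> energy \<nu> / L" using j(2) cv by simp
  have sup: "\<forall>x\<in>G. \<nu> x \<le> L * energy \<nu>"
  proof
    fix x assume that: "x \<in> G"
    have "\<nu> x \<le> energy (convpow \<mu> (2 * j))"
      unfolding \<nu>_def using conv_self_le_energy[OF that] by simp
    also have "\<dots> \<le> L * energy (conv \<nu> \<nu>)" using j(2) cv L by (simp add: divide_le_eq mult.commute)
    also have "\<dots> \<le> L * energy \<nu>" using e2 L by simp
    finally show "\<nu> x \<le> L * energy \<nu>" .
  qed
  obtain S y where S: "S \<subseteq> G" "1 \<in> S" "\<And>s. s \<in> S \<Longrightarrow> inverse s \<in> S" "y \<in> G"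
    "real (card (S ^ 45)) \<le> L ^ 22500 * card S" "(\<Sum>s\<in>S. \<nu> (y * s)) \<ge> 1 / L ^ 300"
    "energy \<nu> * card S \<le> L ^ 250"
    by (rule energy_conv_dichotomy[OF pr L sup flat]) (rule that; blast)
  obtain g where g: "g \<in> G" "(\<Sum>s\<in>S. \<mu> (g * s)) \<ge> 1 / L ^ 300"
    using convpow_mass_translate[OF \<mu> S(1,4)] S(6) unfolding \<nu>_def by blast
  have "M \<le> card S" using growth[OF S(1-3) g(1) S(5) g(2)] .
  then have "energy \<nu> * M \<le> energy \<nu> * card S"
    by (intro mult_left_mono) (auto simp: energy_def intro: sum_nonneg)
  with S(7) have "energy \<nu> \<le> L ^ 250 / M" using M by (simp add: le_divide_eq)
  moreover have "energy (convpow \<mu> (2 * J)) \<le> energy \<nu>"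
    unfolding \<nu>_def by (rule energy_convpow_antimono[OF \<mu>]) (use j(1) in simp)
  ultimately show ?thesis by simp
qed

lemma sym_convpow:
  assumes "\<And>x. x \<in> G \<Longrightarrow> \<mu> (inverse x) = \<mu> x" "x \<in> G"
  shows "convpow \<mu> k (inverse x) = convpow \<mu> k x"
  using assms(2)
proof (induction k arbitrary: x)
  case (Suc k)
  let ?f = "convpow \<mu> k"
  have "conv ?f ?f (inverse x) = (\<Sum>y\<in>G. ?f y * ?f (x * y))"
    unfolding conv_def using Suc.IH[of "x * _"] Suc.prems by (intro sum.cong refl) simp
  also have "\<dots> = (\<Sum>y\<in>G. ?f (inverse y) * ?f (x * inverse y))"
    by (rule sum_inverse[symmetric])
  also have "\<dots> = conv ?f ?f x"
    unfolding conv_alt[OF Suc.prems] using Suc.IH by (intro sum.cong refl) simp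
  finally show ?case by simp
qed (use assms in auto)

end

section \<open>A pivot argument in the affine group\<close>

lemma card_collisions:
  assumes "finite X" "f ` X \<subseteq> Y" "finite Y"
  shows "(card X)\<^sup>2 \<le> card Y * card {e \<in> X \<times> X. f (fst e) = f (snd e)}"
proof -
  let ?n = "\<lambda>y. card {x \<in> X. f x = y}"
  have "real (card X) = (\<Sum>y\<in>Y. real (?n y))"
    using sum.group[OF assms(1,3,2), of "\<lambda>_. 1::real"] by simp
  then have "(real (card X))\<^sup>2 \<le> card Y * (\<Sum>y\<in>Y. (real (?n y))\<^sup>2)"
    using sum_squared_le_sum_of_squares[of "\<lambda>y. real (?n y)" Y] by (simp add: mult.commute)
  also have "(\<Sum>y\<in>Y. (real (?n y))\<^sup>2) = real (card (Sigma Y (\<lambda>y. {x \<in> X. f x = y} \<times> {x \<in> X. f x = y})))"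
    using assms by (simp add: card_cartesian_product power2_eq_square)
  also have "card (Sigma Y (\<lambda>y. {x \<in> X. f x = y} \<times> {x \<in> X. f x = y})) = card {e \<in> X \<times> X. f (fst e) = f (snd e)}"
    by (rule bij_betw_same_card[of snd], rule bij_betwI[where g = "\<lambda>e. (f (fst e), e)"]) (use assms(2) in auto)
  finally have "real ((card X)\<^sup>2) \<le> real (card Y * card {e \<in> X \<times> X. f (fst e) = f (snd e)})" by simp
  then show ?thesis by (simp only: of_nat_le_iff)
qed

lemma residues_eq_iff_dvd:
  "x \<in> {0..<p} \<Longrightarrow> y \<in> {0..<p} \<Longrightarrow> p dvd x - y \<longleftrightarrow> x = (y::int)"
  by (metis atLeastLessThan_iff cong_def cong_iff_dvd_diff mod_pos_pos_trivial)

text \<open>Call \<open>y\<close> involved if the map \<open>(e, d) \<mapsto> e + d y\<close> on \<open>E \<times> D\<close> is not injective.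
  Multiplying by the denominator of \<open>y = (e\<^sub>1 - e\<^sub>2) / (d - d')\<close> maps \<open>E + D (y + e\<^sub>0)\<close> into the small
  set \<open>E'\<close>, so that \<open>y + e\<^sub>0\<close> is involved as well.\<close>

theorem affine_growth:
  fixes p :: int and D E E' :: "int set"
  assumes p: "prime p" and E: "E \<subseteq> {0..<p}" and D: "D \<subseteq> {0..<p}" and E': "finite E'"
    and e0: "e\<^sub>0 \<in> E" "e\<^sub>0 \<noteq> 0" and D2: "card D \<ge> 2" and small: "2 * card E' \<le> card E * card D"
    and closed: "\<And>d d' c e e1 e2. \<lbrakk>d \<in> D; d' \<in> D; c \<in> D; e \<in> E; e1 \<in> E; e2 \<in> E\<rbrakk> \<Longrightarrow>
      ((d - d') * e + c * (e1 - e2)) mod p \<in> E' \<and> ((d - d') * e + c * (e1 - e2) + (d - d') * c * e\<^sub>0) mod p \<in> E'"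
  shows "p \<le> 2 * int (card E')"
proof -
  have p1: "p > 1" using p by (simp add: prime_gt_1_int)
  have finD: "finite D" and finE: "finite E" using D E by (auto intro: finite_subset)
  have eqE: "e = e'" if "e \<in> E" "e' \<in> E" "p dvd e - e'" for e e'
    using residues_eq_iff_dvd[of e p e'] that E by (metis subsetD)
  have eqD: "d = d'" if "d \<in> D" "d' \<in> D" "p dvd d - d'" for d d'
    using residues_eq_iff_dvd[of d p d'] that D by (metis subsetD)
  define involved where "involved y \<longleftrightarrow> (\<exists>d\<in>D. \<exists>d'\<in>D. \<exists>e1\<in>E. \<exists>e2\<in>E. d \<noteq> d' \<and> p dvd (d - d') * y - (e1 - e2))" for y
  have n0: "card E * card D > 0" using e0 D2 finE finD by (auto simp: card_gt_0_iff)
  have step: "involved (y + e\<^sub>0)" if "involved y" for y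
  proof -
    obtain d d' e1 e2 where d: "d \<in> D" "d' \<in> D" "e1 \<in> E" "e2 \<in> E" "d \<noteq> d'" "p dvd (d - d') * y - (e1 - e2)"
      using \<open>involved y\<close> by (auto simp: involved_def)
    define f where "f = (\<lambda>(e, c). ((d - d') * (e + c * (y + e\<^sub>0))) mod p)"
    have "f ` (E \<times> D) \<subseteq> E'"
    proof clarsimp
      fix e c assume ec: "e \<in> E" "c \<in> D"
      have "p dvd c * ((d - d') * y - (e1 - e2))" using d(6) by simp
      then have "f (e, c) = ((d - d') * e + c * (e1 - e2) + (d - d') * c * e\<^sub>0) mod p"
        unfolding f_def by (simp add: mod_eq_dvd_iff algebra_simps)
      then show "f (e, c) \<in> E'" using closed[OF d(1,2) ec(2,1) d(3,4)] by simp
    qed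
    then have "card (f ` (E \<times> D)) \<le> card E'" using E' by (intro card_mono) auto
    also have "\<dots> < card (E \<times> D)" unfolding card_cartesian_product using small n0 by linarith
    finally have "\<not> inj_on f (E \<times> D)" by (rule pigeonhole)
    then obtain e c e' c' where ec: "e \<in> E" "c \<in> D" "e' \<in> E" "c' \<in> D" "(e, c) \<noteq> (e', c')" "f (e, c) = f (e', c')"
      by (auto simp: inj_on_def)
    then have "p dvd (d - d') * ((c' - c) * (y + e\<^sub>0) - (e - e'))"
      unfolding f_def by (simp add: mod_eq_dvd_iff algebra_simps dvd_diff_commute)
    moreover have "\<not> p dvd d - d'" using d eqD by blast
    ultimately have dv: "p dvd (c' - c) * (y + e\<^sub>0) - (e - e')" using prime_dvd_mult_iff[OF p] by blast
    have "c' \<noteq> c"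
    proof
      assume "c' = c"
      then have "p dvd e - e'" using dv by (simp add: dvd_diff_commute)
      then have "e = e'" using eqE ec by blast
      then show False using ec \<open>c' = c\<close> by simp
    qed
    then show ?thesis unfolding involved_def using ec dv by blast
  qed
  \<comment> \<open>As \<open>e\<^sub>0\<close> is invertible, its multiples exhaust the field, so
    being involved spreads from 0 to every \<open>y\<close>.\<close>
  have "involved (int n * e\<^sub>0)" for n
  proof (induction n)
    case 0
    obtain d d' where "d \<in> D" "d' \<in> D" "d \<noteq> d'" using D2 finD by (metis card_2_iff' card_le_Suc0_iff_eq not_less_eq_eq numeral_2_eq_2)
    then show ?case unfolding involved_def using e0(1) by force
  next
    case (Suc n)
    then show ?case using step[of "int n * e\<^sub>0"] by (simp add: algebra_simps)
  qed
  moreover have "\<exists>n. p dvd y - int n * e\<^sub>0" for y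
  proof -
    have "\<not> p dvd e\<^sub>0" using residues_eq_iff_dvd[of e\<^sub>0 p 0] e0 E p1 by auto
    then have "coprime e\<^sub>0 p" using p by (metis coprime_commute prime_imp_coprime_int)
    then obtain x where "[e\<^sub>0 * x = 1] (mod p)" using cong_solve_coprime_int by blast
    then have "[y = e\<^sub>0 * x * y] (mod p)" using cong_scalar_right[of "e\<^sub>0 * x" 1 p y] by (simp add: cong_sym)
    also have "[e\<^sub>0 * x * y = e\<^sub>0 * ((x * y) mod p)] (mod p)" by (simp add: cong_def mod_simps mult.assoc)
    finally have "p dvd y - e\<^sub>0 * ((x * y) mod p)" by (simp add: cong_iff_dvd_diff)
    moreover have "(x * y) mod p = int (nat ((x * y) mod p))" using p1 by simp
    ultimately show ?thesis by (metis mult.commute)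
  qed
  moreover have "involved y" if "involved z" "p dvd y - z" for y z
  proof -
    obtain d d' e1 e2 where d: "d \<in> D" "d' \<in> D" "e1 \<in> E" "e2 \<in> E" "d \<noteq> d'" "p dvd (d - d') * z - (e1 - e2)"
      using \<open>involved z\<close> by (auto simp: involved_def)
    have "p dvd ((d - d') * z - (e1 - e2)) + (d - d') * (y - z)" using d(6) that(2) by (meson dvd_add dvd_mult)
    then have "p dvd (d - d') * y - (e1 - e2)" by (simp add: algebra_simps)
    then show ?thesis using d unfolding involved_def by blast
  qed
  ultimately have all: "involved y" for y by meson
  define X where "X = E \<times> D"
  define n where "n = card E * card D"
  have cX: "card X = n" and finX: "finite X" using finE finD by (simp_all add: X_def n_def card_cartesian_product)
  define f where "f y = (\<lambda>(e, c). (e + c * y) mod p)" for y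
  define Q where "Q y = {z \<in> X \<times> X. f y (fst z) = f y (snd z)}" for y
  \<comment> \<open>Multiplying by the denominator of \<open>y\<close> moves all values into
    \<open>E'\<close> without changing which pairs collide; Cauchy-Schwarz then forces many
    collisions for every \<open>y\<close>.\<close>
  have coll: "n\<^sup>2 \<le> card E' * card (Q y)" for y
  proof -
    obtain d d' e1 e2 where d: "d \<in> D" "d' \<in> D" "e1 \<in> E" "e2 \<in> E" "d \<noteq> d'" "p dvd (d - d') * y - (e1 - e2)"
      using all[of y] by (auto simp: involved_def)
    define g where "g = (\<lambda>(e, c). ((d - d') * (e + c * y)) mod p)"
    have "g ` X \<subseteq> E'"
    proof (clarsimp simp: X_def)
      fix e c assume ec: "e \<in> E" "c \<in> D"
      have "p dvd c * ((d - d') * y - (e1 - e2))" using d(6) by simp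
      then have "g (e, c) = ((d - d') * e + c * (e1 - e2)) mod p"
        unfolding g_def by (simp add: mod_eq_dvd_iff algebra_simps)
      then show "g (e, c) \<in> E'" using closed[OF d(1,2) ec(2,1) d(3,4)] by simp
    qed
    then have "n\<^sup>2 \<le> card E' * card {z \<in> X \<times> X. g (fst z) = g (snd z)}"
      using card_collisions[OF finX _ E', of g] cX by simp
    also have "{z \<in> X \<times> X. g (fst z) = g (snd z)} = Q y"
    proof -
      have nd: "\<not> p dvd d - d'" using d eqD by blast
      have "g a = g b \<longleftrightarrow> f y a = f y b" for a b
      proof -
        have "g a = g b \<longleftrightarrow> p dvd (d - d') * ((fst a + snd a * y) - (fst b + snd b * y))"
          unfolding g_def by (simp add: mod_eq_dvd_iff case_prod_beta right_diff_distrib)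
        then show ?thesis using nd by (simp add: prime_dvd_mult_iff[OF p] f_def mod_eq_dvd_iff case_prod_beta)
      qed
      then show ?thesis by (simp add: Q_def)
    qed
    finally show ?thesis .
  qed
  have finQ: "finite (Q y)" for y using finX by (simp add: Q_def)
  \<comment> \<open>Double counting over \<open>y\<close>: a pair off the diagonal collides for at
    most one \<open>y\<close>, since a collision determines the slope. Hence p n^2 <= |E'| (p n +
    n^2), and 2 |E'| <= n absorbs the first term on the right.\<close>
  have "nat p * n\<^sup>2 = (\<Sum>y\<in>{0..<p}. n\<^sup>2)" by simp
  also have "\<dots> \<le> (\<Sum>y\<in>{0..<p}. card E' * card (Q y))" by (intro sum_mono coll)
  also have "\<dots> = card E' * card (Sigma {0..<p} Q)" using finQ by (simp add: sum_distrib_left)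
  also have "card (Sigma {0..<p} Q) \<le> nat p * n + n\<^sup>2"
  proof -
    let ?S1 = "{(y, z) \<in> Sigma {0..<p} Q. fst z = snd z}" and ?S2 = "{(y, z) \<in> Sigma {0..<p} Q. fst z \<noteq> snd z}"
    have "card ?S1 \<le> card ({0..<p} \<times> X)"
      by (rule card_inj_on_le[of "\<lambda>(y, z). (y, fst z)"]) (use finX in \<open>auto simp: inj_on_def Q_def prod_eq_iff\<close>)
    moreover have "card ?S2 \<le> card (X \<times> X)"
    proof (rule card_inj_on_le[of snd])
      show "inj_on snd ?S2"
      proof (rule inj_onI, clarsimp)
        fix y y' e c e' c'
        assume as: "((e, c), (e', c')) \<in> Q y" "((e, c), (e', c')) \<in> Q y'" "0 \<le> y" "y < p" "0 \<le> y'" "y' < p" "e = e' \<longrightarrow> c \<noteq> c'"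
        then have m: "e \<in> E" "e' \<in> E" "c \<in> D" "c' \<in> D" by (auto simp: Q_def X_def)
        have dv: "p dvd (e + c * y) - (e' + c' * y)" "p dvd (e + c * y') - (e' + c' * y')"
          using as by (auto simp: Q_def f_def mod_eq_dvd_iff)
        have "c \<noteq> c'"
        proof
          assume "c = c'"
          then have "p dvd e - e'" using dv by simp
          then have "e = e'" using eqE m by blast
          then show False using as \<open>c = c'\<close> by simp
        qed
        then have nc: "\<not> p dvd c - c'" using m eqD by blast
        have "p dvd ((e + c * y) - (e' + c' * y)) - ((e + c * y') - (e' + c' * y'))" using dv by (rule dvd_diff)
        then have "p dvd (c - c') * (y - y')" by (simp add: algebra_simps)
        then have "p dvd y - y'" using nc prime_dvd_mult_iff[OF p] by blast
        then show "y = y'" using residues_eq_iff_dvd[of y p y'] as by simp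
      qed
    qed (use finX in \<open>auto simp: Q_def\<close>)
    moreover have eq: "Sigma {0..<p} Q = ?S1 \<union> ?S2" by auto
    have "card (Sigma {0..<p} Q) \<le> card ?S1 + card ?S2"
      by (rule ord_eq_le_trans[OF arg_cong[OF eq, of card] card_Un_le])
    moreover have "card ({0..<p} \<times> X) = nat p * n" "card (X \<times> X) = n\<^sup>2"
      using cX by (simp_all add: card_cartesian_product power2_eq_square)
    ultimately show ?thesis by linarith
  qed
  finally have "nat p * n * n \<le> card E' * (nat p + n) * n"
    by (simp add: power2_eq_square algebra_simps)
  then have "nat p * n \<le> card E' * (nat p + n)" using n0 by (simp add: n_def)
  then have "2 * (nat p * n) \<le> 2 * card E' * nat p + 2 * card E' * n" by (simp add: algebra_simps)
  also have "\<dots> \<le> n * nat p + 2 * card E' * n" using small by (simp add: n_def)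
  finally have "n * nat p \<le> n * (2 * card E')" by (simp add: algebra_simps)
  then have "nat p \<le> 2 * card E'" using n0 by (simp add: n_def)
  then show ?thesis by linarith
qed

section \<open>The group $\mathrm{SL}_2$ over a prime field\<close>

text \<open>If h g = h' g' with g and g' in \<open>\<Gamma>\<close>, then h^-1 h' = g g'^-1 lies
  both in \<open>H ^ 2\<close> and in \<open>\<Gamma>\<close>, which bounds the fibres of
  multiplication. So once the powers of \<open>H\<close> are comparable in size, their slices by a
  subgroup are comparable as well.\<close>

lemma card_mult_subgroup_le:
  fixes H :: "'a::mgroup set"
  assumes H: "finite H" "\<And>h. h \<in> H \<Longrightarrow> inverse h \<in> H"
    and \<Gamma>: "\<And>x y. x \<in> \<Gamma> \<Longrightarrow> y \<in> \<Gamma> \<Longrightarrow> x * inverse y \<in> \<Gamma>"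
  shows "card H * card (H ^ m \<inter> \<Gamma>) \<le> card (H ^ 2 \<inter> \<Gamma>) * card (H ^ Suc m)"
proof -
  have "card (H \<times> (H ^ m \<inter> \<Gamma>)) \<le> card (H ^ 2 \<inter> \<Gamma>) * card (H ^ Suc m)"
  proof (rule card_mult_le_fibres[where f = "\<lambda>(h, g). h * g"])
    show "(\<lambda>(h, g). h * g) ` (H \<times> (H ^ m \<inter> \<Gamma>)) \<subseteq> H ^ Suc m" by auto
    fix w
    let ?F = "{x \<in> H \<times> (H ^ m \<inter> \<Gamma>). (case x of (h, g) \<Rightarrow> h * g) = w}"
    show "card ?F \<le> card (H ^ 2 \<inter> \<Gamma>)"
    proof (cases "?F = {}")
      case False
      then obtain h0 g0 where 0: "h0 \<in> H" "g0 \<in> H ^ m" "g0 \<in> \<Gamma>" "h0 * g0 = w" by auto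
      show ?thesis
      proof (rule card_inj_on_le)
        show "inj_on (\<lambda>(h, g). inverse h0 * h) ?F" by (auto simp: inj_on_def)
        show "(\<lambda>(h, g). inverse h0 * h) ` ?F \<subseteq> H ^ 2 \<inter> \<Gamma>"
        proof (rule image_subsetI)
          fix e assume "e \<in> ?F"
          then obtain h g where e: "e = (h, g)" and hg: "h \<in> H" "g \<in> H ^ m" "g \<in> \<Gamma>" "w = h * g" by auto
          then have "inverse h0 * h = g0 * inverse g" using 0 by (metis mgroup_solve mult.assoc)
          then show "(case e of (h, g) \<Rightarrow> inverse h0 * h) \<in> H ^ 2 \<inter> \<Gamma>" unfolding e
            using \<Gamma>[OF 0(3) hg(3)] set_times_intro[OF H(2)[OF 0(1)] hg(1)] by (simp add: power2_eq_square)
        qed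
      qed (use H in simp)
    qed (simp only: card.empty)
  qed (use H in \<open>auto simp: finite_set_times\<close>)
  then show ?thesis by (simp add: card_cartesian_product)
qed

lemma set_power_mono_exponent:
  assumes "1 \<in> (H :: 'a::monoid_mult set)" "m \<le> n"
  shows "H ^ m \<subseteq> H ^ n"
proof -
  have one: "1 \<in> H ^ k" for k
  proof (induction k)
    case (Suc k)
    then have "1 * 1 \<in> H * H ^ k" using assms(1) by (intro set_times_intro)
    then show ?case by simp
  qed simp
  have "x \<in> H ^ n" if "x \<in> H ^ m" for x
  proof -
    have "x * 1 \<in> H ^ m * H ^ (n - m)" using that one by blast
    then show ?thesis using assms(2) by (simp flip: power_add)
  qed
  then show ?thesis by blast
qed

lemma set_power_inverse:
  fixes H :: "'a::mgroup set"
  assumes "\<And>h. h \<in> H \<Longrightarrow> inverse h \<in> H"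
  shows "x \<in> H ^ n \<Longrightarrow> inverse x \<in> H ^ n"
proof (induction n arbitrary: x)
  case (Suc n)
  then obtain h y where x: "x = h * y" "h \<in> H" "y \<in> H ^ n" by (auto simp: set_times_image)
  then have "inverse y * inverse h \<in> H ^ n * H" using Suc.IH assms by blast
  then show ?case using x by (simp add: power_commutes)
qed simp

notation "apply" (infixl \<open>\<langle>$\<rangle>\<close> 999)

locale sl2 =
  fixes p :: int
  assumes prime_p: "prime p"
begin

lemma p_gt_1: "p > 1" using prime_p by (simp add: prime_gt_1_int)

lemma abs_p_neq_1 [simp]: "\<bar>p\<bar> \<noteq> 1" using p_gt_1 by simp

lemma dvd_mult_iff: "p dvd a * b \<longleftrightarrow> p dvd a \<or> p dvd b"
  using prime_p by (rule prime_dvd_mult_iff)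

lemma cong_mult_cancel: "\<not> p dvd a \<Longrightarrow> [a * b = a * c] (mod p) \<longleftrightarrow> [b = c] (mod p)"
  by (simp add: cong_iff_dvd_diff dvd_mult_iff flip: right_diff_distrib)

definition vecs :: "(int \<times> int) set" where
  "vecs = {0..<p} \<times> {0..<p}"

definition lin_fun :: "int \<Rightarrow> int \<Rightarrow> int \<Rightarrow> int \<Rightarrow> int \<times> int \<Rightarrow> int \<times> int" where
  "lin_fun a b c d = (\<lambda>(x, y). if (x, y) \<in> vecs then ((a * x + b * y) mod p, (c * x + d * y) mod p) else (x, y))"

text \<open>Matrices act on all of \<open>int \<times> int\<close>, trivially outside \<open>vecs\<close>, so that the groups
  \<open>GL\<^sub>2\<close> over the different prime fields all live in the single group type \<open>(int \<times> int) perm\<close>.\<close>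

definition lin :: "int \<Rightarrow> int \<Rightarrow> int \<Rightarrow> int \<Rightarrow> (int \<times> int) perm" where
  "lin a b c d = Perm (lin_fun a b c d)"

lemma finite_vecs [simp]: "finite vecs" by (simp add: vecs_def)

lemma lin_fun_vecs: "v \<in> vecs \<Longrightarrow> lin_fun a b c d v \<in> vecs"
  using p_gt_1 by (auto simp: lin_fun_def vecs_def)

lemma bij_lin_fun:
  assumes "\<not> p dvd a * d - b * c"
  shows "bij (lin_fun a b c d)"
proof -
  have "inj_on (lin_fun a b c d) vecs"
  proof (rule inj_onI, clarify)
    fix x y x' y' assume v: "(x, y) \<in> vecs" "(x', y') \<in> vecs" "lin_fun a b c d (x, y) = lin_fun a b c d (x', y')"
    then have 1: "p dvd (a * x + b * y) - (a * x' + b * y')" "p dvd (c * x + d * y) - (c * x' + d * y')"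
      by (simp_all add: lin_fun_def mod_eq_dvd_iff)
    have "p dvd d * ((a * x + b * y) - (a * x' + b * y')) - b * ((c * x + d * y) - (c * x' + d * y'))"
      "p dvd a * ((c * x + d * y) - (c * x' + d * y')) - c * ((a * x + b * y) - (a * x' + b * y'))"
      using 1 by (meson dvd_diff dvd_mult)+
    then have "p dvd (a * d - b * c) * (x - x')" "p dvd (a * d - b * c) * (y - y')"
      by (simp_all add: algebra_simps)
    then have "p dvd x - x'" "p dvd y - y'" using assms by (auto simp: dvd_mult_iff)
    then show "x = x' \<and> y = y'" using v residues_eq_iff_dvd by (auto simp: vecs_def)
  qed
  moreover have "lin_fun a b c d ` vecs \<subseteq> vecs" using lin_fun_vecs by blast
  ultimately have "bij_betw (lin_fun a b c d) vecs vecs"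
    by (simp add: bij_betw_def endo_inj_surj)
  moreover have "bij_betw (lin_fun a b c d) (- vecs) (- vecs)"
    by (rule bij_betw_cong[THEN iffD1, OF _ bij_betw_id]) (auto simp: lin_fun_def)
  ultimately have "bij_betw (lin_fun a b c d) (vecs \<union> - vecs) (vecs \<union> - vecs)"
    by (rule bij_betw_combine) auto
  then show ?thesis by simp
qed

lemma apply_lin:
  assumes "\<not> p dvd a * d - b * c"
  shows "lin a b c d \<langle>$\<rangle> v = lin_fun a b c d v"
proof -
  have "{v. lin_fun a b c d v \<noteq> v} \<subseteq> vecs" by (auto simp: lin_fun_def split: if_splits)
  then have "finite {v. lin_fun a b c d v \<noteq> v}" by (rule finite_subset) simp
  then show ?thesis unfolding lin_def using bij_lin_fun[OF assms] by (subst Perm_inverse) auto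
qed

lemma lin_mult:
  assumes "\<not> p dvd a * d - b * c" "\<not> p dvd a' * d' - b' * c'"
  shows "lin a b c d * lin a' b' c' d' = lin (a * a' + b * c') (a * b' + b * d') (c * a' + d * c') (c * b' + d * d')"
proof (rule perm_eqI)
  fix v :: "int \<times> int"
  have "(a * a' + b * c') * (c * b' + d * d') - (a * b' + b * d') * (c * a' + d * c') = (a * d - b * c) * (a' * d' - b' * c')"
    by (simp add: algebra_simps)
  then have nd: "\<not> p dvd (a * a' + b * c') * (c * b' + d * d') - (a * b' + b * d') * (c * a' + d * c')"
    using assms by (simp add: dvd_mult_iff)
  obtain x y where v: "v = (x, y)" by fastforce
  show "(lin a b c d * lin a' b' c' d') \<langle>$\<rangle> v =
      lin (a * a' + b * c') (a * b' + b * d') (c * a' + d * c') (c * b' + d * d') \<langle>$\<rangle> v"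
  proof (cases "v \<in> vecs")
    case True
    have c1: "[a * ((a' * x + b' * y) mod p) + b * ((c' * x + d' * y) mod p) = a * (a' * x + b' * y) + b * (c' * x + d' * y)] (mod p)"
      by (intro cong_add cong_mult) (simp_all add: cong_def)
    have c2: "[c * ((a' * x + b' * y) mod p) + d * ((c' * x + d' * y) mod p) = c * (a' * x + b' * y) + d * (c' * x + d' * y)] (mod p)"
      by (intro cong_add cong_mult) (simp_all add: cong_def)
    have "lin_fun a' b' c' d' v \<in> vecs" using True by (rule lin_fun_vecs)
    then show ?thesis using True
      unfolding apply_times o_apply apply_lin[OF assms(1)] apply_lin[OF assms(2)] apply_lin[OF nd]
      using c1 c2 by (simp add: lin_fun_def v cong_def) (simp add: algebra_simps)
  next
    case False
    then show ?thesis
      by (simp add: apply_times apply_lin[OF assms(1)] apply_lin[OF assms(2)] apply_lin[OF nd] lin_fun_def v)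
  qed
qed

lemma lin_eq_iff:
  assumes "\<not> p dvd a * d - b * c" "\<not> p dvd a' * d' - b' * c'"
  shows "lin a b c d = lin a' b' c' d' \<longleftrightarrow> [a = a'] (mod p) \<and> [b = b'] (mod p) \<and> [c = c'] (mod p) \<and> [d = d'] (mod p)"
proof
  assume eq: "lin a b c d = lin a' b' c' d'"
  have "lin_fun a b c d v = lin_fun a' b' c' d' v" for v
    using eq apply_lin[OF assms(1)] apply_lin[OF assms(2)] by metis
  from this[of "(1, 0)"] this[of "(0, 1)"]
  show "[a = a'] (mod p) \<and> [b = b'] (mod p) \<and> [c = c'] (mod p) \<and> [d = d'] (mod p)"
    using p_gt_1 by (auto simp: lin_fun_def vecs_def cong_def)
next
  assume c: "[a = a'] (mod p) \<and> [b = b'] (mod p) \<and> [c = c'] (mod p) \<and> [d = d'] (mod p)"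
  have "lin_fun a b c d (x, y) = lin_fun a' b' c' d' (x, y)" for x y
  proof -
    have "[a * x + b * y = a' * x + b' * y] (mod p)" "[c * x + d * y = c' * x + d' * y] (mod p)"
      using c by (auto intro!: cong_add cong_mult)
    then show ?thesis by (simp add: lin_fun_def cong_def)
  qed
  then show "lin a b c d = lin a' b' c' d'" unfolding lin_def by (metis prod.collapse ext)
qed

lemma det_1: "[a * d - b * c = 1] (mod p) \<Longrightarrow> \<not> p dvd a * d - b * c"
  using p_gt_1 by (metis cong_dvd_iff not_prime_unit prime_p)

lemma lin_1: "lin 1 0 0 1 = 1"
  using p_gt_1 by (auto intro!: perm_eqI simp: apply_lin lin_fun_def vecs_def)

definition SL :: "(int \<times> int) perm set" where
  "SL = {lin a b c d | a b c d. [a * d - b * c = 1] (mod p)}"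

lemma SL_I: "[a * d - b * c = 1] (mod p) \<Longrightarrow> lin a b c d \<in> SL"
  by (auto simp: SL_def)

lemma SL_E:
  assumes "g \<in> SL"
  obtains a b c d where "g = lin a b c d" "[a * d - b * c = 1] (mod p)" "\<not> p dvd a * d - b * c"
  using assms det_1 by (auto simp: SL_def)

lemma lin_mult_SL:
  assumes "[a * d - b * c = 1] (mod p)" "[a' * d' - b' * c' = 1] (mod p)"
  shows "[(a * a' + b * c') * (c * b' + d * d') - (a * b' + b * d') * (c * a' + d * c') = 1] (mod p)"
proof -
  have "(a * a' + b * c') * (c * b' + d * d') - (a * b' + b * d') * (c * a' + d * c') = (a * d - b * c) * (a' * d' - b' * c')"
    by (simp add: algebra_simps)
  then show ?thesis using cong_mult[OF assms] by simp
qed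

lemma lin_inverse:
  assumes "[a * d - b * c = 1] (mod p)"
  shows "inverse (lin a b c d) = lin d (- b) (- c) a"
proof -
  have 1: "[d * a - (- b) * (- c) = 1] (mod p)" using assms by (simp add: algebra_simps)
  have "lin a b c d * lin d (- b) (- c) a = lin (a * d + b * (- c)) (a * (- b) + b * a) (c * d + d * (- c)) (c * (- b) + d * a)"
    by (rule lin_mult[OF det_1[OF assms] det_1[OF 1]])
  also have "\<dots> = lin 1 0 0 1"
  proof (subst lin_eq_iff)
    show "\<not> p dvd (a * d + b * (- c)) * (c * (- b) + d * a) - (a * (- b) + b * a) * (c * d + d * (- c))"
      by (rule det_1[OF lin_mult_SL[OF assms 1]])
  qed (use assms p_gt_1 in \<open>auto simp: cong_iff_dvd_diff algebra_simps\<close>)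
  finally show ?thesis by (metis lin_1 mgroup_cancel(2) mult.right_neutral)
qed

lemma finite_SL: "finite SL"
proof -
  have "SL \<subseteq> (\<lambda>(a, b, c, d). lin a b c d) ` ({0..<p} \<times> {0..<p} \<times> {0..<p} \<times> {0..<p})"
  proof
    fix g assume "g \<in> SL"
    then obtain a b c d where g: "g = lin a b c d" "\<not> p dvd a * d - b * c" by (rule SL_E)
    have "[(a mod p) * (d mod p) - (b mod p) * (c mod p) = a * d - b * c] (mod p)"
      by (intro cong_diff cong_mult) (simp_all add: cong_def)
    then have "\<not> p dvd (a mod p) * (d mod p) - (b mod p) * (c mod p)" using g(2) by (simp add: cong_dvd_iff)
    then have "g = lin (a mod p) (b mod p) (c mod p) (d mod p)"
      unfolding g(1) using g(2) by (subst lin_eq_iff) (auto simp: cong_def)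
    then show "g \<in> (\<lambda>(a, b, c, d). lin a b c d) ` ({0..<p} \<times> {0..<p} \<times> {0..<p} \<times> {0..<p})"
      using p_gt_1 by (auto intro!: image_eqI[of _ _ "(a mod p, b mod p, c mod p, d mod p)"])
  qed
  then show ?thesis by (rule finite_subset) auto
qed

sublocale SL: finite_mgroup SL
proof
  show "1 \<in> SL" using SL_I[of 1 1 0 0] by (simp add: lin_1)
  show "x * y \<in> SL" if "x \<in> SL" "y \<in> SL" for x y
    using that by (auto elim!: SL_E simp: lin_mult intro!: SL_I lin_mult_SL)
  show "inverse x \<in> SL" if "x \<in> SL" for x
    using that by (auto elim!: SL_E simp: lin_inverse intro!: SL_I simp: algebra_simps)
qed (rule finite_SL)

section \<open>Unipotents, the Borel subgroup and the big Bruhat cell\<close>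

definition upper :: "int \<Rightarrow> (int \<times> int) perm" where
  "upper b = lin 1 b 0 1"

definition unipotents :: "(int \<times> int) perm set" where
  "unipotents = range upper"

text \<open>The stabilizer in \<open>SL\<close> of the point at infinity, that is, of the line
  through (1, 0).\<close>

definition borel :: "(int \<times> int) perm set" where
  "borel = {lin a b 0 d | a b d. [a * d = 1] (mod p)}"

lemma upper_SL [simp]: "upper b \<in> SL" by (auto simp: upper_def intro!: SL_I)

lemma upper_mult: "upper b * upper b' = upper (b + b')"
  by (simp add: upper_def lin_mult add.commute)

lemma upper_eq_iff: "upper b = upper b' \<longleftrightarrow> [b = b'] (mod p)"
  by (simp add: upper_def lin_eq_iff)

lemma upper_0: "upper 0 = 1" by (simp add: upper_def lin_1)

lemma upper_inverse: "inverse (upper b) = upper (- b)"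
  by (simp add: upper_def lin_inverse)

lemma upper_mod: "upper (b mod p) = upper b" by (simp add: upper_eq_iff cong_def)

lemma unipotents_quotient: "x \<in> unipotents \<Longrightarrow> y \<in> unipotents \<Longrightarrow> x * inverse y \<in> unipotents"
  by (auto simp: unipotents_def upper_inverse upper_mult)

lemma borel_iff: "lin a b c d \<in> borel \<longleftrightarrow> p dvd c" if "[a * d - b * c = 1] (mod p)"
proof
  assume "lin a b c d \<in> borel"
  then obtain a' b' d' where "lin a b c d = lin a' b' 0 d'" "[a' * d' = 1] (mod p)" by (auto simp: borel_def)
  then have "[c = 0] (mod p)" by (subst (asm) lin_eq_iff) (use that det_1 det_1[of a' d' b' 0] in auto)
  then show "p dvd c" by (simp add: cong_0_iff)
next
  assume c: "p dvd c"
  have 1: "[a * d = 1] (mod p)"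
  proof -
    have "[b * c = 0] (mod p)" using c by (simp add: cong_0_iff)
    then show ?thesis using cong_add[OF that, of "b * c" 0] by simp
  qed
  have "lin a b c d = lin a b 0 d"
    by (subst lin_eq_iff) (use that 1 c det_1 det_1[of a d b 0] in \<open>auto simp: cong_0_iff\<close>)
  then show "lin a b c d \<in> borel" using 1 by (auto simp: borel_def)
qed

lemma borel_quotient: "x \<in> borel \<Longrightarrow> y \<in> borel \<Longrightarrow> x * inverse y \<in> borel"
proof -
  assume "x \<in> borel" "y \<in> borel"
  then obtain a b d a' b' d' where x: "x = lin a b 0 d" "[a * d = 1] (mod p)" and y: "y = lin a' b' 0 d'" "[a' * d' = 1] (mod p)"
    by (auto simp: borel_def)
  have 1: "[d' * a' - (- b') * 0 = 1] (mod p)" using y by (simp add: mult.commute)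
  have "inverse y = lin d' (- b') 0 a'" using lin_inverse[of a' d' b' 0] y by simp
  then have eq: "x * inverse y = lin (a * d') (a * (- b') + b * a') 0 (d * a')"
    using lin_mult[of a d b 0 d' a' "- b'" 0] det_1[of a d b 0] det_1[OF 1] x by simp
  have "[(a * d) * (a' * d') = 1 * 1] (mod p)" using x y by (intro cong_mult) auto
  then have "[(a * d') * (d * a') = 1] (mod p)" by (simp add: mult_ac)
  then show ?thesis unfolding eq borel_def by blast
qed

text \<open>Two features of this matrix matter: its trace is 2, and its lower left entry is minus a
  square times \<open>t\<close>, which vanishes exactly when the conjugate fixes infinity.\<close>

lemma conj_upper:
  assumes "[a * d - b * c = 1] (mod p)"
  shows "lin a b c d * upper t * inverse (lin a b c d) = lin (1 - a * c * t) (a * a * t) (- c * c * t) (1 + a * c * t)"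
    and "[(1 - a * c * t) * (1 + a * c * t) - (a * a * t) * (- c * c * t) = 1] (mod p)"
proof -
  show *: "[(1 - a * c * t) * (1 + a * c * t) - (a * a * t) * (- c * c * t) = 1] (mod p)"
    by (simp add: algebra_simps)
  have 1: "[a * (c * t + d) - (a * t + b) * c = 1] (mod p)" using assms by (simp add: algebra_simps)
  have 2: "[d * a - (- b) * (- c) = 1] (mod p)" using assms by (simp add: algebra_simps)
  have "lin a b c d * upper t = lin a (a * t + b) c (c * t + d)"
    unfolding upper_def using lin_mult[OF det_1[OF assms], of 1 1 t 0] by simp
  then have "lin a b c d * upper t * inverse (lin a b c d) =
      lin (a * d + (a * t + b) * (- c)) (a * (- b) + (a * t + b) * a) (c * d + (c * t + d) * (- c)) (c * (- b) + (c * t + d) * a)"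
    using lin_mult[OF det_1[OF 1] det_1[OF 2]] lin_inverse[OF assms] by simp
  also have "\<dots> = lin (1 - a * c * t) (a * a * t) (- c * c * t) (1 + a * c * t)"
  proof (subst lin_eq_iff)
    show "\<not> p dvd (a * d + (a * t + b) * - c) * (c * - b + (c * t + d) * a) - (a * - b + (a * t + b) * a) * (c * d + (c * t + d) * - c)"
      by (rule det_1[OF lin_mult_SL[OF 1 2]])
    show "\<not> p dvd (1 - a * c * t) * (1 + a * c * t) - (a * a * t) * (- c * c * t)" by (rule det_1[OF *])
    have "p dvd a * d - b * c - 1" using assms by (simp add: cong_iff_dvd_diff)
    then show "[a * d + (a * t + b) * - c = 1 - a * c * t] (mod p) \<and> [a * - b + (a * t + b) * a = a * a * t] (mod p) \<and>
      [c * d + (c * t + d) * - c = - c * c * t] (mod p) \<and> [c * - b + (c * t + d) * a = 1 + a * c * t] (mod p)"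
      by (simp add: cong_iff_dvd_diff algebra_simps)
  qed
  finally show "lin a b c d * upper t * inverse (lin a b c d) = lin (1 - a * c * t) (a * a * t) (- c * c * t) (1 + a * c * t)" .
qed

lemma conj_upper_borel:
  assumes "[a * d = 1] (mod p)"
  shows "lin a b 0 d * upper t * inverse (lin a b 0 d) = upper (a * a * t)"
  using conj_upper(1)[of a d b 0 t] assms by (simp add: upper_def)

lemma upper_mult_lin_mult_upper:
  assumes "[a * d - b * c = 1] (mod p)"
  shows "upper x * lin a b c d * upper y = lin (a + x * c) ((a + x * c) * y + (b + x * d)) c (c * y + d)"
    and "[(a + x * c) * (c * y + d) - ((a + x * c) * y + (b + x * d)) * c = 1] (mod p)"
proof -
  show "[(a + x * c) * (c * y + d) - ((a + x * c) * y + (b + x * d)) * c = 1] (mod p)"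
    using assms by (simp add: algebra_simps)
  have 1: "[(a + x * c) * d - (b + x * d) * c = 1] (mod p)" using assms by (simp add: algebra_simps)
  have "upper x * lin a b c d = lin (a + x * c) (b + x * d) c d"
    unfolding upper_def using lin_mult[OF _ det_1[OF assms], of 1 1 x 0] by simp
  then show "upper x * lin a b c d * upper y = lin (a + x * c) ((a + x * c) * y + (b + x * d)) c (c * y + d)"
    unfolding upper_def using lin_mult[OF det_1[OF 1], of 1 1 y 0] by simp
qed

lemma conj_unipotent_in_unipotents_imp_borel:
  assumes k: "k \<in> SL" and u: "\<not> p dvd t" "k * upper t * inverse k \<in> unipotents"
  shows "k \<in> borel"
proof -
  obtain a b c d where k: "k = lin a b c d" "[a * d - b * c = 1] (mod p)" using k by (rule SL_E)
  obtain s where "k * upper t * inverse k = upper s" using u(2) by (auto simp: unipotents_def)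
  then have "lin (1 - a * c * t) (a * a * t) (- c * c * t) (1 + a * c * t) = lin 1 s 0 1"
    using conj_upper(1)[OF k(2)] k(1) by (simp add: upper_def)
  then have "[- c * c * t = 0] (mod p)"
    by (subst (asm) lin_eq_iff) (use det_1[OF conj_upper(2)[OF k(2)]] in auto)
  then have "p dvd c" using u(1) by (simp add: cong_0_iff dvd_mult_iff)
  then show ?thesis using borel_iff[OF k(2)] k(1) by simp
qed

text \<open>Uniqueness in the big Bruhat cell: outside the Borel subgroup \<open>c\<close> is
  invertible, so the entries \<open>a + x * c\<close> and \<open>c * y + d\<close> recover
  \<open>x\<close> and \<open>y\<close> modulo \<open>p\<close>.\<close>

lemma big_cell_inj:
  assumes g: "g \<in> SL" "g \<notin> borel" and eq: "upper x * g * upper y = upper x' * g * upper y'"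
  shows "upper x = upper x' \<and> upper y = upper y'"
proof -
  obtain a b c d where k: "g = lin a b c d" "[a * d - b * c = 1] (mod p)" using g(1) by (rule SL_E)
  then have c: "\<not> p dvd c" using borel_iff[OF k(2)] g(2) by simp
  have "[a + x * c = a + x' * c] (mod p) \<and> [c * y + d = c * y' + d] (mod p)"
    using eq unfolding k(1) upper_mult_lin_mult_upper(1)[OF k(2)]
    by (subst (asm) lin_eq_iff) (use det_1[OF upper_mult_lin_mult_upper(2)[OF k(2)]] in auto)
  then have "p dvd c * (x - x')" "p dvd c * (y - y')" by (simp_all add: cong_iff_dvd_diff algebra_simps)
  then show ?thesis using c by (simp add: upper_eq_iff cong_iff_dvd_diff dvd_mult_iff)
qed

text \<open>Multiplying by upper unipotents on both sides leaves the lower left entry unchanged, so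
  this entry recovers \<open>t\<close>. It is non-zero, so the conjugate lies in the big cell and
  \<open>big_cell_inj\<close> recovers the outer factors.\<close>

lemma big_cell_conj_inj:
  assumes g: "g \<in> SL" "g \<notin> borel" and t: "\<not> p dvd t" and t': "\<not> p dvd t'"
    and eq: "upper x * (g * upper t * inverse g) * upper y = upper x' * (g * upper t' * inverse g) * upper y'"
  shows "upper x = upper x' \<and> upper t = upper t' \<and> upper y = upper y'"
proof -
  obtain a b c d where k: "g = lin a b c d" "[a * d - b * c = 1] (mod p)" using g(1) by (rule SL_E)
  then have c: "\<not> p dvd c" using borel_iff[OF k(2)] g(2) by simp
  have "[- c * c * t = - c * c * t'] (mod p)"
    using eq unfolding k(1) conj_upper(1)[OF k(2)] upper_mult_lin_mult_upper(1)[OF conj_upper(2)[OF k(2)]]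
    by (subst (asm) lin_eq_iff) (use det_1[OF upper_mult_lin_mult_upper(2)[OF conj_upper(2)[OF k(2)]]] in \<open>blast\<close>)+
  then have "p dvd (- c * c) * (t - t')" by (simp add: cong_iff_dvd_diff algebra_simps)
  then have tt: "upper t = upper t'" using c by (simp add: upper_eq_iff cong_iff_dvd_diff dvd_mult_iff)
  have "g * upper t * inverse g \<notin> borel"
    using borel_iff[OF conj_upper(2)[OF k(2)]] c t unfolding k(1) conj_upper(1)[OF k(2)] by (simp add: dvd_mult_iff)
  moreover have "g * upper t * inverse g \<in> SL" using g by simp
  ultimately show ?thesis using big_cell_inj[of "g * upper t * inverse g" x y x' y'] eq tt by simp
qed

text \<open>A trace computation: both conjugates have trace 2, whereas multiplying the first by
  \<open>upper s\<close> changes its trace by - c^2 t s. So c t vanishes modulo \<open>p\<close>,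
  and the first conjugate is upper unipotent.\<close>

lemma two_conjugates_differ_by_unipotent:
  assumes "h \<in> SL" "h' \<in> SL" and s: "\<not> p dvd s" and eq: "h * upper t * inverse h * upper s = h' * upper t' * inverse h'"
  shows "h * upper t * inverse h \<in> unipotents"
proof -
  obtain a b c d where k: "h = lin a b c d" "[a * d - b * c = 1] (mod p)" using assms(1) by (rule SL_E)
  obtain a' b' c' d' where k': "h' = lin a' b' c' d'" "[a' * d' - b' * c' = 1] (mod p)" using assms(2) by (rule SL_E)
  note k1 = conj_upper(2)[OF k(2), of t] and k2 = conj_upper(2)[OF k'(2), of t']
  have "lin (1 - a * c * t) (a * a * t) (- c * c * t) (1 + a * c * t) * upper s =
      lin (1 - a * c * t) ((1 - a * c * t) * s + a * a * t) (- c * c * t) ((- c * c * t) * s + (1 + a * c * t))"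
    using upper_mult_lin_mult_upper(1)[OF k1, of 0 s] by (simp add: upper_0)
  then have "lin (1 - a * c * t) ((1 - a * c * t) * s + a * a * t) (- c * c * t) ((- c * c * t) * s + (1 + a * c * t)) =
      lin (1 - a' * c' * t') (a' * a' * t') (- c' * c' * t') (1 + a' * c' * t')"
    using eq unfolding k(1) k'(1) conj_upper(1)[OF k(2)] conj_upper(1)[OF k'(2)] by simp
  then have "[1 - a * c * t = 1 - a' * c' * t'] (mod p) \<and> [(- c * c * t) * s + (1 + a * c * t) = 1 + a' * c' * t'] (mod p)"
    by (subst (asm) lin_eq_iff) (use det_1[OF upper_mult_lin_mult_upper(2)[OF k1, of 0 s]] det_1[OF k2] in \<open>simp_all\<close>)
  then have "[1 - a * c * t = 1 - a' * c' * t'] (mod p)" "[(- c * c * t) * s + (1 + a * c * t) = 1 + a' * c' * t'] (mod p)"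
    by blast+
  then have "[(1 - a * c * t) + ((- c * c * t) * s + (1 + a * c * t)) = (1 - a' * c' * t') + (1 + a' * c' * t')] (mod p)"
    by (rule cong_add)
  then have "p dvd c * c * t * s" by (simp add: cong_iff_dvd_diff)
  then have "p dvd c * t" using s by (auto simp: dvd_mult_iff)
  then have 2: "p dvd a * c * t" "p dvd c * c * t" by (auto simp: dvd_mult_iff)
  have "lin (1 - a * c * t) (a * a * t) (- c * c * t) (1 + a * c * t) = lin 1 (a * a * t) 0 1"
    by (subst lin_eq_iff) (use det_1[OF k1] 2 in \<open>auto simp: cong_iff_dvd_diff\<close>)
  then show ?thesis unfolding k(1) conj_upper(1)[OF k(2)] by (simp add: unipotents_def upper_def)
qed

end

section \<open>Growth in $\mathrm{SL}_2$\<close>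

locale sl2_approximate_group = sl2 +
  fixes H :: "(int \<times> int) perm set" and K :: real
  assumes H_SL: "H \<subseteq> SL" and one_H: "1 \<in> H" and inverse_H: "\<And>h. h \<in> H \<Longrightarrow> inverse h \<in> H"
    and K1: "K \<ge> 1" and small: "real (card (H ^ 45)) \<le> K * card H"
begin

lemma finite_H [simp]: "finite H" using H_SL finite_SL by (rule finite_subset)

lemma card_H_pos: "card H > 0" using one_H by (auto simp: card_gt_0_iff)

lemma power_H_SL: "H ^ n \<subseteq> SL"
proof (induction n)
  case (Suc n)
  then show ?case using H_SL by (auto simp: set_times_image subset_iff)
qed simp

lemma power_H_mono: "m \<le> n \<Longrightarrow> H ^ m \<subseteq> H ^ n"
  using one_H by (rule set_power_mono_exponent)

lemma card_power_H: "n \<le> 45 \<Longrightarrow> real (card (H ^ n)) \<le> K * card H"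
  using card_mono[OF finite_set_power[OF finite_H] power_H_mono, of n 45] small by linarith

lemma mult_power_H: "x \<in> H ^ m \<Longrightarrow> y \<in> H ^ n \<Longrightarrow> x * y \<in> H ^ (m + n)"
  by (simp add: power_add set_times_intro)

lemma inverse_power_H: "x \<in> H ^ n \<Longrightarrow> inverse x \<in> H ^ n"
  using inverse_H by (rule set_power_inverse)

lemma conj_power_H:
  assumes "h \<in> H ^ m" "x \<in> H ^ n"
  shows "h * x * inverse h \<in> H ^ (m + n + m)"
  using assms by (intro mult_power_H inverse_power_H)

lemma H_power_1: "h \<in> H \<Longrightarrow> h \<in> H ^ 1" by (simp only: power_one_right)

lemma conj_H: "h \<in> H \<Longrightarrow> x \<in> H ^ n \<Longrightarrow> h * x * inverse h \<in> H ^ (n + 2)"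
  using conj_power_H[OF H_power_1, of h x n] by (metis (no_types) add.assoc add.commute one_add_one)

text \<open>The comparison with \<open>H ^ 2\<close> costs one extra factor of \<open>H\<close>,
  whence 44 here and 45 in the hypothesis \<open>small\<close>.\<close>

lemma card_power_H_Int:
  assumes "m \<le> 44" "\<And>x y. x \<in> \<Gamma> \<Longrightarrow> y \<in> \<Gamma> \<Longrightarrow> x * inverse y \<in> \<Gamma>"
  shows "real (card (H ^ m \<inter> \<Gamma>)) \<le> K * card (H ^ 2 \<inter> \<Gamma>)"
proof -
  have "real (card H) * card (H ^ m \<inter> \<Gamma>) \<le> card (H ^ 2 \<inter> \<Gamma>) * real (card (H ^ Suc m))"
    using card_mult_subgroup_le[OF finite_H inverse_H assms(2), of m] by (metis of_nat_le_iff of_nat_mult)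
  also have "\<dots> \<le> card (H ^ 2 \<inter> \<Gamma>) * (K * card H)"
    using card_power_H[of "Suc m"] assms(1) by (intro mult_left_mono) auto
  finally show ?thesis using card_H_pos by (simp add: mult_ac)
qed

definition Q :: "(int \<times> int) perm set" where
  "Q = H ^ 2 \<inter> unipotents"

lemma finite_Q [simp]: "finite Q" by (simp add: Q_def)

lemma one_Q: "1 \<in> Q"
proof -
  have "1 * 1 \<in> H * H" using one_H by blast
  then have "1 \<in> H ^ 2" by (simp add: power2_eq_square)
  moreover have "1 \<in> unipotents" unfolding unipotents_def by (metis rangeI upper_0)
  ultimately show ?thesis by (simp add: Q_def)
qed

lemma card_Q_minus_1: "real (card (Q - {1})) = real (card Q) - 1"
proof -
  have "card Q > 0" using one_Q by (auto simp: card_gt_0_iff)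
  then show ?thesis using one_Q by (simp add: card_Diff_singleton of_nat_diff)
qed

lemma Q_E:
  assumes "x \<in> Q"
  obtains t where "x = upper t" "x \<in> H ^ 2" "x \<noteq> 1 \<longleftrightarrow> \<not> p dvd t"
  using assms upper_eq_iff[of _ 0] by (auto simp: Q_def unipotents_def upper_0 cong_0_iff)

lemma card_power_H_unipotents: "m \<le> 44 \<Longrightarrow> real (card (H ^ m \<inter> unipotents)) \<le> K * card Q"
  unfolding Q_def by (rule card_power_H_Int) (auto intro: unipotents_quotient)

text \<open>For \<open>g\<close> off the Borel subgroup, the products x g y, and x (g u g^-1) y with
  non-trivial u, determine their unipotent letters. The quadratic bound makes |H| much larger than
  |Q|; the cubic one turns |Q| of order p into |H| of order p^3.\<close>

lemma card_big_cell_le: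
  assumes g: "g \<in> H" "g \<notin> borel"
  shows "real (card Q) ^ 2 \<le> K * card H" "real (card Q) ^ 2 * (real (card Q) - 1) \<le> K * card H"
proof -
  have gS: "g \<in> SL" using g H_SL by auto
  have "card (Q \<times> Q) \<le> card (H ^ 5)"
  proof (rule card_inj_on_le[of "\<lambda>(x, y). x * g * y"])
    show "inj_on (\<lambda>(x, y). x * g * y) (Q \<times> Q)"
    proof (rule inj_onI, clarify)
      fix x y x' y' assume m: "x \<in> Q" "y \<in> Q" "x' \<in> Q" "y' \<in> Q" and eq: "x * g * y = x' * g * y'"
      obtain a where a: "x = upper a" using m(1) by (rule Q_E)
      obtain b where b: "y = upper b" using m(2) by (rule Q_E)
      obtain a' where a': "x' = upper a'" using m(3) by (rule Q_E)
      obtain b' where b': "y' = upper b'" using m(4) by (rule Q_E)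
      show "x = x' \<and> y = y'" using big_cell_inj[OF gS g(2)] eq unfolding a b a' b' by blast
    qed
    show "(\<lambda>(x, y). x * g * y) ` (Q \<times> Q) \<subseteq> H ^ 5"
      using mult_power_H[OF mult_power_H[OF _ H_power_1[OF g(1)]], of _ 2 _ 2] by (auto simp: Q_def)
  qed simp
  then have "real (card Q) ^ 2 \<le> card (H ^ 5)" by (simp add: card_cartesian_product power2_eq_square flip: of_nat_mult)
  then show "real (card Q) ^ 2 \<le> K * card H" using card_power_H[of 5] by linarith
  have "card (Q \<times> (Q - {1}) \<times> Q) \<le> card (H ^ 8)"
  proof (rule card_inj_on_le[of "\<lambda>(x, u, y). x * (g * u * inverse g) * y"])
    show "inj_on (\<lambda>(x, u, y). x * (g * u * inverse g) * y) (Q \<times> (Q - {1}) \<times> Q)"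
    proof (rule inj_onI)
      fix e e' assume e12: "e \<in> Q \<times> (Q - {1}) \<times> Q" "e' \<in> Q \<times> (Q - {1}) \<times> Q"
        and e': "(case e of (x, u, y) \<Rightarrow> x * (g * u * inverse g) * y) = (case e' of (x, u, y) \<Rightarrow> x * (g * u * inverse g) * y)"
      obtain x u y where 1: "e = (x, u, y)" "x \<in> Q" "u \<in> Q" "y \<in> Q" "u \<noteq> 1" using e12(1) by auto
      obtain x' u' y' where 2: "e' = (x', u', y')" "x' \<in> Q" "u' \<in> Q" "y' \<in> Q" "u' \<noteq> 1" using e12(2) by auto
      note e = 1(1) 2(1) and m = 1(2-4) 2(2-4) 1(5) 2(5)
      have eq: "x * (g * u * inverse g) * y = x' * (g * u' * inverse g) * y'" using e' e by simp
      obtain a where a: "x = upper a" using m(1) by (rule Q_E)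
      obtain b where b: "y = upper b" using m(3) by (rule Q_E)
      obtain a' where a': "x' = upper a'" using m(4) by (rule Q_E)
      obtain b' where b': "y' = upper b'" using m(6) by (rule Q_E)
      obtain t where t: "u = upper t" "\<not> p dvd t" using m(2,7) by (auto elim: Q_E)
      obtain t' where t': "u' = upper t'" "\<not> p dvd t'" using m(5,8) by (auto elim: Q_E)
      have "x = x' \<and> u = u' \<and> y = y'"
        using big_cell_conj_inj[OF gS g(2) t(2) t'(2)] eq unfolding a b a' b' t t' by blast
      then show "e = e'" by (simp add: e)
    qed
    show "(\<lambda>(x, u, y). x * (g * u * inverse g) * y) ` (Q \<times> (Q - {1}) \<times> Q) \<subseteq> H ^ 8"
    proof (rule image_subsetI)
      fix e assume "e \<in> Q \<times> (Q - {1}) \<times> Q"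
      then obtain x u y where e: "e = (x, u, y)" and m: "x \<in> Q" "u \<in> Q" "y \<in> Q" by auto
      then have "x * (g * u * inverse g) * y \<in> H ^ (2 + (2 + 2) + 2)"
        by (intro mult_power_H conj_H) (use g in \<open>auto simp: Q_def\<close>)
      then show "(case e of (x, u, y) \<Rightarrow> x * (g * u * inverse g) * y) \<in> H ^ 8" by (simp add: e)
    qed
  qed simp
  then have "real (card Q * (card (Q - {1}) * card Q)) \<le> card (H ^ 8)"
    unfolding card_cartesian_product of_nat_le_iff .
  moreover note card_Q_minus_1
  ultimately have "real (card Q) ^ 2 * (real (card Q) - 1) \<le> card (H ^ 8)" by (simp add: power2_eq_square mult_ac)
  then show "real (card Q) ^ 2 * (real (card Q) - 1) \<le> K * card H" using card_power_H[of 8] by linarith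
qed

section \<open>Conjugates of unipotents\<close>

definition W :: "(int \<times> int) perm set" where
  "W = (\<lambda>(h, u). h * u * inverse h) ` (H \<times> (Q - {1}))"

lemma finite_W [simp]: "finite W" by (simp add: W_def)

lemma W_H: "W \<subseteq> H ^ 4"
proof
  fix w assume "w \<in> W"
  then obtain h u where w: "w = h * u * inverse h" "h \<in> H" "u \<in> H ^ 2" by (auto simp: W_def Q_def)
  then have "w \<in> H ^ (2 + 2)" by (simp only: conj_H)
  then show "w \<in> H ^ 4" by simp
qed

text \<open>If h u h^-1 = h0 u0 h0^-1, then h0^-1 h conjugates a non-trivial upper unipotent to an
  upper unipotent, so it lies in the Borel subgroup. This bounds the fibres of the conjugation
  map.\<close>

lemma card_W_ge: "real (card H) * (real (card Q) - 1) \<le> card (H ^ 2 \<inter> borel) * real (card W)"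
proof -
  have "card (H \<times> (Q - {1})) \<le> card (H ^ 2 \<inter> borel) * card W"
  proof (rule card_mult_le_fibres[where f = "\<lambda>(h, u). h * u * inverse h"])
    fix w assume "w \<in> W"
    then obtain h0 u0 where 0: "h0 \<in> H" "u0 \<in> Q" "w = h0 * u0 * inverse h0" by (auto simp: W_def)
    let ?F = "{x \<in> H \<times> (Q - {1}). (case x of (h, u) \<Rightarrow> h * u * inverse h) = w}"
    show "card ?F \<le> card (H ^ 2 \<inter> borel)"
    proof (rule card_inj_on_le)
      show "inj_on (\<lambda>(h, u). inverse h0 * h) ?F"
        by (auto simp: inj_on_def mult.assoc mgroup_solve)
      show "(\<lambda>(h, u). inverse h0 * h) ` ?F \<subseteq> H ^ 2 \<inter> borel"
      proof (rule image_subsetI)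
        fix e assume "e \<in> ?F"
        then obtain h u where e: "e = (h, u)" "h \<in> H" "u \<in> Q" "u \<noteq> 1" "h * u * inverse h = w" by auto
        obtain t where t: "u = upper t" "\<not> p dvd t" using e by (auto elim: Q_E)
        define k where "k = inverse h0 * h"
        have kH: "k \<in> H ^ 2" using mult_power_H[OF H_power_1[OF inverse_H[OF 0(1)]] H_power_1[OF e(2)]] by (simp add: k_def numeral_2_eq_2)
        have "k * u * inverse k = inverse h0 * w * h0" using e(5)[symmetric] by (simp add: k_def mult.assoc)
        also have "\<dots> = u0" by (simp add: 0(3) mult.assoc)
        finally have "k * upper t * inverse k \<in> unipotents" using 0(2) t by (simp add: Q_def)
        then have "k \<in> borel" using conj_unipotent_in_unipotents_imp_borel[OF _ t(2)] kH power_H_SL by blast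
        then show "(case e of (h, u) \<Rightarrow> inverse h0 * h) \<in> H ^ 2 \<inter> borel" using kH by (simp add: e(1) k_def)
      qed
    qed simp
  qed (auto simp: W_def)
  then have "real (card H * card (Q - {1})) \<le> real (card (H ^ 2 \<inter> borel) * card W)"
    by (simp only: card_cartesian_product of_nat_le_iff)
  moreover note card_Q_minus_1
  ultimately show ?thesis by simp
qed

text \<open>A collision w u = w' u' with distinct u and u' makes two conjugates of unipotents differ
  by a non-trivial unipotent, so by the trace argument w is itself upper unipotent, and such w are
  few. Up to these, the pairs from \<open>W\<close> and \<open>Q\<close> inject into
  \<open>H ^ 6\<close>.\<close>

lemma card_W_le: "(real (card W) * card Q)\<^sup>2 \<le> K * card H * (card W * card Q + K * card Q ^ 3)"
proof -
  let ?f = "\<lambda>(w, u). w * u"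
  let ?C = "{e \<in> (W \<times> Q) \<times> (W \<times> Q). ?f (fst e) = ?f (snd e)}"
  have sub: "?f ` (W \<times> Q) \<subseteq> H ^ 6"
    using W_H mult_power_H[of _ 4 _ 2] by (auto simp: Q_def)
  have "(card (W \<times> Q))\<^sup>2 \<le> card (H ^ 6) * card ?C"
    by (rule card_collisions[OF _ sub]) simp_all
  moreover have "card ?C \<le> card W * card Q + card Q * (card Q * card (H ^ 4 \<inter> unipotents))"
  proof -
    let ?S1 = "{e \<in> ?C. snd (fst e) = snd (snd e)}" and ?S2 = "{e \<in> ?C. snd (fst e) \<noteq> snd (snd e)}"
    have "card ?S1 \<le> card (W \<times> Q)"
      by (rule card_inj_on_le[of fst]) (auto simp: inj_on_def)
    moreover have "card ?S2 \<le> card (Q \<times> Q \<times> (H ^ 4 \<inter> unipotents))"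
    proof (rule card_inj_on_le[of "\<lambda>e. (snd (fst e), snd (snd e), fst (fst e))"])
      show "inj_on (\<lambda>e. (snd (fst e), snd (snd e), fst (fst e))) ?S2"
        by (auto simp: inj_on_def prod_eq_iff)
      show "(\<lambda>e. (snd (fst e), snd (snd e), fst (fst e))) ` ?S2 \<subseteq> Q \<times> Q \<times> (H ^ 4 \<inter> unipotents)"
      proof (rule image_subsetI)
        fix e assume "e \<in> ?S2"
        then obtain w u w' u' where e: "e = ((w, u), (w', u'))" "w \<in> W" "w' \<in> W" "u \<in> Q" "u' \<in> Q" "u \<noteq> u'" "w * u = w' * u'" by auto
        obtain a where a: "u = upper a" using e(4) by (rule Q_E)
        obtain a' where a': "u' = upper a'" using e(5) by (rule Q_E)
        have nd: "\<not> p dvd a - a'" using e(6) a a' by (simp add: upper_eq_iff cong_iff_dvd_diff)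
        have "w' = w * u * inverse u'" using e(7) by (simp add: mult.assoc)
        then have w': "w' = w * upper (a - a')" by (simp add: a a' upper_inverse upper_mult mult.assoc)
        obtain h v where h: "w = h * v * inverse h" "h \<in> H" "v \<in> Q" using e(2) by (auto simp: W_def)
        obtain h' v' where h': "w' = h' * v' * inverse h'" "h' \<in> H" "v' \<in> Q" using e(3) by (auto simp: W_def)
        obtain t where t: "v = upper t" using h(3) by (rule Q_E)
        obtain t' where t': "v' = upper t'" using h'(3) by (rule Q_E)
        have "w \<in> unipotents"
          using two_conjugates_differ_by_unipotent[OF _ _ nd, of h h' t t'] w' h h' t t' H_SL by auto
        then show "(snd (fst e), snd (snd e), fst (fst e)) \<in> Q \<times> Q \<times> (H ^ 4 \<inter> unipotents)"
          using e W_H by auto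
      qed
    qed simp
    moreover have eq: "?C = ?S1 \<union> ?S2" by auto
    have "card ?C \<le> card ?S1 + card ?S2"
      by (rule ord_eq_le_trans[OF arg_cong[OF eq, of card] card_Un_le])
    ultimately show ?thesis unfolding card_cartesian_product by linarith
  qed
  ultimately have "real ((card W * card Q)\<^sup>2) \<le> real (card (H ^ 6) * (card W * card Q + card Q * (card Q * card (H ^ 4 \<inter> unipotents))))"
    unfolding card_cartesian_product of_nat_le_iff by (meson le_trans mult_le_mono2)
  also have "\<dots> = real (card (H ^ 6)) * (card W * card Q + card Q * (card Q * real (card (H ^ 4 \<inter> unipotents))))"
    by simp
  also have "\<dots> \<le> (K * card H) * (card W * card Q + card Q * (card Q * (K * card Q)))"
    using card_power_H[of 6] card_power_H_unipotents[of 4] K1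
    by (intro mult_mono add_left_mono mult_left_mono) auto
  finally show ?thesis by (simp add: power3_eq_cube mult_ac)
qed

text \<open>If few elements of \<open>H\<^sup>2\<close> fix the point at infinity, then a positive proportion of \<open>H\<^sup>4\<close> is
  unipotent; but two elements of trace \<open>2\<close> rarely differ by an upper unipotent.\<close>

lemma card_borel_ge:
  assumes g: "g \<in> H" "g \<notin> borel" and q: "real (card Q) > 128 * K ^ 7"
  shows "real (card (H ^ 2 \<inter> borel)) > 4 * K ^ 2 * card Q"
proof (rule ccontr)
  define q where "q = real (card Q)"
  define R where "R = real (card H)"
  define w where "w = real (card W)"
  assume "\<not> ?thesis"
  then have s: "real (card (H ^ 2 \<inter> borel)) \<le> 4 * K ^ 2 * q" by (simp add: q_def)
  have K7: "K ^ 7 \<ge> 1" using K1 by simp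
  have q128: "q > 128" "q > 128 * K ^ 7" using q K7 by (auto simp: q_def)
  have R0: "R > 0" using card_H_pos by (simp add: R_def)
  have "R * (q / 2) \<le> R * (q - 1)" using R0 q128 by simp
  also have "\<dots> \<le> card (H ^ 2 \<inter> borel) * w" using card_W_ge by (simp add: R_def q_def w_def)
  also have "\<dots> \<le> (4 * K ^ 2 * q) * w" using s by (intro mult_right_mono) (auto simp: w_def)
  finally have "q * R \<le> q * (8 * K ^ 2 * w)" by (simp add: mult_ac)
  \<comment> \<open>So \<open>W\<close> is a positive proportion of \<open>H\<close>, up to powers
    of K. Then \<open>W\<close> times \<open>Q\<close> is too large for \<open>H ^ 6\<close> unless
    |H| is at most of order |Q|, against the quadratic big cell bound.\<close>
  then have Rw: "R \<le> 8 * K ^ 2 * w" using q128 by simp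
  have wR: "w \<le> K * R"
  proof -
    have "w \<le> card (H ^ 4)" unfolding w_def using W_H by (simp add: card_mono)
    then show ?thesis using card_power_H[of 4] by (simp add: R_def)
  qed
  have "(w * q)\<^sup>2 \<le> K * R * (w * q + K * q ^ 3)" using card_W_le by (simp add: w_def q_def R_def)
  also have "\<dots> \<le> K * R * (K * R * q + K * q ^ 3)"
    using wR K1 R0 q128 by (intro mult_left_mono add_right_mono mult_right_mono) auto
  finally have "q * (w\<^sup>2 * q) \<le> q * (K ^ 2 * R * (R + q\<^sup>2))"
    by (simp add: power2_eq_square power3_eq_cube algebra_simps)
  then have 1: "w\<^sup>2 * q \<le> K ^ 2 * R * (R + q\<^sup>2)" using q128 by simp
  have "R\<^sup>2 * q \<le> (8 * K ^ 2 * w)\<^sup>2 * q" using Rw R0 q128 by (intro mult_right_mono power_mono) auto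
  also have "\<dots> = 64 * K ^ 4 * (w\<^sup>2 * q)" by (simp add: power_mult_distrib flip: power_mult)
  also have "\<dots> \<le> 64 * K ^ 4 * (K ^ 2 * R * (R + q\<^sup>2))" using 1 K1 by (intro mult_left_mono) auto
  also have "\<dots> = R * (64 * K ^ 6 * R + 64 * K ^ 6 * q\<^sup>2)" by (simp add: algebra_simps flip: power_add)
  finally have "R * (R * q) \<le> R * (64 * K ^ 6 * R + 64 * K ^ 6 * q\<^sup>2)" by (simp add: power2_eq_square mult.assoc)
  then have 2: "R * q \<le> 64 * K ^ 6 * R + 64 * K ^ 6 * q\<^sup>2" using R0 by simp
  have "K ^ 6 \<le> K ^ 7" using K1 by (intro power_increasing) auto
  then have "128 * K ^ 6 * R \<le> q * R" using q128 R0 by (intro mult_right_mono) auto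
  then have "q * R \<le> q * (128 * K ^ 6 * q)" using 2 by (simp add: power2_eq_square algebra_simps)
  then have 3: "R \<le> 128 * K ^ 6 * q" using q128 by simp
  have "q\<^sup>2 \<le> K * R" using card_big_cell_le(1)[OF g] by (simp add: q_def R_def)
  also have "\<dots> \<le> K * (128 * K ^ 6 * q)" using 3 K1 by (intro mult_left_mono) auto
  finally have "q * q \<le> q * (128 * K ^ 7)" by (simp add: power2_eq_square eval_nat_numeral algebra_simps)
  then show False using q128 by simp
qed

section \<open>Dilations of the unipotents\<close>

definition P :: "nat \<Rightarrow> int \<Rightarrow> bool" where
  "P n b \<longleftrightarrow> upper b \<in> H ^ n"

lemma P_add: "P m a \<Longrightarrow> P n b \<Longrightarrow> P (m + n) (a + b)"
  using mult_power_H[of "upper a" m "upper b" n] by (simp add: P_def upper_mult)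

lemma P_minus: "P n b \<Longrightarrow> P n (- b)"
  using inverse_power_H[of "upper b" n] by (simp add: P_def upper_inverse)

lemma P_diff: "P m a \<Longrightarrow> P n b \<Longrightarrow> P (m + n) (a - b)"
  using P_add[OF _ P_minus] by fastforce

lemma P_mod [simp]: "P n (b mod p) \<longleftrightarrow> P n b" by (simp add: P_def upper_mod)

lemma card_P: "card {b \<in> {0..<p}. P n b} = card (H ^ n \<inter> unipotents)"
proof (rule bij_betw_same_card)
  have "inj_on upper {b \<in> {0..<p}. P n b}"
    using residues_eq_iff_dvd by (auto simp: inj_on_def upper_eq_iff cong_iff_dvd_diff)
  moreover have "upper ` {b \<in> {0..<p}. P n b} = H ^ n \<inter> unipotents"
  proof -
    have "upper b \<in> upper ` {b \<in> {0..<p}. P n b}" if "P n b" for b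
      using that p_gt_1 by (intro image_eqI[of _ _ "b mod p"]) (auto simp: upper_mod)
    then show ?thesis by (auto simp: P_def unipotents_def)
  qed
  ultimately show "bij_betw upper {b \<in> {0..<p}. P n b} (H ^ n \<inter> unipotents)" by (simp add: bij_betw_def)
qed

text \<open>Conjugation by a Borel element with diagonal entries a and 1 / a multiplies the
  parameter of a unipotent by a^2; these are the ratios that \<open>H ^ 2\<close> makes
  available.\<close>

definition D :: "int set" where
  "D = {(a * a) mod p | a. \<exists>b d. lin a b 0 d \<in> H ^ 2 \<and> [a * d = 1] (mod p)}"

lemma D_subset: "D \<subseteq> {0..<p}"
  using p_gt_1 by (auto simp: D_def)

text \<open>The four extra factors are a Borel element of \<open>H ^ 2\<close> and its
  inverse.\<close>

lemma P_scale:
  assumes "d \<in> D" "P n b"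
  shows "P (n + 4) (d * b)"
proof -
  obtain a c e where d: "d = (a * a) mod p" "lin a c 0 e \<in> H ^ 2" "[a * e = 1] (mod p)"
    using assms(1) by (auto simp: D_def)
  have "upper (a * a * b) \<in> H ^ (2 + n + 2)"
    using conj_power_H[OF d(2), of "upper b" n] assms(2) unfolding P_def conj_upper_borel[OF d(3)] .
  moreover have "2 + n + 2 = n + 4" by simp
  ultimately have "P (n + 4) (a * a * b)" unfolding P_def by metis
  then have "P (n + 4) ((a * a * b) mod p)" by simp
  also have "(a * a * b) mod p = (d * b) mod p" by (simp add: d(1) mod_mult_left_eq)
  finally show ?thesis by simp
qed

text \<open>A Borel element of \<open>H ^ 2\<close> is determined by its diagonal up to a unipotent
  from \<open>H ^ 4\<close>, and the diagonal is determined by its square up to sign, which gives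
  the factor 2.\<close>

lemma card_D_ge: "real (card (H ^ 2 \<inter> borel)) \<le> 2 * K * card Q * card D"
proof -
  \<comment> \<open>The diagonal entry is read off from the image of (1, 0), so it does not depend
    on the integers chosen to represent the matrix.\<close>
  define tor where "tor g = fst (g \<langle>$\<rangle> (1, 0))" for g :: "(int \<times> int) perm"
  have tor: "tor (lin a b 0 d) = a mod p" if "[a * d = 1] (mod p)" for a b d
    using det_1[of a d b 0] that p_gt_1 by (simp add: tor_def apply_lin lin_fun_def vecs_def)
  define T where "T = tor ` (H ^ 2 \<inter> borel)"
  have finT: "finite T" by (simp add: T_def)
  have 1: "card (H ^ 2 \<inter> borel) \<le> card (H ^ 4 \<inter> unipotents) * card T"
  proof (rule card_mult_le_fibres[where f = tor])
    fix y assume "y \<in> T"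
    then obtain g0 where g0: "g0 \<in> H ^ 2" "g0 \<in> borel" "tor g0 = y" by (auto simp: T_def)
    obtain a b d where 0: "g0 = lin a b 0 d" "[a * d = 1] (mod p)" using g0(2) by (auto simp: borel_def)
    show "card {x \<in> H ^ 2 \<inter> borel. tor x = y} \<le> card (H ^ 4 \<inter> unipotents)"
    proof (rule card_inj_on_le[of "\<lambda>g. g * inverse g0"])
      show "(\<lambda>g. g * inverse g0) ` {x \<in> H ^ 2 \<inter> borel. tor x = y} \<subseteq> H ^ 4 \<inter> unipotents"
      proof (rule image_subsetI)
        fix g assume g: "g \<in> {x \<in> H ^ 2 \<inter> borel. tor x = y}"
        then obtain a' b' d' where 1: "g = lin a' b' 0 d'" "[a' * d' = 1] (mod p)" by (auto simp: borel_def)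
        have c: "[a' = a] (mod p)" using g g0(3) tor 0 1 by (simp add: cong_def)
        have e: "[a' * d = 1] (mod p)" using cong_trans[OF cong_mult[OF c cong_refl[of d]] 0(2)] .
        have e': "[d' * a = 1] (mod p)" using cong_trans[OF cong_mult[OF cong_refl[of d'] cong_sym[OF c]]] 1(2) by (simp add: mult.commute)
        have 2: "[d * a - (- b) * 0 = 1] (mod p)" using 0 by (simp add: mult.commute)
        have "g * inverse g0 = lin (a' * d) (a' * (- b) + b' * a) 0 (d' * a)"
          using lin_mult[of a' d' b' 0 d a "- b" 0] det_1[of a' d' b' 0] det_1[OF 2] lin_inverse[of a d b 0] 0 1 by simp
        also have "\<dots> = upper (a' * (- b) + b' * a)"
          unfolding upper_def
        proof (subst lin_eq_iff)
          have "[(a' * d) * (d' * a) - (a' * (- b) + b' * a) * 0 = 1] (mod p)" using cong_mult[OF e e'] by simp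
          then show "\<not> p dvd (a' * d) * (d' * a) - (a' * (- b) + b' * a) * 0" by (rule det_1)
        qed (use e e' in auto)
        finally have "g * inverse g0 \<in> unipotents" by (simp add: unipotents_def)
        moreover have "g * inverse g0 \<in> H ^ (2 + 2)" using g g0 by (intro mult_power_H inverse_power_H) auto
        ultimately show "g * inverse g0 \<in> H ^ 4 \<inter> unipotents" by simp
      qed
    qed (auto simp: inj_on_def)
  qed (auto simp: T_def)
  have 2: "card T \<le> 2 * card D"
  proof (rule card_mult_le_fibres[where f = "\<lambda>a. (a * a) mod p"])
    show "finite T" by (rule finT)
    have Tp: "T \<subseteq> {0..<p}" using p_gt_1 by (auto simp: T_def borel_def tor)
    show "(\<lambda>a. (a * a) mod p) ` T \<subseteq> D"
      by (auto simp: T_def borel_def tor D_def mod_mult_eq) blast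
    show "finite D" using D_subset by (rule finite_subset) simp
    fix y
    show "card {a \<in> T. (a * a) mod p = y} \<le> 2"
    proof (cases "{a \<in> T. (a * a) mod p = y} = {}")
      case False
      then obtain a0 where a0: "a0 \<in> T" "(a0 * a0) mod p = y" by auto
      have "{a \<in> T. (a * a) mod p = y} \<subseteq> {a0, (- a0) mod p}"
      proof
        fix a assume "a \<in> {a \<in> T. (a * a) mod p = y}"
        then have a: "a \<in> T" "(a * a) mod p = y" by auto
        have "(a * a) mod p = (a0 * a0) mod p" using a a0 by simp
        then have "p dvd a * a - a0 * a0" by (simp only: mod_eq_dvd_iff)
        then have "p dvd (a - a0) * (a + a0)" by (simp add: algebra_simps)
        then consider "p dvd a - a0" | "p dvd a - (- a0)" by (auto simp: dvd_mult_iff)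
        then show "a \<in> {a0, (- a0) mod p}"
        proof cases
          case 1
          then have "a = a0" using residues_eq_iff_dvd a a0 Tp by (metis subsetD)
          then show ?thesis by simp
        next
          case 2
          then have "a mod p = (- a0) mod p" by (simp add: mod_eq_dvd_iff)
          then show ?thesis using a Tp by auto
        qed
      qed
      then have "card {a \<in> T. (a * a) mod p = y} \<le> card {a0, (- a0) mod p}" by (intro card_mono) auto
      also have "\<dots> \<le> 2" by (simp add: card_insert_if)
      finally show ?thesis .
    qed (simp only: card.empty)
  qed
  have "real (card (H ^ 2 \<inter> borel)) \<le> real (card (H ^ 4 \<inter> unipotents)) * real (card T)"
    using 1 by (simp flip: of_nat_mult)
  also have "\<dots> \<le> (K * card Q) * (2 * real (card D))"
    using card_power_H_unipotents[of 4] 2 by (intro mult_mono) auto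
  finally show ?thesis by (simp add: mult_ac)
qed

text \<open>The unipotents in \<open>H ^ 44\<close> exceed those in \<open>H ^ 2\<close> by at most
  a factor K, while \<open>card_borel_ge\<close> provides more than 2 K dilation ratios. So the
  combinations of \<open>E\<close> and \<open>D\<close> fall into a set too small for injectivity,
  and \<open>affine_growth\<close> makes |Q| at least p / (2 K). The cubic big cell bound
  concludes.\<close>

theorem product_growth:
  assumes g: "g \<in> H" "g \<notin> borel" and q: "real (card (H ^ 2 \<inter> unipotents)) > 128 * K ^ 7"
  shows "real_of_int p ^ 3 / (16 * K ^ 4) \<le> card H"
proof -
  have q': "real (card Q) > 128 * K ^ 7" using q by (simp add: Q_def)
  have K7: "K ^ 7 \<ge> 1" using K1 by simp
  have q128: "real (card Q) > 128" using q' K7 by linarith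
  define E where "E = {b \<in> {0..<p}. P 2 b}"
  \<comment> \<open>The longest expression to be covered has four products of the form d e, of
    length 6 each, and two of the form d c e0, of length 10 each; this makes 44.\<close>
  define E' where "E' = {b \<in> {0..<p}. P 44 b}"
  have cE: "card E = card Q" and cE': "card E' = card (H ^ 44 \<inter> unipotents)"
    unfolding E_def E'_def Q_def by (rule card_P)+
  have cE'2: "real (card E') \<le> K * card Q" using card_power_H_unipotents[of 44] cE' by simp
  have "4 * K ^ 2 * card Q < 2 * K * card Q * card D"
    using card_borel_ge[OF g q'] card_D_ge by linarith
  then have "(2 * K * card Q) * (2 * K) < (2 * K * card Q) * card D" by (simp add: power2_eq_square mult_ac)
  then have D2K: "2 * K < card D" using K1 q128 by (simp add: mult_less_cancel_left_pos)
  have "card E > 1" using q128 cE by simp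
  then obtain e0 where e0: "e0 \<in> E" "e0 \<noteq> 0"
    by (metis card_1_singleton_iff card_gt_0_iff finite_subset insertI1 is_singletonI' is_singleton_altdef less_irrefl less_trans zero_less_one)
  have "p \<le> 2 * int (card E')"
  proof (rule affine_growth[OF prime_p _ _ _ e0])
    show "finite E'" unfolding E'_def by (rule finite_subset[of _ "{0..<p}"]) auto
    show "2 \<le> card D" using D2K K1 by linarith
    have "2 * real (card E') \<le> card Q * (2 * K)" using cE'2 by (simp add: mult.commute)
    also have "\<dots> \<le> real (card Q) * real (card D)" using D2K by (intro mult_left_mono) auto
    finally show "2 * card E' \<le> card E * card D" unfolding cE by (simp flip: of_nat_mult)
  next
    fix d d' c e e1 e2 assume m: "d \<in> D" "d' \<in> D" "c \<in> D" "e \<in> E" "e1 \<in> E" "e2 \<in> E"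
    have Pd: "P 6 (x * y)" if "x \<in> D" "y \<in> E" for x y
      using P_scale[OF that(1), of 2 y] that(2) by (simp add: E_def)
    have "P ((6 + 6) + (6 + 6)) ((d * e - d' * e) + (c * e1 - c * e2))"
      using m by (intro P_add P_diff Pd)
    then have 1: "P 24 ((d - d') * e + c * (e1 - e2))" by (simp add: algebra_simps)
    have "P 10 (d * (c * e0))" "P 10 (d' * (c * e0))"
      using P_scale[OF m(1) Pd[OF m(3) e0(1)]] P_scale[OF m(2) Pd[OF m(3) e0(1)]] by simp_all
    then have "P (24 + (10 + 10)) (((d - d') * e + c * (e1 - e2)) + (d * (c * e0) - d' * (c * e0)))"
      by (intro P_add P_diff 1)
    then have 2: "P 44 ((d - d') * e + c * (e1 - e2) + (d - d') * c * e0)" by (simp add: algebra_simps)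
    have "P 44 ((d - d') * e + c * (e1 - e2))" using 1 power_H_mono[of 24 44] by (auto simp: P_def)
    then show "((d - d') * e + c * (e1 - e2)) mod p \<in> E' \<and> ((d - d') * e + c * (e1 - e2) + (d - d') * c * e0) mod p \<in> E'"
      using 2 p_gt_1 by (simp add: E'_def)
  qed (use D_subset in \<open>auto simp: E_def E'_def\<close>)
  then have "real_of_int p \<le> 2 * real (card E')" by linarith
  also have "\<dots> \<le> 2 * (K * card Q)" using cE'2 by simp
  finally have pq: "real_of_int p \<le> 2 * K * card Q" by simp
  have "real_of_int p ^ 3 \<le> (2 * K * card Q) ^ 3" using pq p_gt_1 by (intro power_mono) auto
  also have "\<dots> = 16 * K ^ 3 * (real (card Q) ^ 2 * (real (card Q) / 2))" by (simp add: power_mult_distrib power2_eq_square power3_eq_cube)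
  also have "\<dots> \<le> 16 * K ^ 3 * (real (card Q) ^ 2 * (real (card Q) - 1))"
    using q128 K1 by (intro mult_left_mono) auto
  also have "\<dots> \<le> 16 * K ^ 3 * (K * card H)" using card_big_cell_le(2)[OF g] K1 by (intro mult_left_mono) auto
  also have "\<dots> = (16 * K ^ 4) * card H" by (simp add: eval_nat_numeral)
  finally show ?thesis using K1 by (simp add: divide_le_eq mult.commute)
qed

end

section \<open>Averaging operators on the projective line\<close>

context sl2
begin

definition nz :: "(int \<times> int) set" where
  "nz = vecs - {(0, 0)}"

definition scale :: "int \<Rightarrow> int \<times> int \<Rightarrow> int \<times> int" where
  "scale t v = ((t * fst v) mod p, (t * snd v) mod p)"

text \<open>Functions on the projective line, encoded as functions on non-zero vectors that are
  constant along lines. Sums over \<open>nz\<close> are p - 1 times sums over the projective line,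
  and no quotient has to be formed.\<close>

definition homogeneous :: "(int \<times> int \<Rightarrow> real) \<Rightarrow> bool" where
  "homogeneous F \<longleftrightarrow> (\<forall>v\<in>nz. \<forall>t. \<not> p dvd t \<longrightarrow> F (scale t v) = F v)"

text \<open>The Moebius maps have determinant \<open>- \<rho>\<close>, so they act through this
  larger group.\<close>

definition GL :: "(int \<times> int) perm set" where
  "GL = {lin a b c d | a b c d. \<not> p dvd a * d - b * c}"

lemma SL_GL: "g \<in> SL \<Longrightarrow> g \<in> GL"
  unfolding SL_def GL_def using det_1 by blast

lemma apply_inverse_apply [simp]: "inverse g \<langle>$\<rangle> (g \<langle>$\<rangle> v) = (v :: int \<times> int)"
  unfolding apply_sequence mgroup_left_inverse by simp

lemma finite_nz [simp]: "finite nz" by (simp add: nz_def)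

lemma e1_nz [simp]: "(1, 0) \<in> nz" using p_gt_1 by (simp add: nz_def vecs_def)

lemma GL_vecs:
  assumes "g \<in> GL"
  shows "g \<langle>$\<rangle> v \<in> nz \<longleftrightarrow> v \<in> nz"
proof -
  obtain a b c d where g: "g = lin a b c d" "\<not> p dvd a * d - b * c" using assms by (auto simp: GL_def)
  have 0: "g \<langle>$\<rangle> (0, 0) = (0, 0)" using p_gt_1 by (simp add: g(1) apply_lin[OF g(2)] lin_fun_def vecs_def)
  have inj: "inj (apply g)" by (simp add: bij_is_inj)
  have "g \<langle>$\<rangle> v = (0, 0) \<longleftrightarrow> v = (0, 0)" using 0 injD[OF inj, of v "(0, 0)"] by metis
  moreover have "g \<langle>$\<rangle> v \<in> vecs \<longleftrightarrow> v \<in> vecs"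
    unfolding g(1) apply_lin[OF g(2)] using lin_fun_vecs[of v a b c d] by (cases v) (auto simp: lin_fun_def)
  ultimately show ?thesis by (auto simp: nz_def)
qed

lemma sum_GL:
  assumes "g \<in> GL"
  shows "(\<Sum>v\<in>nz. h (g \<langle>$\<rangle> v)) = (\<Sum>v\<in>nz. h v)"
proof (rule sum.reindex_bij_betw)
  have "inj_on (apply g) nz" by (meson bij_apply bij_is_inj inj_on_subset subset_UNIV)
  moreover have "apply g ` nz \<subseteq> nz" using GL_vecs[OF assms] by auto
  ultimately show "bij_betw (apply g) nz nz" by (simp add: bij_betw_def endo_inj_surj)
qed

lemma GL_scale:
  assumes "g \<in> GL" "v \<in> nz"
  shows "g \<langle>$\<rangle> (scale t v) = scale t (g \<langle>$\<rangle> v)"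
proof -
  obtain a b c d where g: "g = lin a b c d" "\<not> p dvd a * d - b * c" using assms by (auto simp: GL_def)
  obtain x y where v: "v = (x, y)" by fastforce
  have "[a * ((t * x) mod p) + b * ((t * y) mod p) = a * (t * x) + b * (t * y)] (mod p)"
    "[c * ((t * x) mod p) + d * ((t * y) mod p) = c * (t * x) + d * (t * y)] (mod p)"
    by (intro cong_add cong_mult; simp add: cong_def)+
  then have "[a * ((t * x) mod p) + b * ((t * y) mod p) = t * (a * x + b * y)] (mod p)"
    "[c * ((t * x) mod p) + d * ((t * y) mod p) = t * (c * x + d * y)] (mod p)"
    by (simp_all add: distrib_left mult.left_commute)
  then show ?thesis using assms(2) p_gt_1
    unfolding g(1) apply_lin[OF g(2)] v
    by (simp add: lin_fun_def scale_def nz_def vecs_def cong_def mod_mult_right_eq)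
qed

lemma homogeneous_comp_GL:
  assumes "homogeneous F" "g \<in> GL"
  shows "homogeneous (\<lambda>v. F (g \<langle>$\<rangle> v))"
  using assms GL_vecs[OF assms(2)] by (auto simp: homogeneous_def GL_scale)

text \<open>The vectors (1, 0) and (s, 1) represent every line once, and each line contains p - 1
  non-zero vectors.\<close>

lemma sum_homogeneous:
  fixes F :: "int \<times> int \<Rightarrow> real"
  assumes F: "homogeneous F"
  shows "(\<Sum>v\<in>nz. F v) = (p - 1) * (F (1, 0) + (\<Sum>s\<in>{0..<p}. F (s, 1)))"
proof -
  have nz: "nz = (\<lambda>x. (x, 0)) ` {1..<p} \<union> {0..<p} \<times> {1..<p}"
    by (auto simp: nz_def vecs_def)
  have "(\<Sum>v\<in>nz. F v) = (\<Sum>v\<in>(\<lambda>x. (x, 0)) ` {1..<p}. F v) + (\<Sum>v\<in>{0..<p} \<times> {1..<p}. F v)"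
    unfolding nz by (rule sum.union_disjoint) auto
  also have "(\<Sum>v\<in>(\<lambda>x. (x, 0)) ` {1..<p}. F v) = (\<Sum>x\<in>{1..<p}. F (x, 0))"
    by (subst sum.reindex) (auto simp: inj_on_def)
  also have "\<dots> = (\<Sum>x\<in>{1..<p}. F (1, 0))"
  proof (rule sum.cong[OF refl])
    fix x assume x: "x \<in> {1..<p}"
    then have "\<not> p dvd x" by (auto simp: zdvd_not_zless)
    then have "F (scale x (1, 0)) = F (1, 0)" using F by (simp add: homogeneous_def)
    then show "F (x, 0) = F (1, 0)" using x by (simp add: scale_def)
  qed
  also have "(\<Sum>v\<in>{0..<p} \<times> {1..<p}. F v) = (\<Sum>y\<in>{1..<p}. \<Sum>x\<in>{0..<p}. F (x, y))"
    by (subst sum.swap) (simp add: sum.cartesian_product)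
  also have "\<dots> = (\<Sum>y\<in>{1..<p}. \<Sum>s\<in>{0..<p}. F (s, 1))"
  proof (rule sum.cong[OF refl])
    fix y assume y: "y \<in> {1..<p}"
    then have ny: "\<not> p dvd y" by (auto simp: zdvd_not_zless)
    have inj: "inj_on (\<lambda>s. (y * s) mod p) {0..<p}"
    proof (rule inj_onI)
      fix s s' assume s: "s \<in> {0..<p}" "s' \<in> {0..<p}" "(y * s) mod p = (y * s') mod p"
      then have "p dvd y * (s - s')" by (simp add: mod_eq_dvd_iff right_diff_distrib)
      then show "s = s'" using ny s residues_eq_iff_dvd by (simp add: dvd_mult_iff)
    qed
    have "(\<lambda>s. (y * s) mod p) ` {0..<p} = {0..<p}"
      by (rule endo_inj_surj[OF _ _ inj]) (use p_gt_1 in auto)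
    then have "(\<Sum>x\<in>{0..<p}. F (x, y)) = (\<Sum>s\<in>{0..<p}. F ((y * s) mod p, y))"
      using sum.reindex[OF inj, of "\<lambda>x. F (x, y)"] by simp
    also have "\<dots> = (\<Sum>s\<in>{0..<p}. F (s, 1))"
    proof (rule sum.cong[OF refl])
      fix s assume s: "s \<in> {0..<p}"
      then have "(s, 1) \<in> nz" using p_gt_1 by (auto simp: nz_def vecs_def)
      then have "F (scale y (s, 1)) = F (s, 1)" using F ny by (simp add: homogeneous_def)
      then show "F ((y * s) mod p, y) = F (s, 1)" using y by (simp add: scale_def)
    qed
    finally show "(\<Sum>x\<in>{0..<p}. F (x, y)) = (\<Sum>s\<in>{0..<p}. F (s, 1))" .
  qed
  finally show ?thesis using p_gt_1 by (simp add: distrib_left)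
qed

definition Op :: "((int \<times> int) perm \<Rightarrow> real) \<Rightarrow> (int \<times> int \<Rightarrow> real) \<Rightarrow> int \<times> int \<Rightarrow> real" where
  "Op \<mu> F v = (\<Sum>g\<in>SL. \<mu> g * F (g \<langle>$\<rangle> v))"

definition norm2 :: "(int \<times> int \<Rightarrow> real) \<Rightarrow> real" where
  "norm2 F = (\<Sum>v\<in>nz. (F v)\<^sup>2)"

lemma norm2_nonneg [simp]: "0 \<le> norm2 F" by (simp add: norm2_def sum_nonneg)

lemma homogeneous_Op: "homogeneous F \<Longrightarrow> homogeneous (Op \<mu> F)"
proof -
  assume F: "homogeneous F"
  have "Op \<mu> F (scale t v) = Op \<mu> F v" if "v \<in> nz" "\<not> p dvd t" for v t
    unfolding Op_def
  proof (rule sum.cong[OF refl])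
    fix g assume "g \<in> SL"
    then have "homogeneous (\<lambda>v. F (g \<langle>$\<rangle> v))" using F SL_GL by (simp add: homogeneous_comp_GL)
    then show "\<mu> g * F (g \<langle>$\<rangle> (scale t v)) = \<mu> g * F (g \<langle>$\<rangle> v)"
      using that by (simp add: homogeneous_def)
  qed
  then show ?thesis by (simp add: homogeneous_def)
qed

lemma sum_Op_mult: "(\<Sum>v\<in>nz. Op \<mu> F v * h v) = (\<Sum>g\<in>SL. \<mu> g * (\<Sum>v\<in>nz. F (g \<langle>$\<rangle> v) * h v))"
proof -
  have "(\<Sum>v\<in>nz. Op \<mu> F v * h v) = (\<Sum>v\<in>nz. \<Sum>g\<in>SL. \<mu> g * (F (g \<langle>$\<rangle> v) * h v))"
    by (simp add: Op_def sum_distrib_right mult.assoc)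
  also have "\<dots> = (\<Sum>g\<in>SL. \<Sum>v\<in>nz. \<mu> g * (F (g \<langle>$\<rangle> v) * h v))" by (rule sum.swap)
  finally show ?thesis by (simp add: sum_distrib_left)
qed

lemma sum_Op:
  assumes "(\<Sum>v\<in>nz. F v) = 0"
  shows "(\<Sum>v\<in>nz. Op \<mu> F v) = 0"
  using sum_Op_mult[of \<mu> F "\<lambda>_. 1"] sum_GL[OF SL_GL, of _ F] assms by simp

text \<open>The order of the factors is reversed because functions are pulled back along a left
  action.\<close>

lemma Op_conv: "Op (SL.conv f g) F v = Op g (Op f F) v"
proof -
  have "Op (SL.conv f g) F v = (\<Sum>y\<in>SL. \<Sum>z\<in>SL. f y * g z * F ((y * z) \<langle>$\<rangle> v))"
    unfolding Op_def by (rule SL.sum_conv)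
  also have "\<dots> = (\<Sum>z\<in>SL. \<Sum>y\<in>SL. f y * g z * F ((y * z) \<langle>$\<rangle> v))" by (rule sum.swap)
  also have "\<dots> = Op g (Op f F) v"
    unfolding Op_def sum_distrib_left by (simp add: apply_times mult_ac)
  finally show ?thesis .
qed

lemma Op_self_adjoint:
  assumes "\<And>x. x \<in> SL \<Longrightarrow> \<mu> (inverse x) = \<mu> x"
  shows "(\<Sum>v\<in>nz. Op \<mu> F v * h v) = (\<Sum>v\<in>nz. F v * Op \<mu> h v)"
proof -
  have "(\<Sum>v\<in>nz. Op \<mu> F v * h v) = (\<Sum>g\<in>SL. \<mu> g * (\<Sum>v\<in>nz. F (g \<langle>$\<rangle> v) * h v))" by (rule sum_Op_mult)
  also have "\<dots> = (\<Sum>g\<in>SL. \<mu> (inverse g) * (\<Sum>v\<in>nz. F (inverse g \<langle>$\<rangle> v) * h v))"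
    by (rule SL.sum_inverse[symmetric])
  also have "\<dots> = (\<Sum>g\<in>SL. \<mu> g * (\<Sum>v\<in>nz. h (g \<langle>$\<rangle> v) * F v))"
  proof (rule sum.cong[OF refl])
    fix g assume g: "g \<in> SL"
    have "(\<Sum>v\<in>nz. F (inverse g \<langle>$\<rangle> v) * h v) = (\<Sum>v\<in>nz. h (g \<langle>$\<rangle> v) * F v)"
      using sum_GL[OF SL_GL[OF g], of "\<lambda>v. F (inverse g \<langle>$\<rangle> v) * h v"] by (simp add: mult.commute)
    then show "\<mu> (inverse g) * (\<Sum>v\<in>nz. F (inverse g \<langle>$\<rangle> v) * h v) = \<mu> g * (\<Sum>v\<in>nz. h (g \<langle>$\<rangle> v) * F v)"
      using assms[OF g] by simp
  qed
  also have "\<dots> = (\<Sum>v\<in>nz. Op \<mu> h v * F v)" by (rule sum_Op_mult[symmetric])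
  finally show ?thesis by (simp add: mult.commute)
qed

lemma transitive:
  assumes "v \<in> nz"
  obtains h where "h \<in> SL" "h \<langle>$\<rangle> (1, 0) = v"
proof -
  obtain a c where v: "v = (a, c)" by fastforce
  have r: "a \<in> {0..<p}" "c \<in> {0..<p}" "a \<noteq> 0 \<or> c \<noteq> 0" using assms by (auto simp: v nz_def vecs_def)
  have "\<exists>b d. [a * d - b * c = 1] (mod p)"
  proof (cases "a = 0")
    case False
    then have "\<not> p dvd a" using r by (auto simp: zdvd_not_zless)
    then have "coprime a p" using prime_p by (metis coprime_commute prime_imp_coprime_int)
    then obtain d where "[a * d = 1] (mod p)" using cong_solve_coprime_int by blast
    then have "[a * d - 0 * c = 1] (mod p)" by simp
    then show ?thesis by blast
  next
    case True
    then have "\<not> p dvd c" using r by (auto simp: zdvd_not_zless)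
    then have "coprime c p" using prime_p by (metis coprime_commute prime_imp_coprime_int)
    then obtain d where "[c * d = 1] (mod p)" using cong_solve_coprime_int by blast
    then have "[a * 0 - (- d) * c = 1] (mod p)" by (simp add: mult.commute)
    then show ?thesis by blast
  qed
  then obtain b d where bd: "[a * d - b * c = 1] (mod p)" by blast
  show ?thesis
    by (rule that[of "lin a b c d"]) (use bd r p_gt_1 in \<open>auto simp: SL_I apply_lin[OF det_1[OF bd]] lin_fun_def vecs_def v\<close>)
qed

lemma card_fibre_le: "card {g \<in> SL. g \<langle>$\<rangle> (1, 0) = w} \<le> nat p"
proof (cases "{g \<in> SL. g \<langle>$\<rangle> (1, 0) = w} = {}")
  case False
  then obtain g0 where g0: "g0 \<in> SL" "g0 \<langle>$\<rangle> (1, 0) = w" by blast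
  have "card {g \<in> SL. g \<langle>$\<rangle> (1, 0) = w} \<le> card (upper ` {0..<p})"
  proof (rule card_inj_on_le)
    show "inj_on (\<lambda>g. inverse g0 * g) {g \<in> SL. g \<langle>$\<rangle> (1, 0) = w}" by (auto simp: inj_on_def)
    show "(\<lambda>g. inverse g0 * g) ` {g \<in> SL. g \<langle>$\<rangle> (1, 0) = w} \<subseteq> upper ` {0..<p}"
    proof (rule image_subsetI)
      fix g assume g: "g \<in> {g \<in> SL. g \<langle>$\<rangle> (1, 0) = w}"
      have "g \<langle>$\<rangle> (1, 0) = g0 \<langle>$\<rangle> (1, 0)" using g g0 by simp
      then have fix1: "(inverse g0 * g) \<langle>$\<rangle> (1, 0) = (1, 0)" unfolding apply_times o_apply by simp
      have "inverse g0 * g \<in> SL" using g g0 by simp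
      then obtain a b c d where k: "inverse g0 * g = lin a b c d" "[a * d - b * c = 1] (mod p)" by (rule SL_E)
      have "[a = 1] (mod p)" "[c = 0] (mod p)"
        using fix1 p_gt_1 unfolding k(1) apply_lin[OF det_1[OF k(2)]] by (auto simp: lin_fun_def vecs_def cong_def)
      moreover from this have "[a * d - b * c = 1 * d - b * 0] (mod p)" by (intro cong_diff cong_mult) auto
      then have "[d = 1] (mod p)" using k(2) by (metis cong_sym cong_trans diff_zero mult_1 mult_zero_right)
      ultimately have "lin a b c d = lin 1 (b mod p) 0 1"
        by (subst lin_eq_iff) (use det_1[OF k(2)] in \<open>auto simp: cong_def\<close>)
      then show "inverse g0 * g \<in> upper ` {0..<p}" using p_gt_1 by (auto simp: k(1) upper_def)
    qed
  qed simp
  also have "\<dots> \<le> nat p" using card_image_le[of "{0..<p}" upper] by simp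
  finally show ?thesis .
qed (simp only: card.empty)

section \<open>Two-point correlations and the spectral gain\<close>

definition corr :: "(int \<times> int \<Rightarrow> real) \<Rightarrow> int \<times> int \<Rightarrow> int \<times> int \<Rightarrow> real" where
  "corr F v w = (\<Sum>g\<in>SL. F (g \<langle>$\<rangle> v) * F (g \<langle>$\<rangle> w))"

lemma corr_translate: "h \<in> SL \<Longrightarrow> corr F (h \<langle>$\<rangle> v) (h \<langle>$\<rangle> w) = corr F v w"
  unfolding corr_def using SL.sum_right_translate[of h "\<lambda>g. F (g \<langle>$\<rangle> v) * F (g \<langle>$\<rangle> w)"]
  by (simp add: apply_times)

lemma corr_e1_le: "corr F (1, 0) (1, 0) \<le> p * norm2 F"
proof -
  have "corr F (1, 0) (1, 0) = (\<Sum>g\<in>SL. (F (g \<langle>$\<rangle> (1, 0)))\<^sup>2)"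
    by (simp add: corr_def power2_eq_square)
  also have "\<dots> = (\<Sum>w\<in>nz. \<Sum>g\<in>{g \<in> SL. g \<langle>$\<rangle> (1, 0) = w}. (F (g \<langle>$\<rangle> (1, 0)))\<^sup>2)"
    by (rule sum.group[symmetric]) (use GL_vecs SL_GL in \<open>auto simp: finite_SL\<close>)
  also have "\<dots> = (\<Sum>w\<in>nz. card {g \<in> SL. g \<langle>$\<rangle> (1, 0) = w} * (F w)\<^sup>2)" by simp
  also have "\<dots> \<le> (\<Sum>w\<in>nz. real (nat p) * (F w)\<^sup>2)"
    using card_fibre_le by (intro sum_mono mult_right_mono) auto
  finally show ?thesis using p_gt_1 by (simp add: norm2_def sum_distrib_left)
qed

lemma corr_scale:
  assumes "homogeneous F" "\<not> p dvd t" "w \<in> nz"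
  shows "corr F v (scale t w) = corr F v w"
  unfolding corr_def
proof (rule sum.cong[OF refl])
  fix g assume "g \<in> SL"
  then have "homogeneous (\<lambda>v. F (g \<langle>$\<rangle> v))" using assms(1) SL_GL by (simp add: homogeneous_comp_GL)
  then show "F (g \<langle>$\<rangle> v) * F (g \<langle>$\<rangle> (scale t w)) = F (g \<langle>$\<rangle> v) * F (g \<langle>$\<rangle> w)"
    using assms by (simp add: homogeneous_def)
qed

lemma corr_e1_axis:
  assumes "homogeneous F" "x \<in> {1..<p}"
  shows "corr F (1, 0) (x, 0) = corr F (1, 0) (1, 0)"
proof -
  have "\<not> p dvd x" using assms by (auto simp: zdvd_not_zless)
  then have "corr F (1, 0) (scale x (1, 0)) = corr F (1, 0) (1, 0)" using assms by (intro corr_scale) auto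
  then show ?thesis using assms by (simp add: scale_def)
qed

text \<open>The lines through \<open>(s, 1)\<close>, together with the line through \<open>(1, 0)\<close>, exhaust the projective line,
  and the stabilizer of \<open>(1, 0)\<close> permutes the former transitively.\<close>

lemma corr_e1_off_axis:
  assumes F: "homogeneous F" "(\<Sum>v\<in>nz. F v) = 0" and xy: "x \<in> {0..<p}" "y \<in> {1..<p}"
  shows "p * corr F (1, 0) (x, y) = - corr F (1, 0) (1, 0)"
proof -
  have s_nz: "(s, 1) \<in> nz" if "s \<in> {0..<p}" for s using that p_gt_1 by (auto simp: nz_def vecs_def)
  have up: "upper b \<langle>$\<rangle> (x, z) = ((x + b * z) mod p, z)" if "x \<in> {0..<p}" "z \<in> {0..<p}" for b x z
    using that p_gt_1 unfolding upper_def by (subst apply_lin) (auto simp: lin_fun_def vecs_def)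
  have move: "corr F (1, 0) (s, 1) = corr F (1, 0) (0, 1)" if "s \<in> {0..<p}" for s
  proof -
    have "corr F (upper s \<langle>$\<rangle> (1, 0)) (upper s \<langle>$\<rangle> (0, 1)) = corr F (1, 0) (0, 1)" by (rule corr_translate) simp
    then show ?thesis using up[of 1 0 s] up[of 0 1 s] that p_gt_1 by simp
  qed
  have "(\<Sum>s\<in>{0..<p}. corr F (1, 0) (s, 1)) = (\<Sum>g\<in>SL. \<Sum>s\<in>{0..<p}. F (g \<langle>$\<rangle> (1, 0)) * F (g \<langle>$\<rangle> (s, 1)))"
    unfolding corr_def by (rule sum.swap)
  also have "\<dots> = (\<Sum>g\<in>SL. - (F (g \<langle>$\<rangle> (1, 0)) * F (g \<langle>$\<rangle> (1, 0))))"
  proof (rule sum.cong[OF refl])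
    fix g assume g: "g \<in> SL"
    have "(p - 1) * (F (g \<langle>$\<rangle> (1, 0)) + (\<Sum>s\<in>{0..<p}. F (g \<langle>$\<rangle> (s, 1)))) = 0"
      using sum_homogeneous[OF homogeneous_comp_GL[OF F(1) SL_GL[OF g]]] sum_GL[OF SL_GL[OF g], of F] F(2) by simp
    then have "(\<Sum>s\<in>{0..<p}. F (g \<langle>$\<rangle> (s, 1))) = - F (g \<langle>$\<rangle> (1, 0))" using p_gt_1 by simp
    then show "(\<Sum>s\<in>{0..<p}. F (g \<langle>$\<rangle> (1, 0)) * F (g \<langle>$\<rangle> (s, 1))) = - (F (g \<langle>$\<rangle> (1, 0)) * F (g \<langle>$\<rangle> (1, 0)))"
      by (simp flip: sum_distrib_left)
  qed
  also have "\<dots> = - corr F (1, 0) (1, 0)" by (simp add: corr_def sum_negf)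
  finally have "(\<Sum>s\<in>{0..<p}. corr F (1, 0) (s, 1)) = - corr F (1, 0) (1, 0)" .
  moreover have "(\<Sum>s\<in>{0..<p}. corr F (1, 0) (s, 1)) = (\<Sum>s\<in>{0..<p}. corr F (1, 0) (0, 1))"
    by (intro sum.cong refl move)
  ultimately have 1: "p * corr F (1, 0) (0, 1) = - corr F (1, 0) (1, 0)" using p_gt_1 by simp
  have ny: "\<not> p dvd y" using xy by (auto simp: zdvd_not_zless)
  then have "coprime y p" using prime_p by (metis coprime_commute prime_imp_coprime_int)
  then obtain z where z: "[y * z = 1] (mod p)" using cong_solve_coprime_int by blast
  define s where "s = (z * x) mod p"
  have s: "s \<in> {0..<p}" using p_gt_1 by (simp add: s_def)
  have "[y * s = y * z * x] (mod p)" by (simp add: s_def cong_def mod_mult_right_eq mult.assoc)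
  also have "[y * z * x = 1 * x] (mod p)" using z by (rule cong_mult) simp
  finally have "scale y (s, 1) = (x, y)" using xy by (simp add: scale_def cong_def)
  then have "corr F (1, 0) (x, y) = corr F (1, 0) (s, 1)" using corr_scale[OF F(1) ny s_nz[OF s], of "(1, 0)"] by simp
  then show ?thesis using 1 move[OF s] by simp
qed

text \<open>The kernel is c on the line of (1, 0) and - c / p off it. As \<open>h\<close> has mean
  zero, its sum off this line is minus its sum on it, so the two contributions add up to the factor
  1 + 1 / p.\<close>

lemma sum_corr_e1:
  assumes F: "homogeneous F" "(\<Sum>v\<in>nz. F v) = 0" and h: "homogeneous h" "(\<Sum>v\<in>nz. h v) = 0"
  shows "(\<Sum>w\<in>nz. h w * corr F (1, 0) w) = (p - 1) * (1 + 1 / p) * corr F (1, 0) (1, 0) * h (1, 0)"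
proof -
  define c where "c = corr F (1, 0) (1, 0)"
  have nz: "nz = (\<lambda>x. (x, 0)) ` {1..<p} \<union> ({0..<p} \<times> {1..<p})"
    by (auto simp: nz_def vecs_def)
  have split: "(\<Sum>w\<in>nz. f w) = (\<Sum>x\<in>{1..<p}. f (x, 0)) + (\<Sum>w\<in>{0..<p} \<times> {1..<p}. f w)" for f :: "int \<times> int \<Rightarrow> real"
    unfolding nz by (subst sum.union_disjoint) (auto simp: sum.reindex inj_on_def)
  have ax: "h (x, 0) = h (1, 0)" if "x \<in> {1..<p}" for x
  proof -
    have "\<not> p dvd x" using that by (auto simp: zdvd_not_zless)
    then have "h (scale x (1, 0)) = h (1, 0)" using h(1) by (simp add: homogeneous_def)
    then show ?thesis using that by (simp add: scale_def)
  qed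
  have hx: "(\<Sum>x\<in>{1..<p}. h (x, 0)) = (p - 1) * h (1, 0)"
  proof -
    have "(\<Sum>x\<in>{1..<p}. h (x, 0)) = (\<Sum>x\<in>{1..<p}. h (1, 0))" by (intro sum.cong refl ax)
    then show ?thesis using p_gt_1 by simp
  qed
  have "(\<Sum>w\<in>{0..<p} \<times> {1..<p}. h w * corr F (1, 0) w) = (\<Sum>w\<in>{0..<p} \<times> {1..<p}. h w * (- c / p))"
  proof (rule sum.cong[OF refl])
    fix w assume "w \<in> {0..<p} \<times> {1..<p}"
    then obtain x y where w: "w = (x, y)" "x \<in> {0..<p}" "y \<in> {1..<p}" by auto
    have "corr F (1, 0) w = - c / p"
      using corr_e1_off_axis[OF F w(2,3)] p_gt_1 by (simp add: c_def w(1) field_simps)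
    then show "h w * corr F (1, 0) w = h w * (- c / p)" by simp
  qed
  also have "\<dots> = (\<Sum>w\<in>{0..<p} \<times> {1..<p}. h w) * (- c / p)" by (simp only: sum_distrib_right)
  also have "(\<Sum>w\<in>{0..<p} \<times> {1..<p}. h w) = - ((p - 1) * h (1, 0))" using split[of h] h(2) hx by simp
  finally have off: "(\<Sum>w\<in>{0..<p} \<times> {1..<p}. h w * corr F (1, 0) w) = (p - 1) * h (1, 0) * c / p" by simp
  have "(\<Sum>x\<in>{1..<p}. h (x, 0) * corr F (1, 0) (x, 0)) = (\<Sum>x\<in>{1..<p}. h (1, 0) * c)"
    unfolding c_def by (intro sum.cong refl arg_cong2[where f = "(*)"] ax corr_e1_axis[OF F(1)])
  also have "\<dots> = (p - 1) * h (1, 0) * c" using p_gt_1 by simp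
  finally show ?thesis using split[of "\<lambda>w. h w * corr F (1, 0) w"] off by (simp add: c_def algebra_simps)
qed

text \<open>Schur's lemma made explicit: averaging the rank one operator of \<open>F\<close> over
  \<open>SL\<close> gives an operator that commutes with the group and acts on the mean-zero
  functions as a scalar. Transitivity reduces the computation to the vector (1, 0).\<close>

lemma sum_corr:
  assumes F: "homogeneous F" "(\<Sum>v\<in>nz. F v) = 0" and h: "homogeneous h" "(\<Sum>v\<in>nz. h v) = 0" and v: "v \<in> nz"
  shows "(\<Sum>w\<in>nz. h w * corr F v w) = (p - 1) * (1 + 1 / p) * corr F (1, 0) (1, 0) * h v"
proof -
  obtain g where g: "g \<in> SL" "g \<langle>$\<rangle> (1, 0) = v" using v by (rule transitive)
  have "(\<Sum>w\<in>nz. h w * corr F v w) = (\<Sum>w\<in>nz. h (g \<langle>$\<rangle> w) * corr F v (g \<langle>$\<rangle> w))"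
    by (rule sum_GL[OF SL_GL[OF g(1)], symmetric])
  also have "\<dots> = (\<Sum>w\<in>nz. h (g \<langle>$\<rangle> w) * corr F (1, 0) w)"
    using corr_translate[OF g(1), of F "(1, 0)"] g(2) by simp
  also have "\<dots> = (p - 1) * (1 + 1 / p) * corr F (1, 0) (1, 0) * h (g \<langle>$\<rangle> (1, 0))"
  proof (rule sum_corr_e1[OF F homogeneous_comp_GL[OF h(1) SL_GL[OF g(1)]]])
    show "(\<Sum>v\<in>nz. h (g \<langle>$\<rangle> v)) = 0" using sum_GL[OF SL_GL[OF g(1)], of h] h(2) by simp
  qed
  finally show ?thesis by (simp add: g(2))
qed

text \<open>The gain of a factor \<open>p\<close> over the trivial bound comes from the irreducibility of the mean-zero
  functions on the projective line, here in the form of 2-transitivity.\<close>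

theorem norm2_Op_le:
  assumes F: "homogeneous F" "(\<Sum>v\<in>nz. F v) = 0"
  shows "norm2 (Op \<mu> F) \<le> SL.energy \<mu> * p\<^sup>2 * norm2 F"
proof -
  define h where "h = Op \<mu> F"
  define c where "c = corr F (1, 0) (1, 0)"
  define B where "B g = (\<Sum>v\<in>nz. F (g \<langle>$\<rangle> v) * h v)" for g
  have h: "homogeneous h" "(\<Sum>v\<in>nz. h v) = 0" using F by (simp_all add: h_def homogeneous_Op sum_Op)
  have 1: "norm2 h = (\<Sum>g\<in>SL. \<mu> g * B g)"
    using sum_Op_mult[of \<mu> F h] by (simp add: norm2_def B_def power2_eq_square flip: h_def)
  \<comment> \<open>Schur orthogonality for the matrix coefficient \<open>B\<close>: expanding the
    square produces the kernel \<open>corr\<close>.\<close>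
  have "(\<Sum>g\<in>SL. (B g)\<^sup>2) = (\<Sum>g\<in>SL. \<Sum>v\<in>nz. \<Sum>w\<in>nz. h v * (h w * (F (g \<langle>$\<rangle> v) * F (g \<langle>$\<rangle> w))))"
    by (simp add: B_def power2_eq_square sum_product mult_ac)
  also have "\<dots> = (\<Sum>v\<in>nz. \<Sum>g\<in>SL. \<Sum>w\<in>nz. h v * (h w * (F (g \<langle>$\<rangle> v) * F (g \<langle>$\<rangle> w))))" by (rule sum.swap)
  also have "\<dots> = (\<Sum>v\<in>nz. h v * (\<Sum>w\<in>nz. h w * corr F v w))"
  proof (rule sum.cong[OF refl])
    fix v
    have "(\<Sum>g\<in>SL. \<Sum>w\<in>nz. h v * (h w * (F (g \<langle>$\<rangle> v) * F (g \<langle>$\<rangle> w)))) = (\<Sum>w\<in>nz. \<Sum>g\<in>SL. h v * (h w * (F (g \<langle>$\<rangle> v) * F (g \<langle>$\<rangle> w))))"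
      by (rule sum.swap)
    then show "(\<Sum>g\<in>SL. \<Sum>w\<in>nz. h v * (h w * (F (g \<langle>$\<rangle> v) * F (g \<langle>$\<rangle> w)))) = h v * (\<Sum>w\<in>nz. h w * corr F v w)"
      by (simp add: corr_def sum_distrib_left)
  qed
  also have "\<dots> = (\<Sum>v\<in>nz. ((p - 1) * (1 + 1 / p) * c) * (h v)\<^sup>2)"
    by (intro sum.cong refl) (simp add: sum_corr[OF F h] c_def power2_eq_square)
  also have "\<dots> = ((p - 1) * (1 + 1 / p) * c) * norm2 h" by (simp add: norm2_def sum_distrib_left)
  also have "\<dots> \<le> (p\<^sup>2 * norm2 F) * norm2 h"
  proof (intro mult_right_mono)
    have c0: "0 \<le> c" by (auto simp: c_def corr_def intro: sum_nonneg)
    have "(real_of_int p - 1) * (1 + 1 / p) * c \<le> real_of_int p * c"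
      using p_gt_1 c0 by (intro mult_right_mono) (auto simp: field_simps)
    also have "\<dots> \<le> p * (p * norm2 F)" using corr_e1_le p_gt_1 by (intro mult_left_mono) (auto simp: c_def)
    finally show "(p - 1) * (1 + 1 / p) * c \<le> p\<^sup>2 * norm2 F" by (simp add: power2_eq_square)
  qed simp
  finally have 2: "(\<Sum>g\<in>SL. (B g)\<^sup>2) \<le> (p\<^sup>2 * norm2 F) * norm2 h" .
  have "(norm2 h)\<^sup>2 \<le> SL.energy \<mu> * (\<Sum>g\<in>SL. (B g)\<^sup>2)"
    unfolding 1 SL.energy_def by (rule Cauchy_Schwarz_ineq_sum)
  also have "\<dots> \<le> SL.energy \<mu> * ((p\<^sup>2 * norm2 F) * norm2 h)"
    using 2 by (intro mult_left_mono) (auto simp: SL.energy_def intro: sum_nonneg)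
  finally have 3: "norm2 h * norm2 h \<le> norm2 h * (SL.energy \<mu> * p\<^sup>2 * norm2 F)" by (simp add: power2_eq_square mult_ac)
  show ?thesis
  proof (cases "norm2 h = 0")
    case True
    then show ?thesis by (auto simp: h_def SL.energy_def intro!: mult_nonneg_nonneg sum_nonneg)
  next
    case False
    then have "norm2 h > 0" using norm2_nonneg[of h] by linarith
    then show ?thesis using 3 by (simp add: h_def)
  qed
qed

text \<open>For a self-adjoint T, |T F|^2 = <F, T^2 F> <= |F| |T^2 F|. Each application doubles the
  number of steps, so flatness of a long walk controls a single step.\<close>

lemma norm2_Op_power:
  assumes sym: "\<And>x. x \<in> SL \<Longrightarrow> \<mu> (inverse x) = \<mu> x"
  shows "norm2 (Op \<mu> F) ^ 2 ^ k \<le> norm2 (Op (SL.convpow \<mu> k) F) * norm2 F ^ (2 ^ k - 1)"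
proof (induction k)
  case (Suc k)
  let ?T = "Op (SL.convpow \<mu> k)"
  have sq: "(norm2 (?T F))\<^sup>2 \<le> norm2 (Op (SL.convpow \<mu> (Suc k)) F) * norm2 F"
  proof -
    have "norm2 (?T F) = (\<Sum>v\<in>nz. ?T F v * ?T F v)" by (simp add: norm2_def power2_eq_square)
    also have "\<dots> = (\<Sum>v\<in>nz. F v * ?T (?T F) v)"
      by (rule Op_self_adjoint, rule SL.sym_convpow) (use sym in auto)
    also have "\<dots> = (\<Sum>v\<in>nz. Op (SL.convpow \<mu> (Suc k)) F v * F v)" by (simp add: Op_conv mult.commute)
    finally show ?thesis
      using Cauchy_Schwarz_ineq_sum[of "Op (SL.convpow \<mu> (Suc k)) F" F nz] by (simp add: norm2_def)
  qed
  have "norm2 (Op \<mu> F) ^ 2 ^ Suc k = (norm2 (Op \<mu> F) ^ 2 ^ k)\<^sup>2" by (simp add: mult.commute flip: power_mult)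
  also have "\<dots> \<le> (norm2 (?T F) * norm2 F ^ (2 ^ k - 1))\<^sup>2" using Suc by (intro power_mono) auto
  also have "\<dots> = (norm2 (?T F))\<^sup>2 * norm2 F ^ (2 * (2 ^ k - 1))" by (simp add: power_mult_distrib mult.commute flip: power_mult)
  also have "\<dots> \<le> (norm2 (Op (SL.convpow \<mu> (Suc k)) F) * norm2 F) * norm2 F ^ (2 * (2 ^ k - 1))"
    using sq by (intro mult_right_mono) auto
  also have "\<dots> = norm2 (Op (SL.convpow \<mu> (Suc k)) F) * norm2 F ^ Suc (2 * (2 ^ k - 1))" by simp
  also have "Suc (2 * (2 ^ k - 1)) = 2 ^ Suc k - 1"
    using one_le_power[of "2::nat" k] by (simp only: power_Suc) arith
  finally show ?case .
qed simp

end

section \<open>The random walk attached to $\rho$ and $B$\<close>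

context sl2
begin

lemma GL_mult: "g \<in> GL \<Longrightarrow> h \<in> GL \<Longrightarrow> g * h \<in> GL"
proof -
  assume "g \<in> GL" "h \<in> GL"
  then obtain a b c d a' b' c' d' where g: "g = lin a b c d" "\<not> p dvd a * d - b * c" and h: "h = lin a' b' c' d'" "\<not> p dvd a' * d' - b' * c'"
    by (auto simp: GL_def)
  have "(a * a' + b * c') * (c * b' + d * d') - (a * b' + b * d') * (c * a' + d * c') = (a * d - b * c) * (a' * d' - b' * c')"
    by (simp add: algebra_simps)
  then have "\<not> p dvd (a * a' + b * c') * (c * b' + d * d') - (a * b' + b * d') * (c * a' + d * c')"
    using g h by (simp add: dvd_mult_iff)
  then show ?thesis unfolding g(1) h(1) lin_mult[OF g(2) h(2)] GL_def by blast
qed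

lemma upper_GL [simp]: "upper b \<in> GL" by (simp add: SL_GL)

lemma upper_apply_cancel [simp]: "upper b \<langle>$\<rangle> (upper (- b) \<langle>$\<rangle> v) = v"
  unfolding apply_sequence upper_mult by (simp add: upper_0)

lemma upper_mult_cancel [simp]: "upper b * (upper (- b) * x) = x" "upper (- b) * (upper b * x) = x"
  by (simp_all add: upper_mult upper_0 flip: mult.assoc)

lemma borel_mult: "x \<in> borel \<Longrightarrow> y \<in> borel \<Longrightarrow> x * y \<in> borel"
  and borel_inverse: "x \<in> borel \<Longrightarrow> inverse x \<in> borel"
  and upper_borel: "upper b \<in> borel"
proof -
  show up: "upper b \<in> borel" for b
  proof -
    have "[1 * 1 = 1] (mod p)" by simp
    then show ?thesis unfolding borel_def upper_def by blast
  qed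
  then have one: "1 \<in> borel" using upper_0 by metis
  show inv: "inverse x \<in> borel" if "x \<in> borel" for x using borel_quotient[OF one that] by simp
  show "x * y \<in> borel" if "x \<in> borel" "y \<in> borel" for x y using borel_quotient[OF that(1) inv[OF that(2)]] by simp
qed

lemma card_nz: "real (card nz) = real_of_int p ^ 2 - 1"
proof -
  have "(0, 0) \<in> vecs" using p_gt_1 by (simp add: vecs_def)
  moreover have "card vecs = nat p * nat p" by (simp add: vecs_def card_cartesian_product)
  ultimately have "card nz = nat p * nat p - 1" by (simp add: nz_def card_Diff_singleton)
  moreover have "1 \<le> nat p * nat p" using p_gt_1 by (simp add: Suc_le_eq)
  ultimately show ?thesis using p_gt_1 by (simp add: of_nat_diff power2_eq_square)
qed

end

locale hyperbola = sl2 +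
  fixes \<rho> :: int and B :: "int set"
  assumes \<rho>: "\<not> p dvd \<rho>" and B: "B \<subseteq> {0..<p}" "B \<noteq> {}"
begin

lemma finite_B [simp]: "finite B" using B(1) by (rule finite_subset) simp

lemma card_B_pos: "card B > 0" using B by (simp add: card_gt_0_iff)

lemma card_B_le: "real (card B) \<le> p"
proof -
  have "card B \<le> nat p" using card_mono[OF _ B(1)] by simp
  then show ?thesis using p_gt_1 by linarith
qed

lemma B_eqI: "b \<in> B \<Longrightarrow> b' \<in> B \<Longrightarrow> p dvd b - b' \<Longrightarrow> b = b'"
  using residues_eq_iff_dvd B(1) by (metis subsetD)

definition J :: "(int \<times> int) perm" where
  "J = lin 0 \<rho> 1 0"

lemma det_J: "\<not> p dvd 0 * 0 - \<rho> * 1" using \<rho> by simp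

lemma J_GL [simp]: "J \<in> GL" unfolding J_def GL_def using det_J by blast

text \<open>The action of \<open>gen (b\<^sub>1, b\<^sub>2)\<close> on the projective line is \<open>z \<mapsto> b\<^sub>2 + \<rho> / (z - b\<^sub>1)\<close>.\<close>

definition gen :: "int \<times> int \<Rightarrow> (int \<times> int) perm" where
  "gen e = upper (snd e) * J * upper (- fst e)"

text \<open>The determinants cancel in the quotient, and exchanging the two pairs inverts it; so a
  random word follows a symmetric law on \<open>SL\<close>.\<close>

definition word :: "(int \<times> int) \<times> (int \<times> int) \<Rightarrow> (int \<times> int) perm" where
  "word e = gen (snd e) * inverse (gen (fst e))"

lemma gen_GL [simp]: "gen e \<in> GL" by (simp add: gen_def GL_mult)

lemma word_swap: "word (prod.swap e) = inverse (word e)" by (simp add: word_def)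

definition lower :: "int \<Rightarrow> (int \<times> int) perm" where
  "lower c = J * upper c * inverse J"

text \<open>The two inner translations merge, so \<open>b1\<close> occurs only in the middle factor
  and \<open>b2\<close> only in the last one. Varying \<open>b1\<close> moves the word across cosets
  of the Borel subgroup; varying \<open>b2\<close> moves it by unipotents on the right.\<close>

lemma word_eq: "word ((b1, b2), (b3, b4)) = upper b4 * lower (b1 - b3) * upper (- b2)"
proof -
  have "upper (- b3) * upper b1 = upper (b1 - b3)" by (simp add: upper_mult)
  then have *: "upper (- b3) * (upper b1 * x) = upper (b1 - b3) * x" for x by (simp flip: mult.assoc)
  show ?thesis by (simp add: word_def gen_def lower_def upper_inverse mult.assoc *)
qed

text \<open>\<open>J\<close> exchanges the two coordinate axes, so conjugation by it makes upper
  unipotents lower; the factor \<open>r\<close> is the inverse of \<open>\<rho>\<close> modulo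
  \<open>p\<close>.\<close>

lemma lower_lin: obtains r where "\<not> p dvd r" "\<And>c. lower c = lin 1 0 (r * c) 1"
proof -
  have "coprime \<rho> p" using prime_p \<rho> by (metis coprime_commute prime_imp_coprime_int)
  then obtain r where r: "[\<rho> * r = 1] (mod p)" using cong_solve_coprime_int by blast
  have "lower c = lin 1 0 (r * c) 1" for c
  proof -
    have "J * upper c = lin 0 \<rho> 1 c"
      unfolding J_def upper_def using lin_mult[OF det_J, of 1 1 c 0] by simp
    moreover have "lin 1 0 (r * c) 1 * J = lin 0 \<rho> 1 (r * c * \<rho>)"
      unfolding J_def using lin_mult[OF _ det_J, of 1 1 0 "r * c"] by simp
    moreover have "[c = r * c * \<rho>] (mod p)"
      using cong_mult[OF r cong_refl[of c]] by (simp add: cong_sym mult_ac)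
    then have "lin 0 \<rho> 1 c = lin 0 \<rho> 1 (r * c * \<rho>)" by (subst lin_eq_iff) (use \<rho> in auto)
    ultimately show ?thesis unfolding lower_def by (simp add: mgroup_solve)
  qed
  moreover have "\<not> p dvd r"
  proof
    assume "p dvd r"
    then have "p dvd 1" using r by (metis cong_dvd_iff dvd_mult)
    then show False by simp
  qed
  ultimately show ?thesis using that by blast
qed

lemma lower_SL [simp]: "lower c \<in> SL"
proof -
  obtain r where "lower c = lin 1 0 (r * c) 1" using lower_lin by metis
  then show ?thesis by (simp add: SL_I)
qed

lemma lower_borel: "lower c \<in> borel \<Longrightarrow> p dvd c"
proof -
  obtain r where r: "\<not> p dvd r" "lower c = lin 1 0 (r * c) 1" using lower_lin by metis
  assume "lower c \<in> borel"
  then have "p dvd r * c" unfolding r(2) by (subst (asm) borel_iff) auto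
  then show ?thesis using r(1) by (simp add: dvd_mult_iff)
qed

lemma lower_mult: "inverse (lower c) * lower c' = lower (c' - c)"
proof -
  have "upper (- c) * (upper c' * x) = upper (c' - c) * x" for x by (simp add: upper_mult flip: mult.assoc)
  then show ?thesis by (simp add: lower_def upper_inverse mult.assoc)
qed

lemma word_SL [simp]: "word e \<in> SL"
proof -
  obtain b1 b2 b3 b4 where "e = ((b1, b2), (b3, b4))" by (metis prod.collapse)
  then show ?thesis by (simp add: word_eq)
qed

definition B4 :: "((int \<times> int) \<times> (int \<times> int)) set" where
  "B4 = (B \<times> B) \<times> (B \<times> B)"

lemma finite_B4 [simp]: "finite B4" by (simp add: B4_def)

lemma card_B4: "card B4 = card B ^ 4" by (simp add: B4_def card_cartesian_product power4_eq_xxxx)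

definition \<mu> :: "(int \<times> int) perm \<Rightarrow> real" where
  "\<mu> g = card {e \<in> B4. word e = g} / card B ^ 4"

lemma sum_\<mu>: "(\<Sum>g\<in>SL. \<mu> g * f g) = (\<Sum>e\<in>B4. f (word e)) / card B ^ 4"
proof -
  have "(\<Sum>e\<in>B4. f (word e)) = (\<Sum>g\<in>SL. \<Sum>e\<in>{e \<in> B4. word e = g}. f (word e))"
    by (rule sum.group[symmetric]) (auto simp: finite_SL)
  also have "\<dots> = (\<Sum>g\<in>SL. card {e \<in> B4. word e = g} * f g)" by simp
  finally show ?thesis by (simp add: \<mu>_def sum_divide_distrib)
qed

lemma prob_\<mu>: "SL.prob \<mu>"
  using sum_\<mu>[of "\<lambda>_. 1"] B(2) by (simp add: SL.prob_def \<mu>_def card_B4)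

lemma sym_\<mu>: "\<mu> (inverse g) = \<mu> g"
proof -
  have swap: "prod.swap e \<in> B4" if "e \<in> B4" for e using that by (auto simp: B4_def)
  have "bij_betw prod.swap {e \<in> B4. word e = inverse g} {e \<in> B4. word e = g}"
    by (rule bij_betwI[where g = prod.swap])
      (auto simp: swap word_swap)
  then show ?thesis by (simp add: \<mu>_def bij_betw_same_card)
qed

lemma mass_\<mu>:
  assumes "S \<subseteq> SL" "g \<in> SL"
  shows "(\<Sum>s\<in>S. \<mu> (g * s)) = card {e \<in> B4. inverse g * word e \<in> S} / card B ^ 4"
proof -
  have fin: "finite S" using assms finite_SL by (auto intro: finite_subset)
  have "card {e \<in> B4. inverse g * word e \<in> S} = (\<Sum>s\<in>S. card {e \<in> {e \<in> B4. inverse g * word e \<in> S}. inverse g * word e = s})"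
    using sum.group[of "{e \<in> B4. inverse g * word e \<in> S}" S "\<lambda>e. inverse g * word e" "\<lambda>_. 1::nat"] fin by (auto simp: image_subset_iff)
  also have "\<dots> = (\<Sum>s\<in>S. card {e \<in> B4. word e = g * s})"
    by (intro sum.cong refl arg_cong[of _ _ card]) (auto simp: mgroup_solve)
  finally show ?thesis by (simp add: \<mu>_def sum_divide_distrib)
qed

text \<open>With the other letters fixed, two words in one coset of the Borel subgroup have as
  quotient a conjugate of \<open>lower (b1' - b1)\<close> by an upper unipotent. It fixes infinity
  only if the two values of \<open>b1\<close> agree.\<close>

lemma card_word_borel_le:
  assumes "g \<in> SL"
  shows "card {e \<in> B4. inverse g * word e \<in> borel} \<le> card B ^ 3"
proof -
  have "card {e \<in> B4. inverse g * word e \<in> borel} \<le> card (B \<times> B \<times> B)"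
  proof (rule card_inj_on_le[where f = "\<lambda>e. (snd (fst e), snd e)"])
    show "inj_on (\<lambda>e. (snd (fst e), snd e)) {e \<in> B4. inverse g * word e \<in> borel}"
    proof (rule inj_onI)
      fix e e' assume e: "e \<in> {e \<in> B4. inverse g * word e \<in> borel}" "e' \<in> {e \<in> B4. inverse g * word e \<in> borel}"
        and eq: "(snd (fst e), snd e) = (snd (fst e'), snd e')"
      obtain b1 b2 b3 b4 where 1: "e = ((b1, b2), (b3, b4))" "b1 \<in> B" using e(1) by (auto simp: B4_def)
      obtain b1' where 2: "e' = ((b1', b2), (b3, b4))" "b1' \<in> B" using e(2) eq 1 by (cases e') (auto simp: B4_def)
      have "inverse g * word e \<in> borel" "inverse g * word e' \<in> borel" using e by auto
      then have "inverse (inverse g * word e) * (inverse g * word e') \<in> borel"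
        by (rule borel_mult[OF borel_inverse])
      also have "inverse (inverse g * word e) * (inverse g * word e') = upper b2 * (inverse (lower (b1 - b3)) * lower (b1' - b3)) * upper (- b2)"
        by (simp add: 1 2 word_eq mult.assoc upper_inverse)
      also have "\<dots> = upper b2 * lower (b1' - b1) * upper (- b2)" by (simp add: lower_mult)
      finally have y: "upper b2 * lower (b1' - b1) * upper (- b2) \<in> borel" .
      have "upper (- b2) * (upper b2 * lower (b1' - b1) * upper (- b2)) * upper b2 \<in> borel"
        by (rule borel_mult[OF borel_mult[OF upper_borel y] upper_borel])
      also have "upper (- b2) * (upper b2 * lower (b1' - b1) * upper (- b2)) * upper b2 = lower (b1' - b1)"
        by (simp add: mult.assoc upper_mult upper_0)
      finally have "b1' = b1" using lower_borel B_eqI 1 2 by blast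
      then show "e = e'" using 1 2 by simp
    qed
    show "(\<lambda>e. (snd (fst e), snd e)) ` {e \<in> B4. inverse g * word e \<in> borel} \<subseteq> B \<times> B \<times> B"
      by (auto simp: B4_def)
  qed simp
  then show ?thesis by (simp add: card_cartesian_product power3_eq_cube)
qed

text \<open>Two words in g S that differ only in \<open>b2\<close> have a quotient that is unipotent
  and lies in \<open>S ^ 2\<close>. So some choice of the other three letters turns a large mass of
  g S into many unipotents.\<close>

lemma card_unipotents_ge:
  assumes S: "S \<subseteq> SL" "\<And>s. s \<in> S \<Longrightarrow> inverse s \<in> S" and g: "g \<in> SL"
  shows "card {e \<in> B4. inverse g * word e \<in> S} \<le> card (S ^ 2 \<inter> unipotents) * card B ^ 3"
proof -
  have finS: "finite S" using S finite_SL by (auto intro: finite_subset)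
  have "card {e \<in> B4. inverse g * word e \<in> S} \<le> card (S ^ 2 \<inter> unipotents) * card (B \<times> B \<times> B)"
  proof (rule card_mult_le_fibres[where f = "\<lambda>e. (fst (fst e), snd e)"])
    show "(\<lambda>e. (fst (fst e), snd e)) ` {e \<in> B4. inverse g * word e \<in> S} \<subseteq> B \<times> B \<times> B"
      by (auto simp: B4_def)
    fix y
    let ?F = "{x \<in> {e \<in> B4. inverse g * word e \<in> S}. (fst (fst x), snd x) = y}"
    show "card ?F \<le> card (S ^ 2 \<inter> unipotents)"
    proof (cases "?F = {}")
      case False
      then obtain e0 where e0: "e0 \<in> ?F" by blast
      obtain b1 b0 b3 b4 where 0: "e0 = ((b1, b0), (b3, b4))" by (metis prod.collapse)
      have shape: "\<exists>b2. x = ((b1, b2), (b3, b4)) \<and> b2 \<in> B" if "x \<in> ?F" for x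
        using that e0 0 by (cases x) (auto simp: B4_def)
      show ?thesis
      proof (rule card_inj_on_le[where f = "\<lambda>x. upper (b0 - snd (fst x))"])
        show "inj_on (\<lambda>x. upper (b0 - snd (fst x))) ?F"
        proof (rule inj_onI)
          fix x x' assume x: "x \<in> ?F" "x' \<in> ?F" "upper (b0 - snd (fst x)) = upper (b0 - snd (fst x'))"
          obtain b2 b2' where b: "x = ((b1, b2), (b3, b4))" "b2 \<in> B" "x' = ((b1, b2'), (b3, b4))" "b2' \<in> B"
            using shape[OF x(1)] shape[OF x(2)] by blast
          have "p dvd (b0 - b2) - (b0 - b2')" using x(3) b by (simp add: upper_eq_iff cong_iff_dvd_diff)
          then have "b2' = b2" using B_eqI[of b2' b2] b by simp
          then show "x = x'" using b by simp
        qed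
        show "(\<lambda>x. upper (b0 - snd (fst x))) ` ?F \<subseteq> S ^ 2 \<inter> unipotents"
        proof (rule image_subsetI)
          fix x assume x: "x \<in> ?F"
          obtain b2 where b: "x = ((b1, b2), (b3, b4))" using shape[OF x] by blast
          have "inverse (inverse g * word e0) \<in> S" "inverse g * word x \<in> S" using x e0 S(2) by blast+
          then have "inverse (inverse g * word e0) * (inverse g * word x) \<in> S * S" by (rule set_times_intro)
          also have "inverse (inverse g * word e0) * (inverse g * word x) = upper b0 * upper (- b2)"
            by (simp add: 0 b word_eq mult.assoc upper_inverse)
          finally show "upper (b0 - snd (fst x)) \<in> S ^ 2 \<inter> unipotents"
            by (simp add: b upper_mult power2_eq_square unipotents_def)
        qed
      qed (use finS in simp)
    qed (simp only: card.empty)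
  qed auto
  then show ?thesis by (simp add: card_cartesian_product power3_eq_cube)
qed

text \<open>Here the exponent 200000 is needed. Mass L^-300 makes |B| at most L^300 times the number
  of unipotents in \<open>S ^ 2\<close>, and \<open>product_growth\<close> with K = L^22500 asks for
  more than 128 L^157500 of them, which follows from |B| > L^157807. Excluding that \<open>S\<close>
  lies in the Borel subgroup takes only |B| > L^300.\<close>

lemma growth:
  fixes L :: real
  assumes L: "L \<ge> 2" "L ^ 200000 \<le> card B"
    and S: "S \<subseteq> SL" "1 \<in> S" "\<And>s. s \<in> S \<Longrightarrow> inverse s \<in> S" and g: "g \<in> SL"
    and small: "real (card (S ^ 45)) \<le> L ^ 22500 * card S" and mass: "(\<Sum>s\<in>S. \<mu> (g * s)) \<ge> 1 / L ^ 300"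
  shows "real_of_int p ^ 3 / (16 * (L ^ 22500) ^ 4) \<le> card S"
proof -
  define b where "b = real (card B)"
  have b0: "b > 0" using card_B_pos by (simp add: b_def)
  define c where "c = real (card {e \<in> B4. inverse g * word e \<in> S})"
  have "1 / L ^ 300 \<le> c / b ^ 4" using mass mass_\<mu>[OF S(1) g] by (simp add: b_def c_def)
  then have c: "b ^ 4 \<le> L ^ 300 * c" using b0 L by (simp add: field_simps)
  have Lpow: "L ^ i < L ^ j" if "i < j" for i j using that L by (intro power_strict_increasing) auto
  have Lb: "L ^ 200000 \<le> b" using L by (simp add: b_def)
  have b4: "b ^ 4 = b * b ^ 3" by (simp add: power4_eq_xxxx power3_eq_cube)
  have "\<not> S \<subseteq> borel"
  proof
    assume "S \<subseteq> borel"
    then have "card {e \<in> B4. inverse g * word e \<in> S} \<le> card {e \<in> B4. inverse g * word e \<in> borel}"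
      by (intro card_mono) auto
    also have "\<dots> \<le> card B ^ 3" by (rule card_word_borel_le[OF g])
    finally have "real (card {e \<in> B4. inverse g * word e \<in> S}) \<le> real (card B ^ 3)" by (simp only: of_nat_le_iff)
    then have "c \<le> b ^ 3" by (simp add: b_def c_def)
    then have "L ^ 300 * c \<le> L ^ 300 * b ^ 3" using L by (intro mult_left_mono) auto
    with c b4 have "b * b ^ 3 \<le> L ^ 300 * b ^ 3" by simp
    then have "b \<le> L ^ 300" using b0 by simp
    then show False using Lb Lpow[of 300 200000] by simp
  qed
  then obtain h where h: "h \<in> S" "h \<notin> borel" by blast
  have L1: "L ^ 22500 \<ge> 1" using L by simp
  interpret sl2_approximate_group p S "L ^ 22500"
    by unfold_locales (use S small L1 in auto)
  have "real (card {e \<in> B4. inverse g * word e \<in> S}) \<le> real (card (S ^ 2 \<inter> unipotents) * card B ^ 3)"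
    using card_unipotents_ge[OF S(1,3) g] by (simp only: of_nat_le_iff)
  then have "c \<le> card (S ^ 2 \<inter> unipotents) * b ^ 3" by (simp add: b_def c_def)
  then have "L ^ 300 * c \<le> L ^ 300 * (card (S ^ 2 \<inter> unipotents) * b ^ 3)" using L by (intro mult_left_mono) auto
  with c b4 have "b * b ^ 3 \<le> (L ^ 300 * card (S ^ 2 \<inter> unipotents)) * b ^ 3" by simp
  then have q: "b \<le> L ^ 300 * card (S ^ 2 \<inter> unipotents)" using b0 by simp
  have "128 * (L ^ 22500) ^ 7 \<le> L ^ 7 * L ^ 157500"
    using power_mono[OF L(1), of 7] L by (intro mult_mono) (auto simp flip: power_mult)
  also have "\<dots> = L ^ 157507" by (simp flip: power_add)
  also have "\<dots> < card (S ^ 2 \<inter> unipotents)"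
  proof (rule ccontr)
    assume "\<not> ?thesis"
    then have "L ^ 300 * card (S ^ 2 \<inter> unipotents) \<le> L ^ 300 * L ^ 157507" using L by (intro mult_left_mono) auto
    also have "\<dots> = L ^ 157807" by (simp flip: power_add)
    finally show False using q Lb Lpow[of 157807 200000] by linarith
  qed
  finally have "real (card (S ^ 2 \<inter> unipotents)) > 128 * (L ^ 22500) ^ 7" .
  then show ?thesis by (rule product_growth[OF h])
qed

text \<open>The growth alternative contributes 16 L^90250 / p^3, where 90250 = 250 + 4 * 22500. As
  L^200000 <= |B| <= p, this is at most p^(-5/2), so a power of p is left after paying for the
  factor \<open>p\<^sup>2\<close> of \<open>norm2_Op_le\<close>.\<close>

lemma energy_le:
  fixes L :: real
  assumes L: "L \<ge> 2" "L ^ 200000 \<le> card B" and J: "real_of_int p ^ 3 \<le> L ^ n"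
  shows "SL.energy (SL.convpow \<mu> (2 * n)) * p\<^sup>2 \<le> real_of_int p powr (- 1 / 2)"
proof -
  define P where "P = real_of_int p"
  have P: "P > 1" using p_gt_1 by (simp add: P_def)
  define M where "M = P ^ 3 / (16 * (L ^ 22500) ^ 4)"
  have M: "M > 0" using P L by (simp add: M_def)
  have "SL.energy (SL.convpow \<mu> (2 * n)) \<le> max (1 / L ^ n) (L ^ 250 / M)"
    by (rule SL.energy_convpow_decay[OF prob_\<mu> L(1) M]) (unfold M_def P_def, rule growth[OF L], auto)
  also have "\<dots> \<le> sqrt P / P ^ 3"
  proof (rule max.boundedI)
    have "1 / L ^ n \<le> 1 / P ^ 3" using J P L by (intro divide_left_mono) (auto simp: P_def)
    also have "\<dots> \<le> sqrt P / P ^ 3" using P by (intro divide_right_mono) auto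
    finally show "1 / L ^ n \<le> sqrt P / P ^ 3" .
    have "(L ^ 100000)\<^sup>2 = L ^ 200000" by (simp flip: power_mult)
    also have "\<dots> \<le> P" using L(2) card_B_le by (simp add: P_def)
    finally have sq: "L ^ 100000 \<le> sqrt P" by (rule real_le_rsqrt)
    have "L ^ 250 / M = 16 * L ^ 90250 / P ^ 3"
    proof -
      have "L ^ 250 / M = 16 * (L ^ 250 * (L ^ 22500) ^ 4) / P ^ 3" by (simp add: M_def)
      also have "L ^ 250 * (L ^ 22500) ^ 4 = L ^ 90250" by (simp flip: power_mult power_add)
      finally show ?thesis .
    qed
    also have "\<dots> \<le> (L ^ 4 * L ^ 90250) / P ^ 3"
      using power_mono[OF L(1), of 4] L P by (intro divide_right_mono mult_right_mono) auto
    also have "\<dots> = L ^ 90254 / P ^ 3" by (simp flip: power_add)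
    also have "\<dots> \<le> L ^ 100000 / P ^ 3" using L P by (intro divide_right_mono power_increasing) auto
    also have "\<dots> \<le> sqrt P / P ^ 3" using sq P by (intro divide_right_mono) auto
    finally show "L ^ 250 / M \<le> sqrt P / P ^ 3" .
  qed
  finally have "SL.energy (SL.convpow \<mu> (2 * n)) * P\<^sup>2 \<le> sqrt P / P ^ 3 * P\<^sup>2" by (intro mult_right_mono) auto
  also have "\<dots> = sqrt P / P" using P by (simp add: power3_eq_cube power2_eq_square)
  also have "\<dots> = 1 / sqrt P" using P by (simp add: divide_eq_eq eq_divide_eq)
  also have "\<dots> = P powr (- (1 / 2))" using P by (simp only: powr_minus_divide powr_half_sqrt)
  finally show ?thesis by (simp add: P_def)
qed

text \<open>With 2 n doublings the saving p^(-1/2) belongs to the power 4^n of the operator, and one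
  step receives its root of that order.\<close>

lemma norm2_Op_\<mu>_le:
  fixes L :: real
  assumes L: "L \<ge> 2" "L ^ 200000 \<le> card B" and J: "real_of_int p ^ 3 \<le> L ^ n"
    and F: "homogeneous F" "(\<Sum>v\<in>nz. F v) = 0"
  shows "norm2 (Op \<mu> F) \<le> real_of_int p powr (- 1 / (2 * 4 ^ n)) * norm2 F"
proof -
  define P where "P = real_of_int p"
  have P: "P > 1" using p_gt_1 by (simp add: P_def)
  define m where "m = (2::nat) ^ (2 * n)"
  have m: "m > 0" "real m = 4 ^ n" by (simp_all add: m_def power_mult)
  define T where "T = Op (SL.convpow \<mu> (2 * n)) F"
  have "norm2 (Op \<mu> F) ^ m \<le> norm2 T * norm2 F ^ (m - 1)"
    unfolding m_def T_def by (rule norm2_Op_power) (rule sym_\<mu>)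
  also have "\<dots> \<le> (P powr (- 1 / 2) * norm2 F) * norm2 F ^ (m - 1)"
  proof (intro mult_right_mono)
    have "norm2 T \<le> (SL.energy (SL.convpow \<mu> (2 * n)) * p\<^sup>2) * norm2 F"
      unfolding T_def using norm2_Op_le[OF F] by simp
    also have "\<dots> \<le> P powr (- 1 / 2) * norm2 F"
      using energy_le[OF L J] unfolding P_def by (intro mult_right_mono) auto
    finally show "norm2 T \<le> P powr (- 1 / 2) * norm2 F" .
  qed simp
  also have "\<dots> = P powr (- 1 / 2) * norm2 F ^ m"
    using m(1) by (metis (no_types, lifting) mult.assoc power_minus_mult mult.commute)
  also have "P powr (- 1 / 2) = (P powr (- 1 / (2 * real m))) ^ m"
    using P m by (simp add: powr_power)
  finally have "norm2 (Op \<mu> F) ^ m \<le> (P powr (- 1 / (2 * real m)) * norm2 F) ^ m" by (simp add: power_mult_distrib)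
  then show ?thesis using m by (subst (asm) power_mono_iff) (auto simp: P_def)
qed

lemma gen_apply: "gen e \<langle>$\<rangle> v = upper (snd e) \<langle>$\<rangle> (J \<langle>$\<rangle> (upper (- fst e) \<langle>$\<rangle> v))"
  by (simp add: gen_def apply_times)

text \<open>The square norm of the sum of \<open>F\<close> over all Moebius maps expands into a
  quadratic form in words, governed by \<open>\<mu>\<close>. Each of the two applications of
  Cauchy-Schwarz halves the exponent, which takes 1/2 over 4^n to 1/8 over 4^n.\<close>

lemma correlation_le:
  fixes L :: real
  assumes L: "L \<ge> 2" "L ^ 200000 \<le> card B" and J: "real_of_int p ^ 3 \<le> L ^ n"
    and F: "homogeneous F" "(\<Sum>v\<in>nz. F v) = 0"
  shows "(\<Sum>e\<in>B \<times> B. \<Sum>v\<in>nz. F (upper (fst e) \<langle>$\<rangle> v) * F (upper (snd e) \<langle>$\<rangle> (J \<langle>$\<rangle> v)))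
    \<le> (card B)\<^sup>2 * real_of_int p powr (- 1 / (8 * 4 ^ n)) * norm2 F"
proof -
  define X where "X = (\<Sum>e\<in>B \<times> B. \<Sum>v\<in>nz. F (upper (fst e) \<langle>$\<rangle> v) * F (upper (snd e) \<langle>$\<rangle> (J \<langle>$\<rangle> v)))"
  define h where "h v = (\<Sum>e\<in>B \<times> B. F (gen e \<langle>$\<rangle> v))" for v
  define P where "P = real_of_int p"
  have P: "P > 1" using p_gt_1 by (simp add: P_def)
  define b where "b = real (card B)"
  have "X = (\<Sum>e\<in>B \<times> B. \<Sum>v\<in>nz. F v * F (gen e \<langle>$\<rangle> v))"
    unfolding X_def
  proof (rule sum.cong[OF refl])
    fix e
    show "(\<Sum>v\<in>nz. F (upper (fst e) \<langle>$\<rangle> v) * F (upper (snd e) \<langle>$\<rangle> (J \<langle>$\<rangle> v))) = (\<Sum>v\<in>nz. F v * F (gen e \<langle>$\<rangle> v))"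
      using sum_GL[OF upper_GL, of "\<lambda>v. F (upper (fst e) \<langle>$\<rangle> v) * F (upper (snd e) \<langle>$\<rangle> (J \<langle>$\<rangle> v))" "- fst e"]
      by (simp add: gen_apply)
  qed
  also have "\<dots> = (\<Sum>v\<in>nz. \<Sum>e\<in>B \<times> B. F v * F (gen e \<langle>$\<rangle> v))" by (rule sum.swap)
  also have "\<dots> = (\<Sum>v\<in>nz. F v * h v)" by (simp add: h_def sum_distrib_left)
  finally have X: "X\<^sup>2 \<le> norm2 F * norm2 h"
    unfolding norm2_def by (simp add: Cauchy_Schwarz_ineq_sum)
  have "norm2 h = (\<Sum>v\<in>nz. \<Sum>e\<in>B4. F (gen (fst e) \<langle>$\<rangle> v) * F (gen (snd e) \<langle>$\<rangle> v))"
    by (simp add: norm2_def h_def power2_eq_square sum_product sum.cartesian_product B4_def case_prod_beta)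
  also have "\<dots> = (\<Sum>e\<in>B4. \<Sum>v\<in>nz. F (gen (fst e) \<langle>$\<rangle> v) * F (gen (snd e) \<langle>$\<rangle> v))" by (rule sum.swap)
  also have "\<dots> = (\<Sum>e\<in>B4. \<Sum>v\<in>nz. F (word e \<langle>$\<rangle> v) * F v)"
  proof (rule sum.cong[OF refl])
    fix e
    have "word e \<langle>$\<rangle> (gen (fst e) \<langle>$\<rangle> v) = gen (snd e) \<langle>$\<rangle> v" for v
      by (simp add: apply_sequence word_def mult.assoc)
    then show "(\<Sum>v\<in>nz. F (gen (fst e) \<langle>$\<rangle> v) * F (gen (snd e) \<langle>$\<rangle> v)) = (\<Sum>v\<in>nz. F (word e \<langle>$\<rangle> v) * F v)"
      using sum_GL[OF gen_GL, of "\<lambda>v. F (word e \<langle>$\<rangle> v) * F v" "fst e"] by (simp add: mult.commute)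
  qed
  also have "\<dots> = b ^ 4 * (\<Sum>g\<in>SL. \<mu> g * (\<Sum>v\<in>nz. F (g \<langle>$\<rangle> v) * F v))"
    unfolding sum_\<mu> using B(2) by (simp add: b_def)
  also have "\<dots> = b ^ 4 * (\<Sum>v\<in>nz. Op \<mu> F v * F v)" by (simp add: sum_Op_mult)
  finally have h: "norm2 h = b ^ 4 * (\<Sum>v\<in>nz. Op \<mu> F v * F v)" .
  have "(\<Sum>v\<in>nz. Op \<mu> F v * F v)\<^sup>2 \<le> norm2 (Op \<mu> F) * norm2 F"
    unfolding norm2_def by (rule Cauchy_Schwarz_ineq_sum)
  also have "\<dots> \<le> (P powr (- 1 / (2 * 4 ^ n)) * norm2 F) * norm2 F"
    using norm2_Op_\<mu>_le[OF L J F] unfolding P_def by (intro mult_right_mono) auto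
  also have "\<dots> = (P powr (- 1 / (4 * 4 ^ n)) * norm2 F)\<^sup>2"
    using P by (simp add: power2_eq_square flip: powr_add)
  finally have "(\<Sum>v\<in>nz. Op \<mu> F v * F v) \<le> P powr (- 1 / (4 * 4 ^ n)) * norm2 F"
    by (rule power2_le_imp_le) simp
  then have "norm2 h \<le> b ^ 4 * (P powr (- 1 / (4 * 4 ^ n)) * norm2 F)"
    unfolding h by (intro mult_left_mono) (auto simp: b_def)
  then have "X\<^sup>2 \<le> norm2 F * (b ^ 4 * (P powr (- 1 / (4 * 4 ^ n)) * norm2 F))"
    using X by (meson mult_left_mono norm2_nonneg order_trans)
  also have "\<dots> = (b\<^sup>2 * P powr (- 1 / (8 * 4 ^ n)) * norm2 F)\<^sup>2"
    using P by (simp add: power2_eq_square power4_eq_xxxx mult_ac flip: powr_add)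
  finally have "X \<le> b\<^sup>2 * P powr (- 1 / (8 * 4 ^ n)) * norm2 F"
    by (rule power2_le_imp_le) simp
  then show ?thesis by (simp add: X_def b_def P_def)
qed

end

section \<open>Counting points on hyperbolas\<close>

context hyperbola
begin

text \<open>With s = y1 - b1, a solution means y1 = s + b1 and y2 = b2 + rho / s, so both
  memberships in \<open>Y\<close> are tests of the indicator of \<open>Y\<close> at images of the
  point (s, 1). Subtracting its mean splits the count into the expected number and a correlation of
  mean-zero functions.\<close>

theorem card_hyperbola_le:
  fixes L :: real and Y :: "int set"
  assumes L: "L \<ge> 2" "L ^ 200000 \<le> card B" and J: "real_of_int p ^ 3 \<le> L ^ n" and Y: "Y \<subseteq> {0..<p}"
  shows "real (card {z \<in> (B \<times> B) \<times> (Y \<times> Y). [(fst (snd z) - fst (fst z)) * (snd (snd z) - snd (fst z)) = \<rho>] (mod p)})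
    \<le> (card B)\<^sup>2 * ((card Y)\<^sup>2 / p + real_of_int p powr (- 1 / (8 * 4 ^ n)) * card Y)"
proof -
  define P where "P = real_of_int p"
  have P: "P > 1" using p_gt_1 by (simp add: P_def)
  \<comment> \<open>The indicator of \<open>Y\<close> in the affine chart, extended by 0 at infinity
    and constantly along lines.\<close>
  define F0 :: "int \<times> int \<Rightarrow> real" where
    "F0 v = (if \<not> p dvd snd v \<and> (\<exists>t\<in>Y. [fst v = t * snd v] (mod p)) then 1 else 0)" for v
  define y where "y = real (card Y)"
  \<comment> \<open>The mean is taken over the p + 1 points of the projective line.\<close>
  define m where "m = y / (P + 1)"
  define F where "F v = F0 v - m" for v
  have finY: "finite Y" using Y by (rule finite_subset) simp
  have hom0: "homogeneous F0"
    unfolding homogeneous_def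
  proof (intro ballI allI impI)
    fix v t assume t: "\<not> p dvd t"
    have "[(t * fst v) mod p = s * ((t * snd v) mod p)] (mod p) \<longleftrightarrow> [fst v = s * snd v] (mod p)" for s
    proof -
      have "[(t * fst v) mod p = s * ((t * snd v) mod p)] (mod p) \<longleftrightarrow> [t * fst v = s * (t * snd v)] (mod p)"
        by (simp add: cong_def mod_mult_right_eq)
      also have "\<dots> \<longleftrightarrow> [t * fst v = t * (s * snd v)] (mod p)" by (simp add: mult.left_commute)
      finally show ?thesis using cong_mult_cancel[OF t] by simp
    qed
    then show "F0 (scale t v) = F0 v" using t by (simp add: F0_def scale_def dvd_mult_iff dvd_mod_iff)
  qed
  then have homF: "homogeneous F" by (simp add: homogeneous_def F_def)
  have F0_axis: "F0 (1, 0) = 0" by (simp add: F0_def)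
  have F0_1: "F0 (s, 1) = (if s \<in> Y then 1 else 0)" if "s \<in> {0..<p}" for s
  proof -
    have "[s = t] (mod p) \<longleftrightarrow> s = t" if "t \<in> Y" for t
      using residues_eq_iff_dvd[of s p t] \<open>s \<in> {0..<p}\<close> that Y by (auto simp: cong_iff_dvd_diff)
    then have "(\<exists>t\<in>Y. [s = t] (mod p)) \<longleftrightarrow> s \<in> Y" by auto
    then show ?thesis by (simp add: F0_def)
  qed
  have sumF0: "(\<Sum>v\<in>nz. F0 v) = (P - 1) * y"
  proof -
    have "(\<Sum>s\<in>{0..<p}. F0 (s, 1)) = (\<Sum>s\<in>{0..<p}. if s \<in> Y then 1 else 0)" by (rule sum.cong[OF refl F0_1])
    also have "\<dots> = y" using Y by (simp add: sum.If_cases Int_absorb1 y_def)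
    finally show ?thesis using sum_homogeneous[OF hom0] F0_axis by (simp add: P_def)
  qed
  have P2: "P\<^sup>2 - 1 = (P - 1) * (P + 1)" by (simp add: power2_eq_square algebra_simps)
  have cnz: "real (card nz) = (P - 1) * (P + 1)" by (simp add: card_nz P2 flip: P_def)
  have m: "m * (P + 1) = y" using P by (simp add: m_def)
  have sumF: "(\<Sum>v\<in>nz. F v) = 0"
    using m by (simp add: F_def sum_subtractf sumF0 cnz mult_ac)
  have normF: "norm2 F \<le> (P - 1) * y"
  proof -
    have "norm2 F = (\<Sum>v\<in>nz. F v * F0 v) - m * (\<Sum>v\<in>nz. F v)"
      by (simp add: norm2_def power2_eq_square sum_distrib_left flip: sum_subtractf) (simp add: F_def algebra_simps)
    also have "\<dots> = (\<Sum>v\<in>nz. F v * F0 v)" by (simp add: sumF)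
    also have "\<dots> \<le> (\<Sum>v\<in>nz. F0 v)"
    proof (rule sum_mono)
      fix v
      have "m \<ge> 0" using P by (simp add: m_def y_def)
      then show "F v * F0 v \<le> F0 v" by (simp add: F_def F0_def)
    qed
    finally show ?thesis by (simp add: sumF0)
  qed
  define G where "G v = (\<Sum>e\<in>B \<times> B. F0 (upper (fst e) \<langle>$\<rangle> v) * F0 (upper (snd e) \<langle>$\<rangle> (J \<langle>$\<rangle> v)))" for v
  have G0: "G v \<ge> 0" for v unfolding G_def by (intro sum_nonneg) (simp add: F0_def)
  have homG: "homogeneous G"
    unfolding homogeneous_def
  proof (intro ballI allI impI)
    fix v t assume v: "v \<in> nz" "\<not> p dvd t"
    have 1: "homogeneous (\<lambda>v. F0 (upper b \<langle>$\<rangle> v))" for b by (rule homogeneous_comp_GL[OF hom0 upper_GL])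
    have 2: "homogeneous (\<lambda>v. F0 (upper b \<langle>$\<rangle> (J \<langle>$\<rangle> v)))" for b by (rule homogeneous_comp_GL[OF 1 J_GL])
    show "G (scale t v) = G v"
      unfolding G_def
    proof (rule sum.cong[OF refl])
      fix e
      show "F0 (upper (fst e) \<langle>$\<rangle> (scale t v)) * F0 (upper (snd e) \<langle>$\<rangle> (J \<langle>$\<rangle> (scale t v))) =
          F0 (upper (fst e) \<langle>$\<rangle> v) * F0 (upper (snd e) \<langle>$\<rangle> (J \<langle>$\<rangle> v))"
        using 1[of "fst e"] 2[of "snd e"] v unfolding homogeneous_def by metis
    qed
  qed
  let ?C = "{z \<in> (B \<times> B) \<times> (Y \<times> Y). [(fst (snd z) - fst (fst z)) * (snd (snd z) - snd (fst z)) = \<rho>] (mod p)}"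
  have count: "real (card ?C) \<le> (\<Sum>s\<in>{0..<p}. G (s, 1))"
  proof -
    let ?D = "\<lambda>e. {s \<in> {0..<p}. F0 (upper (fst e) \<langle>$\<rangle> (s, 1)) = 1 \<and> F0 (upper (snd e) \<langle>$\<rangle> (J \<langle>$\<rangle> (s, 1))) = 1}"
    have finD: "finite (?D e)" for e by (rule finite_subset[of _ "{0..<p}"]) auto
    have "card ?C \<le> card (Sigma (B \<times> B) ?D)"
    proof (rule card_inj_on_le[where f = "\<lambda>z. (fst z, (fst (snd z) - fst (fst z)) mod p)"])
      show "inj_on (\<lambda>z. (fst z, (fst (snd z) - fst (fst z)) mod p)) ?C"
      proof (rule inj_onI)
        fix z z' assume z: "z \<in> ?C" "z' \<in> ?C"
          and eq: "(fst z, (fst (snd z) - fst (fst z)) mod p) = (fst z', (fst (snd z') - fst (fst z')) mod p)"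
        obtain b1 b2 y1 y2 where 1: "z = ((b1, b2), (y1, y2))" by (metis prod.collapse)
        obtain y1' y2' where 2: "z' = ((b1, b2), (y1', y2'))" using eq 1 by (metis Pair_inject prod.collapse)
        have Yeq: "a = a'" if "a \<in> Y" "a' \<in> Y" "p dvd a - a'" for a a'
          using residues_eq_iff_dvd that Y by (metis subsetD)
        have m: "y1 \<in> Y" "y1' \<in> Y" "y2 \<in> Y" "y2' \<in> Y" using z 1 2 by auto
        have "p dvd (y1 - b1) - (y1' - b1)" using eq 1 2 by (simp add: mod_eq_dvd_iff)
        then have y1: "y1 = y1'" using Yeq m by simp
        have c: "[(y1 - b1) * (y2 - b2) = \<rho>] (mod p)" "[(y1 - b1) * (y2' - b2) = \<rho>] (mod p)"
          using z 1 2 y1 by auto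
        have nd: "\<not> p dvd y1 - b1"
        proof
          assume "p dvd y1 - b1"
          then have "p dvd \<rho>" using c(1) by (metis cong_dvd_iff dvd_mult2)
          then show False using \<rho> by simp
        qed
        have "[y2 - b2 = y2' - b2] (mod p)"
          using cong_trans[OF c(1) cong_sym[OF c(2)]] cong_mult_cancel[OF nd] by simp
        then have "y2 = y2'" using Yeq m by (simp add: cong_iff_dvd_diff)
        then show "z = z'" using 1 2 y1 by simp
      qed
      show "(\<lambda>z. (fst z, (fst (snd z) - fst (fst z)) mod p)) ` ?C \<subseteq> Sigma (B \<times> B) ?D"
      proof (rule image_subsetI)
        fix z assume z: "z \<in> ?C"
        obtain b1 b2 y1 y2 where 1: "z = ((b1, b2), (y1, y2))" by (metis prod.collapse)
        have mem: "b1 \<in> B" "b2 \<in> B" "y1 \<in> Y" "y2 \<in> Y" and c: "[(y1 - b1) * (y2 - b2) = \<rho>] (mod p)" using z 1 by auto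
        define s where "s = (y1 - b1) mod p"
        have s: "s \<in> {0..<p}" using p_gt_1 by (simp add: s_def)
        have s1: "(s, 1) \<in> vecs" using s p_gt_1 by (simp add: vecs_def)
        have sc: "[s = y1 - b1] (mod p)" by (simp add: s_def cong_def)
        have "[s * (y2 - b2) = \<rho>] (mod p)" using cong_trans[OF cong_mult[OF sc cong_refl] c] .
        then have "p dvd s * (y2 - b2) - \<rho>" by (simp add: cong_iff_dvd_diff)
        then have "p dvd - (s * (y2 - b2) - \<rho>)" by (simp only: dvd_minus_iff)
        then have d: "p dvd (\<rho> + b2 * s) - y2 * s" by (simp add: algebra_simps)
        have ns: "\<not> p dvd s"
        proof
          assume "p dvd s"
          then have "p dvd \<rho>" using \<open>[s * (y2 - b2) = \<rho>] (mod p)\<close> by (metis cong_dvd_iff dvd_mult2)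
          then show False using \<rho> by simp
        qed
        have "upper b1 \<langle>$\<rangle> (s, 1) = ((s + b1) mod p, 1)"
          unfolding upper_def using s1 p_gt_1 by (subst apply_lin) (auto simp: lin_fun_def)
        moreover have "(s + b1) mod p = y1"
          using Y mem by (auto simp: s_def mod_simps)
        moreover have "y1 \<in> {0..<p}" using Y mem by blast
        ultimately have A1: "F0 (upper b1 \<langle>$\<rangle> (s, 1)) = 1" using F0_1[of y1] mem by simp
        have "J \<langle>$\<rangle> (s, 1) = (\<rho> mod p, s)"
          unfolding J_def using s s1 by (subst apply_lin[OF det_J]) (auto simp: lin_fun_def)
        moreover have "upper b2 \<langle>$\<rangle> (\<rho> mod p, s) = ((\<rho> + b2 * s) mod p, s)"
          unfolding upper_def using s p_gt_1 by (subst apply_lin) (auto simp: lin_fun_def vecs_def mod_simps)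
        moreover have "[(\<rho> + b2 * s) mod p = \<rho> + b2 * s] (mod p)" by (simp add: cong_def)
        then have "[(\<rho> + b2 * s) mod p = y2 * s] (mod p)" using d by (meson cong_iff_dvd_diff cong_trans)
        ultimately have A2: "F0 (upper b2 \<langle>$\<rangle> (J \<langle>$\<rangle> (s, 1))) = 1" using ns mem by (auto simp: F0_def)
        show "(fst z, (fst (snd z) - fst (fst z)) mod p) \<in> Sigma (B \<times> B) ?D"
          using A1 A2 s mem by (simp add: 1 flip: s_def)
      qed
      show "finite (Sigma (B \<times> B) ?D)"
        by (intro finite_SigmaI finite_cartesian_product finite_B finD)
    qed
    also have "\<dots> = (\<Sum>e\<in>B \<times> B. card (?D e))" by (intro card_SigmaI ballI finD) simp
    finally have "real (card ?C) \<le> (\<Sum>e\<in>B \<times> B. real (card (?D e)))" by (simp flip: of_nat_sum)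
    also have "\<dots> = (\<Sum>e\<in>B \<times> B. \<Sum>s\<in>{0..<p}. F0 (upper (fst e) \<langle>$\<rangle> (s, 1)) * F0 (upper (snd e) \<langle>$\<rangle> (J \<langle>$\<rangle> (s, 1))))"
    proof (rule sum.cong[OF refl])
      fix e
      have "F0 v * F0 w = (if F0 v = 1 \<and> F0 w = 1 then 1 else 0)" for v w by (simp add: F0_def)
      then show "real (card (?D e)) = (\<Sum>s\<in>{0..<p}. F0 (upper (fst e) \<langle>$\<rangle> (s, 1)) * F0 (upper (snd e) \<langle>$\<rangle> (J \<langle>$\<rangle> (s, 1))))"
        by (simp add: sum.If_cases Int_def)
    qed
    also have "\<dots> = (\<Sum>s\<in>{0..<p}. G (s, 1))" unfolding G_def by (rule sum.swap)
    finally show ?thesis .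
  qed
  \<comment> \<open>Adding the non-negative value at infinity turns the sum over the affine chart
    into one over the whole projective line, on which the group acts.\<close>
  have "(P - 1) * card ?C \<le> (P - 1) * (G (1, 0) + (\<Sum>s\<in>{0..<p}. G (s, 1)))"
    using count G0[of "(1, 0)"] P by (intro mult_left_mono) auto
  also have "\<dots> = (\<Sum>v\<in>nz. G v)" using sum_homogeneous[OF homG] by (simp add: P_def)
  also have "\<dots> = (\<Sum>e\<in>B \<times> B. \<Sum>v\<in>nz. F0 (upper (fst e) \<langle>$\<rangle> v) * F0 (upper (snd e) \<langle>$\<rangle> (J \<langle>$\<rangle> v)))"
    unfolding G_def by (rule sum.swap)
  also have "\<dots> = (\<Sum>e\<in>B \<times> B. (\<Sum>v\<in>nz. F (upper (fst e) \<langle>$\<rangle> v) * F (upper (snd e) \<langle>$\<rangle> (J \<langle>$\<rangle> v))) + m\<^sup>2 * card nz)"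
  proof (rule sum.cong[OF refl])
    fix e
    have 1: "(\<Sum>v\<in>nz. F (upper b \<langle>$\<rangle> v)) = 0" for b using sum_GL[OF upper_GL, of F b] sumF by simp
    have 2: "(\<Sum>v\<in>nz. F (upper b \<langle>$\<rangle> (J \<langle>$\<rangle> v))) = 0" for b
      using sum_GL[OF J_GL, of "\<lambda>v. F (upper b \<langle>$\<rangle> v)"] 1 by simp
    have "F0 v * F0 w = F v * F w + m * F v + m * F w + m\<^sup>2" for v w by (simp add: F_def power2_eq_square algebra_simps)
    then have "(\<Sum>v\<in>nz. F0 (upper (fst e) \<langle>$\<rangle> v) * F0 (upper (snd e) \<langle>$\<rangle> (J \<langle>$\<rangle> v))) =
        (\<Sum>v\<in>nz. F (upper (fst e) \<langle>$\<rangle> v) * F (upper (snd e) \<langle>$\<rangle> (J \<langle>$\<rangle> v))) +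
        m * (\<Sum>v\<in>nz. F (upper (fst e) \<langle>$\<rangle> v)) + m * (\<Sum>v\<in>nz. F (upper (snd e) \<langle>$\<rangle> (J \<langle>$\<rangle> v))) + m\<^sup>2 * card nz"
      by (simp add: sum.distrib sum_distrib_left)
    then show "(\<Sum>v\<in>nz. F0 (upper (fst e) \<langle>$\<rangle> v) * F0 (upper (snd e) \<langle>$\<rangle> (J \<langle>$\<rangle> v))) =
        (\<Sum>v\<in>nz. F (upper (fst e) \<langle>$\<rangle> v) * F (upper (snd e) \<langle>$\<rangle> (J \<langle>$\<rangle> v))) + m\<^sup>2 * card nz"
      by (simp add: 1 2)
  qed
  also have "\<dots> = (\<Sum>e\<in>B \<times> B. \<Sum>v\<in>nz. F (upper (fst e) \<langle>$\<rangle> v) * F (upper (snd e) \<langle>$\<rangle> (J \<langle>$\<rangle> v))) + (card B)\<^sup>2 * (m\<^sup>2 * card nz)"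
    by (simp add: sum.distrib card_cartesian_product power2_eq_square)
  also have "\<dots> \<le> (card B)\<^sup>2 * P powr (- 1 / (8 * 4 ^ n)) * norm2 F + (card B)\<^sup>2 * (m\<^sup>2 * card nz)"
    using correlation_le[OF L J homF sumF] by (simp add: P_def)
  also have "\<dots> \<le> (card B)\<^sup>2 * P powr (- 1 / (8 * 4 ^ n)) * ((P - 1) * y) + (card B)\<^sup>2 * ((P - 1) * (y\<^sup>2 / P))"
  proof (intro add_mono mult_left_mono normF)
    have "m\<^sup>2 * card nz = (P - 1) * (m * (m * (P + 1)))" by (simp add: cnz power2_eq_square)
    also have "\<dots> = (P - 1) * (y\<^sup>2 / (P + 1))" unfolding m by (simp add: m_def power2_eq_square)
    also have "\<dots> \<le> (P - 1) * (y\<^sup>2 / P)" using P by (intro mult_left_mono divide_left_mono) auto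
    finally show "m\<^sup>2 * card nz \<le> (P - 1) * (y\<^sup>2 / P)" .
  qed auto
  also have "\<dots> = (P - 1) * ((card B)\<^sup>2 * (y\<^sup>2 / P + P powr (- 1 / (8 * 4 ^ n)) * y))" by (simp add: algebra_simps)
  finally have "card ?C \<le> (card B)\<^sup>2 * (y\<^sup>2 / P + P powr (- 1 / (8 * 4 ^ n)) * y)" using P by simp
  then show ?thesis by (simp add: y_def P_def)
qed

end

section \<open>From the sumset hypotheses to hyperbolas\<close>

lemma residue_ring_sumset:
  "X <+>\<^bsub>residue_ring m\<^esub> Y = {(x + y) mod m | x y. x \<in> X \<and> y \<in> Y}"
  by (auto simp: set_add_defs residue_ring_def)

text \<open>The size of \<open>Y\<close> enters only through |Y| <= |X| |B + B|, and the bound for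
  hyperbolas increases with |Y|; so any majorant \<open>y\<close> may be inserted.\<close>

lemma prod_eq_card_le:
  fixes p :: nat and A X B :: "int set" and L :: real
  assumes p: "prime p" and A: "A \<subseteq> carrier (prime_field p)" and X: "X \<subseteq> carrier (prime_field p)"
    and B: "B \<subseteq> carrier (prime_field p)" "B \<noteq> {}" and cover: "A \<subseteq> X <+>\<^bsub>prime_field p\<^esub> B"
    and \<rho>: "\<rho> \<in> carrier (prime_field p)" "\<rho> \<noteq> \<zero>\<^bsub>prime_field p\<^esub>"
    and L: "L \<ge> 2" "L ^ 200000 \<le> card B" "real p ^ 3 \<le> L ^ n"
    and y: "real (card X) * real (card (B <+>\<^bsub>prime_field p\<^esub> B)) \<le> y"
  shows "real (card (A \<inter> scaled_inverse_set (prime_field p) \<rho> A)) \<le> y\<^sup>2 / p + real p powr (- 1 / (8 * 4 ^ n)) * y"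
proof -
  define P where "P = int p"
  have prP: "prime P" using p by (simp add: P_def)
  then have P1: "P > 1" by (simp add: prime_gt_1_int)
  interpret R: residues_prime p "prime_field p"
    by unfold_locales (use p in auto)
  have carr: "carrier (prime_field p) = {0..<P}" by (auto simp: residue_ring_def P_def)
  have zero: "\<zero>\<^bsub>prime_field p\<^esub> = 0" by (simp add: residue_ring_def)
  have \<rho>P: "\<not> P dvd \<rho>" using \<rho> carr zero by (auto simp: zdvd_not_zless)
  interpret H: hyperbola P \<rho> B
    by unfold_locales (use prP \<rho>P B carr in auto)
  define S where "S = B <+>\<^bsub>prime_field p\<^esub> B"
  define Y where "Y = X <+>\<^bsub>prime_field p\<^esub> S"
  have finX: "finite X" using X carr by (auto intro: finite_subset)
  have finA: "finite A" using A carr by (auto intro: finite_subset)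
  have S_eq: "S = (\<lambda>(x, y). (x + y) mod P) ` (B \<times> B)" by (auto simp: S_def residue_ring_sumset P_def)
  have Y_eq: "Y = (\<lambda>(x, y). (x + y) mod P) ` (X \<times> S)" by (auto simp: Y_def residue_ring_sumset P_def)
  have finS: "finite S" by (simp add: S_eq)
  have YP: "Y \<subseteq> {0..<P}" using P1 by (auto simp: Y_eq)
  have "card Y \<le> card (X \<times> S)" unfolding Y_eq using finX finS by (intro card_image_le) auto
  then have "real (card Y) \<le> real (card X) * real (card S)" by (simp add: card_cartesian_product flip: of_nat_mult)
  then have cY: "real (card Y) \<le> y" using y by (simp add: S_def)
  have shift: "(a + b) mod P \<in> Y" if ab: "a \<in> A" "b \<in> B" for a b
  proof -
    obtain x c where a: "a = (x + c) mod P" "x \<in> X" "c \<in> B"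
      using cover ab(1) unfolding residue_ring_sumset P_def by blast
    have "(c + b) mod P \<in> S" using a(3) ab(2) by (auto simp: S_eq)
    then have "(x + (c + b) mod P) mod P \<in> Y" using a(2) by (auto simp: Y_eq)
    also have "(x + (c + b) mod P) mod P = (a + b) mod P" by (simp add: a(1) mod_simps add.assoc)
    finally show ?thesis .
  qed
  define N where "N = {z \<in> A \<times> A. fst z \<otimes>\<^bsub>prime_field p\<^esub> snd z = \<rho>}"
  have finN: "finite N" using finA by (simp add: N_def)
  have N: "card (A \<inter> scaled_inverse_set (prime_field p) \<rho> A) = card N"
  proof -
    have "{(a, b) \<in> A \<times> A. a \<otimes>\<^bsub>prime_field p\<^esub> b = \<rho>} = N" by (auto simp: N_def)
    then show ?thesis using R.card_Int_scaled_inverse_set[OF A \<rho>] by simp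
  qed
  let ?C = "{z \<in> (B \<times> B) \<times> (Y \<times> Y). [(fst (snd z) - fst (fst z)) * (snd (snd z) - snd (fst z)) = \<rho>] (mod P)}"
  have "finite Y" using YP by (rule finite_subset) simp
  then have finC: "finite ?C" using H.finite_B by (intro finite_subset[of ?C "(B \<times> B) \<times> (Y \<times> Y)"]) auto
  have "card (N \<times> (B \<times> B)) \<le> card ?C"
  proof (rule card_inj_on_le[where f = "\<lambda>(a, b). (b, ((fst a + fst b) mod P, (snd a + snd b) mod P))"])
    show "inj_on (\<lambda>(a, b). (b, ((fst a + fst b) mod P, (snd a + snd b) mod P))) (N \<times> (B \<times> B))"
    proof (rule inj_onI)
      fix z z' assume z: "z \<in> N \<times> (B \<times> B)" "z' \<in> N \<times> (B \<times> B)"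
        and eq: "(case z of (a, b) \<Rightarrow> (b, ((fst a + fst b) mod P, (snd a + snd b) mod P))) =
          (case z' of (a, b) \<Rightarrow> (b, ((fst a + fst b) mod P, (snd a + snd b) mod P)))"
      obtain a1 a2 b where 1: "z = ((a1, a2), b)" by (metis prod.collapse)
      obtain a1' a2' where 2: "z' = ((a1', a2'), b)" using eq 1 by (cases z') auto
      have "a1 \<in> {0..<P}" "a1' \<in> {0..<P}" "a2 \<in> {0..<P}" "a2' \<in> {0..<P}"
        using z 1 2 A carr by (auto simp: N_def)
      moreover have "P dvd a1 - a1'" "P dvd a2 - a2'" using eq 1 2 by (auto simp: mod_eq_dvd_iff)
      ultimately have "a1 = a1'" "a2 = a2'" using residues_eq_iff_dvd by blast+
      then show "z = z'" using 1 2 by simp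
    qed
    show "(\<lambda>(a, b). (b, ((fst a + fst b) mod P, (snd a + snd b) mod P))) ` (N \<times> (B \<times> B)) \<subseteq> ?C"
    proof (rule image_subsetI)
      fix z assume z: "z \<in> N \<times> (B \<times> B)"
      obtain a1 a2 b1 b2 where 1: "z = ((a1, a2), (b1, b2))" by (metis prod.collapse)
      have mem: "a1 \<in> A" "a2 \<in> A" "b1 \<in> B" "b2 \<in> B" and prod: "(a1 * a2) mod P = \<rho>"
        using z 1 by (auto simp: N_def residue_ring_def P_def)
      have "[((a1 + b1) mod P - b1) * ((a2 + b2) mod P - b2) = (a1 + b1 - b1) * (a2 + b2 - b2)] (mod P)"
        by (intro cong_mult cong_diff) (simp_all add: cong_def)
      also have "[(a1 + b1 - b1) * (a2 + b2 - b2) = \<rho>] (mod P)" using prod by (auto simp: cong_def)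
      finally show "(case z of (a, b) \<Rightarrow> (b, ((fst a + fst b) mod P, (snd a + snd b) mod P))) \<in> ?C"
        using mem shift by (simp add: 1)
    qed
  qed (rule finC)
  then have "real (card N * card (B \<times> B)) \<le> real (card ?C)" by (simp only: card_cartesian_product of_nat_le_iff)
  also have "\<dots> \<le> (card B)\<^sup>2 * ((card Y)\<^sup>2 / P + real_of_int P powr (- 1 / (8 * 4 ^ n)) * card Y)"
    by (rule H.card_hyperbola_le[OF L(1,2) _ YP]) (use L(3) in \<open>simp add: P_def\<close>)
  also have "\<dots> \<le> (card B)\<^sup>2 * (y\<^sup>2 / P + real_of_int P powr (- 1 / (8 * 4 ^ n)) * y)"
    using cY P1 by (intro mult_left_mono add_mono divide_right_mono) (auto intro: power_mono)
  finally have "(real (card B))\<^sup>2 * real (card N) \<le> (real (card B))\<^sup>2 * (y\<^sup>2 / P + real_of_int P powr (- 1 / (8 * 4 ^ n)) * y)"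
    by (simp add: card_cartesian_product power2_eq_square mult_ac)
  then have "real (card N) \<le> y\<^sup>2 / P + real_of_int P powr (- 1 / (8 * 4 ^ n)) * y"
    using H.card_B_pos by (subst (asm) mult_le_cancel_left_pos) auto
  then show ?thesis by (simp add: N P_def)
qed

section \<open>Choice of the constants\<close>

lemma four_power_ceiling_le:
  fixes M \<epsilon> \<delta> :: real
  assumes M: "M \<ge> 0" and \<epsilon>: "0 < \<epsilon>" "\<epsilon> \<le> 1" and \<delta>: "\<delta> \<le> 1 / 4 * (8 * 4 powr M) powr (- 1 / \<epsilon>)"
  shows "\<delta> \<le> 1 / (8 * 4 ^ nat \<lceil>M / \<epsilon>\<rceil>)"
proof -
  define n where "n = nat \<lceil>M / \<epsilon>\<rceil>"
  \<comment> \<open>Rounding up costs a factor 4, matched by the factor 1 / 4 in the bound on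
    \<open>\<delta>\<close>; the factor 8 moves into the base because 1 <= 1 /
    \<open>\<epsilon>\<close>.\<close>
  have "real n \<le> M / \<epsilon> + 1" using M \<epsilon> by (simp add: n_def of_nat_nat)
  then have "4 powr real n \<le> 4 powr (M / \<epsilon> + 1)" by simp
  also have "\<dots> = 4 * (4 powr M) powr (1 / \<epsilon>)" by (simp add: powr_add powr_powr)
  finally have n: "4 ^ n \<le> 4 * (4 powr M) powr (1 / \<epsilon>)" by (simp add: powr_realpow)
  have "8 powr 1 \<le> (8::real) powr (1 / \<epsilon>)" using \<epsilon> by (intro powr_mono) auto
  then have "8 * (4 powr M) powr (1 / \<epsilon>) \<le> 8 powr (1 / \<epsilon>) * (4 powr M) powr (1 / \<epsilon>)" by (intro mult_right_mono) auto
  also have "\<dots> = (8 * 4 powr M) powr (1 / \<epsilon>)" by (simp add: powr_mult)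
  finally have "8 * 4 ^ n \<le> 4 * (8 * 4 powr M) powr (1 / \<epsilon>)" using n by linarith
  then have "1 / (4 * (8 * 4 powr M) powr (1 / \<epsilon>)) \<le> 1 / (8 * 4 ^ n)" by (intro divide_left_mono) auto
  moreover have "1 / 4 * (8 * 4 powr M) powr (- 1 / \<epsilon>) = 1 / (4 * (8 * 4 powr M) powr (1 / \<epsilon>))"
    by (simp add: powr_minus_divide)
  ultimately show ?thesis using \<delta> by (simp add: n_def)
qed

text \<open>This makes \<open>\<delta>\<close> at most \<open>\<epsilon>\<close>, so that p^delta is
  bounded whenever p^epsilon is. It rests on x <= exp x at x = 1 /
  \<open>\<epsilon>\<close>.\<close>

lemma powr_inverse_le_self:
  fixes b \<epsilon> :: real
  assumes "b \<ge> 8" "\<epsilon> > 0"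
  shows "1 / 4 * b powr (- 1 / \<epsilon>) \<le> \<epsilon>"
proof -
  have "exp 1 \<le> b" using exp_le assms(1) by linarith
  have "1 / \<epsilon> \<le> exp (1 / \<epsilon>)" using exp_ge_add_one_self[of "1 / \<epsilon>"] by linarith
  also have "\<dots> = exp 1 powr (1 / \<epsilon>)" by (simp add: powr_def)
  also have "\<dots> \<le> b powr (1 / \<epsilon>)" using assms \<open>exp 1 \<le> b\<close> by (intro powr_mono2) auto
  finally have "1 / b powr (1 / \<epsilon>) \<le> \<epsilon>" using assms by (simp add: field_simps)
  moreover have "b powr (- 1 / \<epsilon>) = 1 / b powr (1 / \<epsilon>)" by (simp add: powr_minus_divide)
  moreover have "0 \<le> 1 / b powr (1 / \<epsilon>)" by simp
  ultimately show ?thesis by linarith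
qed

text \<open>In \<open>C\<^sub>2\<close>, the terms \<open>C\<^sub>1\<^sup>2\<close> and
  \<open>C\<^sub>1\<close> come from y^2 / p and y / p^delta, and \<open>2 ^ K\<close> pays for the
  case of bounded p^epsilon. In \<open>b\<^sub>0\<close>, the factor 8 is that of
  \<open>correlation_le\<close>, and 3 K / epsilon, rounded up, is the least n with L^n at least
  p^3.\<close>

lemma card_Int_scaled_inverse_set_le:
  fixes \<kappa> \<epsilon> \<delta> \<sigma> C\<^sub>1 :: real and K p :: nat and A X B :: "int set" and \<rho> :: int
  defines "b\<^sub>0 \<equiv> 8 * 4 powr (3 * real K)" and "C\<^sub>2 \<equiv> C\<^sub>1\<^sup>2 + C\<^sub>1 + 2 ^ K"
  assumes K: "K = 200000" and C1: "C\<^sub>1 > 0"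
    and \<kappa>: "0 < \<kappa>" and \<epsilon>: "\<epsilon> > 0" and \<delta>: "\<delta> \<le> 1 / 4 * b\<^sub>0 powr (- 1 / \<epsilon>)" and p: "prime p"
    and A: "A \<subseteq> carrier (prime_field p)" and X: "X \<subseteq> carrier (prime_field p)" and B: "B \<subseteq> carrier (prime_field p)"
    and cover: "A \<subseteq> X <+>\<^bsub>prime_field p\<^esub> B"
    and \<sigma>: "real (card (B <+>\<^bsub>prime_field p\<^esub> B)) \<le> \<sigma> * real (card B)"
    and big: "real (card B) \<ge> real p powr \<epsilon>"
    and cX: "real (card X) \<le> C\<^sub>1 * (real (card A) / real (card B)) * real (card B) powr \<kappa>"
    and \<rho>: "\<rho> \<in> carrier (prime_field p)" "\<rho> \<noteq> \<zero>\<^bsub>prime_field p\<^esub>"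
  shows "real (card (A \<inter> scaled_inverse_set (prime_field p) \<rho> A)) \<le> C\<^sub>2 * max
    (\<sigma>\<^sup>2 * (real (card A))\<^sup>2 * real (card B) powr (2 * \<kappa>) / real p)
    (\<sigma> * real (card A) * real (card B) powr \<kappa> / real p powr \<delta>)"
proof -
  have K0: "K > 0" by (simp add: K)
  define M where "M = 3 * real K"
  have "4 powr M \<ge> 1" by (simp add: M_def ge_one_powr_ge_zero)
  then have b0: "b\<^sub>0 \<ge> 8" by (simp add: b\<^sub>0_def M_def)
  define a where "a = real (card A)"
  define b where "b = real (card B)"
  define P where "P = real p"
  define M1 where "M1 = \<sigma>\<^sup>2 * a\<^sup>2 * b powr (2 * \<kappa>) / P"
  define M2 where "M2 = \<sigma> * a * b powr \<kappa> / P powr \<delta>"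
  have P: "P > 1" using prime_gt_1_nat[OF p] by (simp add: P_def)
  have carr: "carrier (prime_field p) = {0..<int p}" by (auto simp: residue_ring_def)
  have fin: "finite A" "finite B" using A B carr by (auto intro: finite_subset)
  have "0 < P powr \<epsilon>" using P by simp
  then have b_pos: "b > 0" using big unfolding b_def P_def by linarith
  then have b1: "b \<ge> 1" by (simp add: b_def)
  have Bne: "B \<noteq> {}" using b_pos by (auto simp: b_def)
  have "card B \<le> p" using card_mono[OF _ B] carr by simp
  then have bP: "b \<le> P" by (simp add: b_def P_def)
  \<comment> \<open>Larger values are ruled out by |B| <= p; \<open>four_power_ceiling_le\<close>
    relies on this.\<close>
  have \<epsilon>1: "\<epsilon> \<le> 1"
  proof (rule ccontr)
    assume "\<not> \<epsilon> \<le> 1"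
    then have "P powr 1 < P powr \<epsilon>" using P by (intro powr_less_mono) auto
    then show False using big bP P by (simp add: b_def P_def)
  qed
  \<comment> \<open>A single translate of \<open>B\<close> already puts |B| elements into the
    sumset; in particular the majorant \<open>y\<close> and \<open>M2\<close> are
    non-negative.\<close>
  have \<sigma>1: "\<sigma> \<ge> 1"
  proof -
    obtain b' where b': "b' \<in> B" using Bne by blast
    have "inj_on (\<lambda>x. (x + b') mod int p) B"
    proof (rule inj_onI)
      fix x y assume xy: "x \<in> B" "y \<in> B" "(x + b') mod int p = (y + b') mod int p"
      then have "x \<in> {0..<int p}" "y \<in> {0..<int p}" using B carr by auto
      then show "x = y" using residues_eq_iff_dvd[of x "int p" y] xy(3) by (simp add: mod_eq_dvd_iff)
    qed
    moreover have "(\<lambda>x. (x + b') mod int p) ` B \<subseteq> B <+>\<^bsub>prime_field p\<^esub> B"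
      using b' by (auto simp: residue_ring_sumset)
    moreover have "finite (B <+>\<^bsub>prime_field p\<^esub> B)"
    proof -
      have "B <+>\<^bsub>prime_field p\<^esub> B = (\<lambda>(x, y). (x + y) mod int p) ` (B \<times> B)" by (auto simp: residue_ring_sumset)
      then show ?thesis using fin by simp
    qed
    ultimately have "card B \<le> card (B <+>\<^bsub>prime_field p\<^esub> B)" by (rule card_inj_on_le)
    then have "1 * b \<le> \<sigma> * b" using \<sigma> by (simp add: b_def)
    then show ?thesis using b_pos by (simp only: mult_le_cancel_right_pos)
  qed
  have M1: "M1 \<ge> 0" using P by (simp add: M1_def)
  have M2: "M2 \<ge> 0" using \<sigma>1 by (simp add: M2_def a_def)
  \<comment> \<open>Chosen so that \<open>L ^ K\<close> is p^epsilon, hence at most |B|.\<close>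
  define L where "L = P powr (\<epsilon> / K)"
  have LK: "L ^ K = P powr \<epsilon>" using P K0 by (simp add: L_def powr_power)
  have "real (card (A \<inter> scaled_inverse_set (prime_field p) \<rho> A)) \<le> C\<^sub>2 * max M1 M2"
  proof (cases "L \<ge> 2")
    case True
    define n where "n = nat \<lceil>M / \<epsilon>\<rceil>"
    define y where "y = C\<^sub>1 * \<sigma> * a * b powr \<kappa>"
    have Ln: "P ^ 3 \<le> L ^ n"
    proof -
      have "M / \<epsilon> \<le> real n" by (simp add: n_def real_nat_ceiling_ge)
      then have "M \<le> \<epsilon> * n" using \<epsilon> by (simp add: field_simps)
      then have "3 \<le> \<epsilon> / K * n" using K0 by (simp add: M_def field_simps)
      then have "P powr 3 \<le> P powr (\<epsilon> / K * n)" using P by (intro powr_mono) auto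
      moreover have "P powr 3 = P ^ 3" using powr_realpow[of P 3] P by simp
      moreover have "P powr (\<epsilon> / K * n) = L ^ n" using P by (simp add: L_def powr_power mult.commute)
      ultimately show ?thesis by simp
    qed
    have Lb: "L ^ 200000 \<le> card B" using LK big unfolding K P_def by simp
    have "real (card X) * real (card (B <+>\<^bsub>prime_field p\<^esub> B)) \<le> (C\<^sub>1 * (a / b) * b powr \<kappa>) * (\<sigma> * b)"
      using cX \<sigma> C1 b_pos by (intro mult_mono) (auto simp: a_def b_def)
    also have "\<dots> = y" using b_pos by (simp add: y_def)
    finally have y: "real (card X) * real (card (B <+>\<^bsub>prime_field p\<^esub> B)) \<le> y" .
    have y0: "y \<ge> 0" using C1 \<sigma>1 by (simp add: y_def a_def)
    have \<delta>n: "P powr (- 1 / (8 * 4 ^ n)) \<le> 1 / P powr \<delta>"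
    proof -
      have "\<delta> \<le> 1 / (8 * 4 ^ n)"
        unfolding n_def using \<delta> \<epsilon> \<epsilon>1 by (intro four_power_ceiling_le) (auto simp: b\<^sub>0_def M_def)
      then have "P powr (- 1 / (8 * 4 ^ n)) \<le> P powr (- \<delta>)" using P by (intro powr_mono) auto
      then show ?thesis by (simp add: powr_minus_divide)
    qed
    have "real (card (A \<inter> scaled_inverse_set (prime_field p) \<rho> A)) \<le> y\<^sup>2 / P + P powr (- 1 / (8 * 4 ^ n)) * y"
      unfolding P_def by (rule prod_eq_card_le[OF p A X B Bne cover \<rho> True Lb _ y]) (use Ln in \<open>simp add: P_def\<close>)
    also have "\<dots> \<le> y\<^sup>2 / P + 1 / P powr \<delta> * y"
      using \<delta>n y0 by (intro add_left_mono mult_right_mono) auto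
    also have "y\<^sup>2 / P = C\<^sub>1\<^sup>2 * M1"
      using b_pos by (simp add: y_def M1_def power_mult_distrib powr_power mult_ac)
    also have "1 / P powr \<delta> * y = C\<^sub>1 * M2" by (simp add: y_def M2_def)
    also have "C\<^sub>1\<^sup>2 * M1 + C\<^sub>1 * M2 \<le> C\<^sub>1\<^sup>2 * max M1 M2 + C\<^sub>1 * max M1 M2"
      using C1 by (intro add_mono mult_left_mono) auto
    also have "\<dots> \<le> C\<^sub>2 * max M1 M2"
      using M1 by (simp add: C\<^sub>2_def distrib_right le_max_iff_disj)
    finally show ?thesis .
  next
    case False
    \<comment> \<open>Now p^epsilon, and with it p^delta, is bounded by an absolute constant, so the
      trivial bound |A| suffices.\<close>
    have "L ^ K \<le> 2 ^ K" using False P by (intro power_mono) (auto simp: L_def)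
    then have P\<epsilon>: "P powr \<epsilon> \<le> 2 ^ K" by (simp add: LK)
    have "\<delta> \<le> \<epsilon>" using \<delta> powr_inverse_le_self[OF b0 \<epsilon>] by linarith
    then have "P powr \<delta> \<le> P powr \<epsilon>" using P by (intro powr_mono) auto
    then have P\<delta>: "P powr \<delta> \<le> 2 ^ K" using P\<epsilon> by linarith
    have "card (A \<inter> scaled_inverse_set (prime_field p) \<rho> A) \<le> card A" using fin by (intro card_mono) auto
    then have "real (card (A \<inter> scaled_inverse_set (prime_field p) \<rho> A)) \<le> 1 * a * 1" by (simp add: a_def)
    also have "\<dots> \<le> \<sigma> * a * b powr \<kappa>"
      using \<sigma>1 b1 \<kappa> by (intro mult_mono) (auto simp: a_def ge_one_powr_ge_zero)
    also have "\<dots> = P powr \<delta> * M2" using P by (simp add: M2_def)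
    also have "\<dots> \<le> 2 ^ K * max M1 M2" using P\<delta> M2 by (intro mult_mono) auto
    also have "\<dots> \<le> C\<^sub>2 * max M1 M2" using C1 M1 by (intro mult_right_mono) (auto simp: C\<^sub>2_def)
    finally show ?thesis .
  qed
  then show ?thesis by (simp add: M1_def M2_def a_def b_def P_def)
qed

theorem corollary2:
  shows "\<exists>b\<^sub>0::real. b\<^sub>0 > 1 \<and>
    (\<forall>C\<^sub>1::real. C\<^sub>1 > 0 \<longrightarrow>
      (\<exists>C\<^sub>2::real. C\<^sub>2 > 0 \<and>
        (\<forall>(\<kappa>::real) (\<epsilon>::real) (\<delta>::real) (\<sigma>::real) (p::nat)
            (A::int set) (X::int set) (B::int set) (\<rho>::int).
          0 < \<kappa> \<longrightarrow> \<kappa> < 1 \<longrightarrow> \<epsilon> > 0 \<longrightarrow> \<delta> \<le> 1 / 4 * b\<^sub>0 powr (- 1 / \<epsilon>) \<longrightarrow>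
          prime p \<longrightarrow>
          A \<subseteq> carrier (prime_field p) \<longrightarrow>
          X \<subseteq> carrier (prime_field p) \<longrightarrow>
          B \<subseteq> carrier (prime_field p) \<longrightarrow>
          A \<subseteq> X <+>\<^bsub>prime_field p\<^esub> B \<longrightarrow>
          real (card (B <+>\<^bsub>prime_field p\<^esub> B)) \<le> \<sigma> * real (card B) \<longrightarrow>
          real (card B) \<ge> real p powr \<epsilon> \<longrightarrow>
          real (card X) \<le> C\<^sub>1 * (real (card A) / real (card B)) * real (card B) powr \<kappa> \<longrightarrow>
          \<rho> \<in> carrier (prime_field p) \<longrightarrow>
          \<rho> \<noteq> \<zero>\<^bsub>prime_field p\<^esub> \<longrightarrow>
          real (card (A \<inter> scaled_inverse_set (prime_field p) \<rho> A))
            \<le> C\<^sub>2 * max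
                (\<sigma>\<^sup>2 * (real (card A))\<^sup>2 * real (card B) powr (2 * \<kappa>) / real p)
                (\<sigma> * real (card A) * real (card B) powr \<kappa> / real p powr \<delta>))))"
proof -
  \<comment> \<open>kept opaque, so that no power with this exponent is evaluated\<close>
  obtain K :: nat where K: "K = 200000" by blast
  have "(4::real) powr (3 * real K) \<ge> 1" by (simp add: ge_one_powr_ge_zero)
  then have b0: "8 * 4 powr (3 * real K) > (1::real)" by linarith
  have pos: "C\<^sub>1 > 0 \<Longrightarrow> C\<^sub>1\<^sup>2 + C\<^sub>1 + 2 ^ K > 0" for C\<^sub>1 :: real
    by (intro add_pos_pos) auto
  show ?thesis
    by (rule exI, rule conjI, rule b0, intro allI impI, rule exI, rule conjI, erule pos, intro allI impI,
        rule card_Int_scaled_inverse_set_le[OF K]; assumption)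
qed

end
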